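(* Let $(X,x)$ be a pointed (cubical) Kan complex and let $n \geq 2$. If $X$ is $(n-1)$-connected, then the Hurewicz homomorphism \[ \pi_n(X,x) \to \tilde{H}_n(X,x) \] is an isomorphism.
   Context: **Cubical sets.** The box category $\square$ has as objects the posets $[1]^n=\{0\le 1\}^n$ ($n\ge 0$), and its morphisms are the poset maps generated under composition by: faces $\partial^n_{i,\varepsilon}\colon [1]^{n-1}\to[1]^n$ ($1\le i\le n$, $\varepsilon\in\{0,1\}$), $(x_1,\dots,x_{n-1})\mapsto(x_1,\dots,x_{i-1},\varepsilon,x_i,\dots,x_{n-1})$; degeneracies $\sigma^n_i\colon[1]^n\to[1]^{n-1}$ ($1\le i\le n$), omitting the $i$-th coordinate; negative connections $\gamma^n_{i,0}\colon[1]^n\to[1]^{n-1}$ ($1\le i\le n-1$), replacing the pair $x_i,x_{i+1}$ by $\max\{x_i,x_{i+1}\}$; positive connections $\gamma^n_{i,1}\colon[1]^n\to[1]^{n-1}$ ($1\le i\le n-1$), replacing $x_i,x_{i+1}$ by $\min\{x_i,x_{i+1}\}$. A cubical set is a functor $X\colon\square^{op}\to\mathsf{Set}$; write $X_n=X([1]^n)$ for its set of $n$-cubes and write cubical operators on the right (e.g. $z\partial_{1,0}$). Cubical maps are natural transformations. $\square^n$ is the representable cubical set $\square(-,[1]^n)$; the open box $\sqcap^n_{i,\varepsilon}\subseteq\square^n$ is the union of the images of all faces $\partial_{j,\eta}$ with $(j,\eta)\ne(i,\varepsilon)$. A cubical set $K$ is a Kan complex if every map $\sqcap^n_{i,\varepsilon}\to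 K$ extends along $\sqcap^n_{i,\varepsilon}\hookrightarrow\square^n$. A pointed cubical set $(X,x)$ is a cubical set with a chosen $x\in X_0$. For $x\in X_0$, $x\sigma^{\circ n}\in X_n$ denotes the $n$-cube obtained from $x$ via the unique map $[1]^n\to[1]^0$. **Homotopy groups.** For a pointed Kan complex $(X,x)$, the loop space $\Omega(X,x)$ is the cubical set whose $n$-cubes are the $(n+1)$-cubes $z$ of $X$ with $z\partial_{1,0}=z\partial_{1,1}=x\sigma^{\circ n}$, where $\varphi\colon[1]^m\to[1]^n$ acts on $z$ as $\mathrm{id}_{[1]}\times\varphi$ acts in $X$; its basepoint is $x\sigma_1$. It is again a Kan complex. $\Omega^0(X,x)=(X,x)$ and $\Omega^n(X,x)=\Omega(\Omega^{n-1}(X,x),x\sigma^{\circ(n-1)})$. $\pi_0$ of a cubical set $Y$ is its colimit, i.e. $Y_0$ modulo the equivalence relation generated by $e\partial_{1,0}\sim e\partial_{1,1}$, $e\in Y_1$. Set $\pi_n(X,x)=\pi_0\Omega^n(X,x)$. For $u,v\in\Omega(X,x)_0$, a concatenation square is a $2$-cube $s$ of $X$ with $s\partial_{1,0}=u$, $s\partial_{1,1}=x\sigma_1$, $s\partial_{2,1}=v$; then $s\partial_{2,0}$ is called a concatenation of $u$ and $v$. Setting $[u][v]=[s\partial_{2,0}]$ is a well-defined group structure on $\pi_1(X,x)=\pi_0\Omega(X,x)$; for $n\ge1$ the group structure on $\pi_n(X,x)=\pi_1(\Omega^{n-1}(X,x))$ is the one obtained this way. $X$ is $m$-connected if $\pi_k(X,x)$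 is trivial for all $0\le k\le m$. **Homology.** A cubical abelian group is a functor $A\colon\square^{op}\to\mathsf{Ab}$. It yields a chain complex $A_\bullet$ with differential $\partial_n(a)=\sum_{i=1}^n\sum_{\varepsilon=0,1}(-1)^{i+\varepsilon}a\partial_{i,\varepsilon}$. The degenerate subcomplex $DA_\bullet$ has $DA_n\subseteq A_n$ the subgroup generated by all $a\sigma_i$ ($1\le i\le n$) and $a\gamma_{i,0}$ ($1\le i\le n-1$), $a\in A_{n-1}$ (so $DA_0=0$). The Moore complex is the quotient chain complex $\delta A=A_\bullet/DA_\bullet$. For a pointed cubical set $(X,x)$, $F(X,x)$ is the cubical abelian group with $F(X,x)_n$ the free abelian group on $X_n$ modulo the subgroup generated by $x\sigma^{\circ n}$; $F$ is left adjoint to $U$, $UA=(A,0)$, with unit $\eta_X\colon X\to UFX$. The underlying cubical set of every cubical abelian group is a Kan complex. Reduced homology is $\tilde H_n(X,x)=H_n(\delta F(X,x))$ (integer coefficients). **Hurewicz homomorphism.** For $n\ge1$ and a cubical abelian group $A$ there is a natural isomorphism $\pi_n(UA,0)\cong H_n(\delta A)$ sending the class of an $n$-cube $a\in A_n$ all of whose faces are $0$ to the homology class of $a$. The Hurewicz homomorphism is the composite $\pi_n(X,x)\xrightarrow{\pi_n(\eta_X)}\pi_n(UFX,0)\cong H_n(\delta FX)=\tilde H_n(X,x)$. *)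

theory Defs
  imports "HOL-Algebra.Free_Abelian_Groups"
begin

section \<open>The box category\<close>

text \<open>
  The poset \<open>[1]\<^sup>n\<close> is the set of boolean lists of length \<open>n\<close>, with \<open>False = 0\<close> and \<open>True = 1\<close>.
  Coordinates are numbered from 1, so \<open>x\<^sub>i\<close> is \<open>xs ! (i - 1)\<close>. Morphisms are functions that are
  extensional on their domain, so that equality of morphisms is equality of functions.
\<close>

definition cube :: "nat \<Rightarrow> bool list set" where
  "cube n = {xs. length xs = n}"

text \<open>
  In the next three definitions \<open>n\<close> is the upper index of \<open>\<partial>\<^sup>n\<close>, \<open>\<sigma>\<^sup>n\<close>, \<open>\<gamma>\<^sup>n\<close>: faces go from
  \<open>[1]\<^sup>n\<^sup>-\<^sup>1\<close> to \<open>[1]\<^sup>n\<close>, degeneracies and connections from \<open>[1]\<^sup>n\<close> to \<open>[1]\<^sup>n\<^sup>-\<^sup>1\<close>.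
\<close>

definition face :: "nat \<Rightarrow> nat \<Rightarrow> bool \<Rightarrow> bool list \<Rightarrow> bool list" where
  "face n i e = (\<lambda>xs \<in> cube (n - 1). take (i - 1) xs @ e # drop (i - 1) xs)"

definition degen :: "nat \<Rightarrow> nat \<Rightarrow> bool list \<Rightarrow> bool list" where
  "degen n i = (\<lambda>xs \<in> cube n. take (i - 1) xs @ drop i xs)"

definition conn :: "nat \<Rightarrow> nat \<Rightarrow> bool \<Rightarrow> bool list \<Rightarrow> bool list" where
  "conn n i e = (\<lambda>xs \<in> cube n.
     take (i - 1) xs @ (if e then min else max) (xs ! (i - 1)) (xs ! i) # drop (i + 1) xs)"

inductive box_map :: "nat \<Rightarrow> nat \<Rightarrow> (bool list \<Rightarrow> bool list) \<Rightarrow> bool" where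
  box_id: "box_map n n (\<lambda>xs \<in> cube n. xs)"
| box_face: "1 \<le> i \<Longrightarrow> i \<le> n \<Longrightarrow> box_map (n - 1) n (face n i e)"
| box_degen: "1 \<le> i \<Longrightarrow> i \<le> n \<Longrightarrow> box_map n (n - 1) (degen n i)"
| box_conn: "1 \<le> i \<Longrightarrow> i \<le> n - 1 \<Longrightarrow> box_map n (n - 1) (conn n i e)"
| box_comp: "box_map k m \<psi> \<Longrightarrow> box_map m n \<phi> \<Longrightarrow> box_map k n (compose (cube k) \<phi> \<psi>)"

text \<open>The unique map \<open>[1]\<^sup>n \<rightarrow> [1]\<^sup>0\<close>, and \<open>id\<^bsub>[1]\<^esub> \<times> \<phi>\<close> for a map \<open>\<phi>\<close> with domain \<open>[1]\<^sup>m\<close>.\<close>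

definition terminal :: "nat \<Rightarrow> bool list \<Rightarrow> bool list" where
  "terminal n = (\<lambda>xs \<in> cube n. [])"

definition id_times :: "nat \<Rightarrow> (bool list \<Rightarrow> bool list) \<Rightarrow> bool list \<Rightarrow> bool list" where
  "id_times m \<phi> = (\<lambda>xs \<in> cube (Suc m). hd xs # \<phi> (tl xs))"

section \<open>Cubical sets and Kan complexes\<close>

text \<open>\<open>act X m n \<phi> z\<close> is \<open>z\<phi> \<in> X\<^sub>m\<close> for \<open>z \<in> X\<^sub>n\<close> and \<open>\<phi> : [1]\<^sup>m \<rightarrow> [1]\<^sup>n\<close>.\<close>

record 'a cubical =
  cells :: "nat \<Rightarrow> 'a set"
  act :: "nat \<Rightarrow> nat \<Rightarrow> (bool list \<Rightarrow> bool list) \<Rightarrow> 'a \<Rightarrow> 'a"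

locale cubical_set =
  fixes X :: "'a cubical"
  assumes act_closed:
      "box_map m n \<phi> \<Longrightarrow> z \<in> cells X n \<Longrightarrow> act X m n \<phi> z \<in> cells X m"
    and act_id:
      "z \<in> cells X n \<Longrightarrow> act X n n (\<lambda>xs \<in> cube n. xs) z = z"
    and act_comp:
      "box_map k m \<psi> \<Longrightarrow> box_map m n \<phi> \<Longrightarrow> z \<in> cells X n \<Longrightarrow>
        act X k n (compose (cube k) \<phi> \<psi>) z = act X k m \<psi> (act X m n \<phi> z)"

definition cubical_map :: "'a cubical \<Rightarrow> 'b cubical \<Rightarrow> (nat \<Rightarrow> 'a \<Rightarrow> 'b) \<Rightarrow> bool" where
  "cubical_map X Y f \<longleftrightarrow>
     (\<forall>n. \<forall>z \<in> cells X n. f n z \<in> cells Y n) \<and>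
     (\<forall>m n \<phi>. \<forall>z \<in> cells X n. box_map m n \<phi> \<longrightarrow> f m (act X m n \<phi> z) = act Y m n \<phi> (f n z))"

definition face_op :: "'a cubical \<Rightarrow> nat \<Rightarrow> nat \<Rightarrow> bool \<Rightarrow> 'a \<Rightarrow> 'a" where
  "face_op X n i e = act X (n - 1) n (face n i e)"

text \<open>\<open>x\<sigma>\<^sup>\<circ>\<^sup>n\<close> for \<open>x \<in> X\<^sub>0\<close>\<close>

definition const_cube :: "'a cubical \<Rightarrow> nat \<Rightarrow> 'a \<Rightarrow> 'a" where
  "const_cube X n x = act X n 0 (terminal n) x"

definition std_cube :: "nat \<Rightarrow> (bool list \<Rightarrow> bool list) cubical" where
  "std_cube n = \<lparr>cells = (\<lambda>m. {\<phi>. box_map m n \<phi>}),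
                 act = (\<lambda>k m \<psi> \<phi>. compose (cube k) \<phi> \<psi>)\<rparr>"

definition open_box :: "nat \<Rightarrow> nat \<Rightarrow> bool \<Rightarrow> (bool list \<Rightarrow> bool list) cubical" where
  "open_box n i e = (std_cube n)\<lparr>cells := (\<lambda>m.
     {compose (cube m) (face n j d) \<psi> | j d \<psi>.
        1 \<le> j \<and> j \<le> n \<and> (j, d) \<noteq> (i, e) \<and> box_map m (n - 1) \<psi>})\<rparr>"

locale kan_complex = cubical_set +
  assumes kan_extension:
    "1 \<le> i \<Longrightarrow> i \<le> n \<Longrightarrow> cubical_map (open_box n i e) X f \<Longrightarrow>
      \<exists>g. cubical_map (std_cube n) X g \<and> (\<forall>m. \<forall>\<phi> \<in> cells (open_box n i e) m. g m \<phi> = f m \<phi>)"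

section \<open>Homotopy groups\<close>

definition loop_space :: "'a cubical \<Rightarrow> 'a \<Rightarrow> 'a cubical" where
  "loop_space X x =
     \<lparr>cells = (\<lambda>n. {z \<in> cells X (Suc n). face_op X (Suc n) 1 False z = const_cube X n x \<and>
                                        face_op X (Suc n) 1 True z = const_cube X n x}),
      act = (\<lambda>m n \<phi>. act X (Suc m) (Suc n) (id_times m \<phi>))\<rparr>"

primrec iter_loop :: "nat \<Rightarrow> 'a cubical \<Rightarrow> 'a \<Rightarrow> 'a cubical" where
  "iter_loop 0 X x = X"
| "iter_loop (Suc n) X x = loop_space (iter_loop n X x) (const_cube X n x)"

definition pi0_rel :: "'a cubical \<Rightarrow> 'a rel" where
  "pi0_rel Y = {(a, b). a \<in> cells Y 0 \<and> b \<in> cells Y 0 \<and>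
     equivclp (\<lambda>u v. \<exists>e \<in> cells Y 1. u = face_op Y 1 1 False e \<and> v = face_op Y 1 1 True e) a b}"

definition pi0 :: "'a cubical \<Rightarrow> 'a set set" where
  "pi0 Y = cells Y 0 // pi0_rel Y"

definition pi0_class :: "'a cubical \<Rightarrow> 'a \<Rightarrow> 'a set" where
  "pi0_class Y a = pi0_rel Y `` {a}"

definition homotopy_set :: "nat \<Rightarrow> 'a cubical \<Rightarrow> 'a \<Rightarrow> 'a set set" where
  "homotopy_set n X x = pi0 (iter_loop n X x)"

definition concat_square :: "'a cubical \<Rightarrow> 'a \<Rightarrow> 'a \<Rightarrow> 'a \<Rightarrow> 'a \<Rightarrow> bool" where
  "concat_square X x u v s \<longleftrightarrow> s \<in> cells X 2 \<and>
     face_op X 2 1 False s = u \<and> face_op X 2 1 True s = const_cube X 1 x \<and>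
     face_op X 2 2 True s = v"

text \<open>
  For a Kan complex, the class in the description of the product does not depend on \<open>u\<close>, \<open>v\<close>, \<open>s\<close>.
\<close>

definition pi1_group :: "'a cubical \<Rightarrow> 'a \<Rightarrow> 'a set monoid" where
  "pi1_group X x =
     \<lparr>carrier = pi0 (loop_space X x),
      mult = (\<lambda>P Q. THE R. \<exists>u \<in> P. \<exists>v \<in> Q. \<exists>s. concat_square X x u v s \<and>
                R = pi0_class (loop_space X x) (face_op X 2 2 False s)),
      one = pi0_class (loop_space X x) (const_cube X 1 x)\<rparr>"

text \<open>Only meaningful for \<open>n \<ge> 1\<close>; the carrier is then \<open>homotopy_set n X x\<close>.\<close>

definition homotopy_group :: "nat \<Rightarrow> 'a cubical \<Rightarrow> 'a \<Rightarrow> 'a set monoid" where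
  "homotopy_group n X x = pi1_group (iter_loop (n - 1) X x) (const_cube X (n - 1) x)"

definition m_connected :: "nat \<Rightarrow> 'a cubical \<Rightarrow> 'a \<Rightarrow> bool" where
  "m_connected m X x \<longleftrightarrow> (\<forall>k \<le> m. is_singleton (homotopy_set k X x))"

text \<open>
  The map induced on \<open>\<pi>\<^sub>n\<close> by a map \<open>f\<close> of pointed cubical sets with target \<open>(Y, y)\<close>. The \<open>k\<close>-cubes of
  \<open>\<Omega>(X, x)\<close> are \<open>(k + 1)\<close>-cubes of \<open>X\<close>, and \<open>\<Omega>f\<close> is the restriction of \<open>f\<close> to them.
\<close>

definition loop_map :: "(nat \<Rightarrow> 'a \<Rightarrow> 'b) \<Rightarrow> nat \<Rightarrow> 'a \<Rightarrow> 'b" where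
  "loop_map f = (\<lambda>k. f (Suc k))"

definition pi0_map :: "'b cubical \<Rightarrow> (nat \<Rightarrow> 'a \<Rightarrow> 'b) \<Rightarrow> 'a set \<Rightarrow> 'b set" where
  "pi0_map Y f P = (THE Q. \<exists>z \<in> P. Q = pi0_class Y (f 0 z))"

definition homotopy_map :: "nat \<Rightarrow> 'b cubical \<Rightarrow> 'b \<Rightarrow> (nat \<Rightarrow> 'a \<Rightarrow> 'b) \<Rightarrow> 'a set \<Rightarrow> 'b set" where
  "homotopy_map n Y y f = pi0_map (iter_loop n Y y) ((loop_map ^^ n) f)"

section \<open>Cubical abelian groups and homology\<close>

text \<open>Abelian groups are written multiplicatively, following HOL-Algebra. The constructions
  below are for records satisfying the locale \<open>cubical_ab_group\<close>; the only instance needed is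
  \<open>free_cubical X x\<close>.\<close>

record 'b cubical_ab =
  grp :: "nat \<Rightarrow> 'b monoid"
  gact :: "nat \<Rightarrow> nat \<Rightarrow> (bool list \<Rightarrow> bool list) \<Rightarrow> 'b \<Rightarrow> 'b"

locale cubical_ab_group =
  fixes A :: "'b cubical_ab"
  assumes grp_comm_group: "comm_group (grp A n)"
    and gact_hom: "box_map m n \<phi> \<Longrightarrow> gact A m n \<phi> \<in> hom (grp A n) (grp A m)"
    and gact_id: "a \<in> carrier (grp A n) \<Longrightarrow> gact A n n (\<lambda>xs \<in> cube n. xs) a = a"
    and gact_comp:
      "box_map k m \<psi> \<Longrightarrow> box_map m n \<phi> \<Longrightarrow> a \<in> carrier (grp A n) \<Longrightarrow>
        gact A k n (compose (cube k) \<phi> \<psi>) a = gact A k m \<psi> (gact A m n \<phi> a)"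

definition underlying :: "'b cubical_ab \<Rightarrow> 'b cubical" where
  "underlying A = \<lparr>cells = (\<lambda>n. carrier (grp A n)), act = gact A\<rparr>"

text \<open>
  If \<open>f : G \<rightarrow> K\<close> is a homomorphism with \<open>f(M) \<subseteq> N\<close>, then \<open>quot_map K N f\<close> is the induced
  homomorphism \<open>G/M \<rightarrow> K/N\<close> on cosets: it sends \<open>M g\<close> to \<open>N f(M g) = N f(g)\<close>.
\<close>

definition quot_map :: "'d monoid \<Rightarrow> 'd set \<Rightarrow> ('c \<Rightarrow> 'd) \<Rightarrow> 'c set \<Rightarrow> 'd set" where
  "quot_map K N f c = N <#>\<^bsub>K\<^esub> (f ` c)"

text \<open>
  Chain complexes are given by groups \<open>C n\<close> and differentials \<open>d n : C n \<rightarrow> C (n - 1)\<close>, where \<open>d 0\<close> is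
  trivial (its target is \<open>C 0\<close> by truncated subtraction).
\<close>

definition homology_group :: "(nat \<Rightarrow> 'c monoid) \<Rightarrow> (nat \<Rightarrow> 'c \<Rightarrow> 'c) \<Rightarrow> nat \<Rightarrow> 'c set monoid" where
  "homology_group C d n =
     (C n)\<lparr>carrier := kernel (C n) (C (n - 1)) (d n)\<rparr> Mod (d (Suc n) ` carrier (C (Suc n)))"

definition homology_class :: "(nat \<Rightarrow> 'c monoid) \<Rightarrow> (nat \<Rightarrow> 'c \<Rightarrow> 'c) \<Rightarrow> nat \<Rightarrow> 'c \<Rightarrow> 'c set" where
  "homology_class C d n c = (d (Suc n) ` carrier (C (Suc n))) #>\<^bsub>C n\<^esub> c"

definition chain_diff :: "'b cubical_ab \<Rightarrow> nat \<Rightarrow> 'b \<Rightarrow> 'b" where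
  "chain_diff A n a = finprod (grp A (n - 1))
     (\<lambda>(i, e). gact A (n - 1) n (face n i e) a [^]\<^bsub>grp A (n - 1)\<^esub> ((- 1) ^ (i + of_bool e) :: int))
     ({1..n} \<times> UNIV)"

definition degenerate_subgroup :: "'b cubical_ab \<Rightarrow> nat \<Rightarrow> 'b set" where
  "degenerate_subgroup A n = generate (grp A n)
     ({gact A n (n - 1) (degen n i) a | i a. 1 \<le> i \<and> i \<le> n \<and> a \<in> carrier (grp A (n - 1))} \<union>
      {gact A n (n - 1) (conn n i False) a | i a.
         1 \<le> i \<and> i \<le> n - 1 \<and> a \<in> carrier (grp A (n - 1))})"

definition moore_group :: "'b cubical_ab \<Rightarrow> nat \<Rightarrow> 'b set monoid" where
  "moore_group A n = grp A n Mod degenerate_subgroup A n"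

definition moore_diff :: "'b cubical_ab \<Rightarrow> nat \<Rightarrow> 'b set \<Rightarrow> 'b set" where
  "moore_diff A n = quot_map (grp A (n - 1)) (degenerate_subgroup A (n - 1)) (chain_diff A n)"

definition moore_homology :: "'b cubical_ab \<Rightarrow> nat \<Rightarrow> 'b set set monoid" where
  "moore_homology A n = homology_group (moore_group A) (moore_diff A) n"

definition moore_class :: "'b cubical_ab \<Rightarrow> nat \<Rightarrow> 'b \<Rightarrow> 'b set set" where
  "moore_class A n a =
     homology_class (moore_group A) (moore_diff A) n (degenerate_subgroup A n #>\<^bsub>grp A n\<^esub> a)"

definition base_subgroup :: "'a cubical \<Rightarrow> 'a \<Rightarrow> nat \<Rightarrow> ('a \<Rightarrow>\<^sub>0 int) set" where
  "base_subgroup X x n = generate (free_Abelian_group (cells X n)) {frag_of (const_cube X n x)}"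

definition free_cubical :: "'a cubical \<Rightarrow> 'a \<Rightarrow> ('a \<Rightarrow>\<^sub>0 int) set cubical_ab" where
  "free_cubical X x =
     \<lparr>grp = (\<lambda>n. free_Abelian_group (cells X n) Mod base_subgroup X x n),
      gact = (\<lambda>m n \<phi>. quot_map (free_Abelian_group (cells X m)) (base_subgroup X x m)
                        (frag_extend (\<lambda>z. frag_of (act X m n \<phi> z))))\<rparr>"

definition eta :: "'a cubical \<Rightarrow> 'a \<Rightarrow> nat \<Rightarrow> 'a \<Rightarrow> ('a \<Rightarrow>\<^sub>0 int) set" where
  "eta X x n z = base_subgroup X x n #>\<^bsub>free_Abelian_group (cells X n)\<^esub> frag_of z"

definition reduced_homology ::
  "nat \<Rightarrow> 'a cubical \<Rightarrow> 'a \<Rightarrow> ('a \<Rightarrow>\<^sub>0 int) set set set monoid" where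
  "reduced_homology n X x = moore_homology (free_cubical X x) n"

section \<open>The Hurewicz homomorphism\<close>

text \<open>
  The isomorphism \<open>\<pi>\<^sub>n(UA, 0) \<rightarrow> H\<^sub>n(\<delta>A)\<close>. The elements of a class \<open>P \<in> \<pi>\<^sub>n(UA, 0)\<close> are exactly
  \<open>n\<close>-cubes of \<open>A\<close> with all faces equal to 0, because the \<open>i\<close>-th loop space condition constrains the
  faces \<open>\<partial>\<^bsub>i,\<epsilon>\<^esub>\<close>.
\<close>

definition pi_to_homology :: "'b cubical_ab \<Rightarrow> nat \<Rightarrow> 'b set \<Rightarrow> 'b set set" where
  "pi_to_homology A n P = (THE h. \<exists>a \<in> P. h = moore_class A n a)"

definition hurewicz :: "nat \<Rightarrow> 'a cubical \<Rightarrow> 'a \<Rightarrow> 'a set \<Rightarrow> ('a \<Rightarrow>\<^sub>0 int) set set set" where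
  "hurewicz n X x =
     pi_to_homology (free_cubical X x) n \<circ>
     homotopy_map n (underlying (free_cubical X x)) \<one>\<^bsub>grp (free_cubical X x) 0\<^esub> (eta X x)"

end

theory Submission
  imports Defs
begin

text \<open>
  Boundaries of \<open>(n + 1)\<close>-cubes whose facets are spherical form a relation on \<open>\<pi>\<^sub>n\<close>. Filling open
  boxes of dimension \<open>n + 2\<close> allows a facet to be pushed onto an adjacent one, and for \<open>n \<ge> 2\<close> these
  moves alone force \<open>\<pi>\<^sub>n\<close> to be an abelian group in which the relation says that the alternating
  sum of the facets vanishes (homotopy addition). Connectivity gives a homotopy \<open>H\<close>, compatible with
  faces and degeneracies, from every cube of dimension at most \<open>n\<close> to a cube whose proper faces are
  constant. The end of \<open>H\<close> extends to a homomorphism from \<open>n\<close>-chains to \<open>\<pi>\<^sub>n\<close> killing degenerate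
  chains and, by homotopy addition, boundaries; hence the Hurewicz map is injective. As a chain
  homotopy, \<open>H\<close> makes every cycle homologous to a sum of spherical cubes; hence it is surjective.
\<close>


section \<open>Cubical identities\<close>

text \<open>The bound n >= 2 enters as \<open>3 \<le> N\<close> with N = n + 1: the pairs of
  directions (1,2) and (2,3) are then both available, and comparing the products defined in them
  takes the place of an Eckmann-Hilton argument. The fillers used are degeneracies and negative
  connections, so the moves on facets are not symmetric in the two sides of a cube, and lower and
  upper facets need different moves. The delicate point in constructing H is that one cube may be
  degenerate in several ways, each of which prescribes H on it. Connections must be respected as
  well as degeneracies, because the Moore complex divides out both. This is needed twice: the
  homomorphism to pi_n has to vanish on all degenerate chains, and the chain homotopy has to
  preserve them, since the boundary of a cycle of the quotient is in general only degenerate, not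
  zero. In dimension n the far end of H is left free. Its faces are far ends in dimension n - 1,
  hence constant, so it represents an element of pi_n.\<close>

lemma in_cube [simp]: "xs \<in> cube n \<longleftrightarrow> length xs = n"
  by (simp add: cube_def)

lemma length_face: "length xs = n \<Longrightarrow> 1 \<le> i \<Longrightarrow> i \<le> Suc n \<Longrightarrow> length (face (Suc n) i e xs) = Suc n"
  by (simp add: face_def)

lemma length_degen: "length xs = Suc n \<Longrightarrow> 1 \<le> i \<Longrightarrow> i \<le> Suc n \<Longrightarrow> length (degen (Suc n) i xs) = n"
  by (simp add: degen_def)

lemma length_conn: "length xs = Suc n \<Longrightarrow> 1 \<le> i \<Longrightarrow> i \<le> n \<Longrightarrow> length (conn (Suc n) i e xs) = n"
  by (simp add: conn_def)

lemma nth_face: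
  assumes "length xs = n" "1 \<le> i" "i \<le> Suc n" "j \<le> n"
  shows "face (Suc n) i e xs ! j = (if Suc j < i then xs ! j else if Suc j = i then e else xs ! (j - 1))"
proof -
  obtain i' where i': "i = Suc i'" using assms by (cases i) auto
  consider "j < i'" | "j = i'" | k where "j = Suc (i' + k)"
    by (metis less_iff_Suc_add linorder_neqE_nat)
  then show ?thesis
    using assms i' by cases (auto simp: face_def nth_append)
qed

lemma nth_degen:
  assumes "length xs = Suc n" "1 \<le> i" "i \<le> Suc n" "j < n"
  shows "degen (Suc n) i xs ! j = (if Suc j < i then xs ! j else xs ! Suc j)"
proof -
  obtain i' where i': "i = Suc i'" using assms by (cases i) auto
  consider "j < i'" | k where "j = i' + k"
    by (metis le_iff_add linorder_not_le)
  then show ?thesis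
    using assms i' by cases (auto simp: degen_def nth_append)
qed

lemma nth_conn:
  assumes "length xs = Suc n" "1 \<le> i" "i \<le> n" "j < n"
  shows "conn (Suc n) i False xs ! j =
    (if Suc j < i then xs ! j else if Suc j = i then xs ! j \<or> xs ! Suc j else xs ! Suc j)"
proof -
  obtain i' where i': "i = Suc i'" using assms by (cases i) auto
  consider "j < i'" | "j = i'" | k where "j = Suc (i' + k)"
    by (metis less_iff_Suc_add linorder_neqE_nat)
  then show ?thesis
    using assms i' by cases (auto simp: conn_def nth_append max_def)
qed

lemmas nth_box = nth_face nth_degen nth_conn
lemmas length_box = length_face length_degen length_conn

lemma box_face': "1 \<le> i \<Longrightarrow> i \<le> Suc n \<Longrightarrow> box_map n (Suc n) (face (Suc n) i e)"
  using box_face[of i "Suc n"] by simp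

lemma box_degen': "1 \<le> i \<Longrightarrow> i \<le> Suc n \<Longrightarrow> box_map (Suc n) n (degen (Suc n) i)"
  using box_degen[of i "Suc n"] by simp

lemma box_conn': "1 \<le> i \<Longrightarrow> i \<le> n \<Longrightarrow> box_map (Suc n) n (conn (Suc n) i e)"
  using box_conn[of i "Suc n"] by simp

lemma box_terminal: "box_map n 0 (terminal n)"
proof (induction n)
  case 0
  have "(\<lambda>xs \<in> cube 0. xs) = terminal 0"
    by (auto simp: terminal_def restrict_def)
  then show ?case using box_id[of 0] by simp
next
  case (Suc n)
  have "compose (cube (Suc n)) (terminal n) (degen (Suc n) 1) = terminal (Suc n)"
    by (auto simp: terminal_def compose_def restrict_def degen_def)
  then show ?case using box_comp[OF box_degen'[of 1 n] Suc] by simp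
qed

lemma box_map_length: "box_map m n \<phi> \<Longrightarrow> length xs = m \<Longrightarrow> length (\<phi> xs) = n"
  by (induction arbitrary: xs rule: box_map.induct) (auto simp: face_def degen_def conn_def compose_def)

lemma box_map_extensional: "box_map m n \<phi> \<Longrightarrow> length xs \<noteq> m \<Longrightarrow> \<phi> xs = undefined"
  by (induction arbitrary: xs rule: box_map.induct) (auto simp: face_def degen_def conn_def compose_def)

lemma box_map_eqI:
  assumes "box_map m n \<phi>" "box_map m n \<psi>" "\<And>xs. length xs = m \<Longrightarrow> \<phi> xs = \<psi> xs"
  shows "\<phi> = \<psi>"
  using assms box_map_extensional by (metis ext)

text \<open>
  The first index is the dimension of the smaller cube: \<open>fc n\<close> maps \<open>X\<^sub>n\<^sub>+\<^sub>1\<close> to \<open>X\<^sub>n\<close>, while \<open>dg n\<close> and \<open>cn n\<close>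
  map \<open>X\<^sub>n\<close> to \<open>X\<^sub>n\<^sub>+\<^sub>1\<close>.
\<close>

context cubical_set
begin

definition fc :: "nat \<Rightarrow> nat \<Rightarrow> bool \<Rightarrow> 'a \<Rightarrow> 'a" where
  "fc n i e = act X n (Suc n) (face (Suc n) i e)"

definition dg :: "nat \<Rightarrow> nat \<Rightarrow> 'a \<Rightarrow> 'a" where
  "dg n i = act X (Suc n) n (degen (Suc n) i)"

definition cn :: "nat \<Rightarrow> nat \<Rightarrow> 'a \<Rightarrow> 'a" where
  "cn n i = act X (Suc n) n (conn (Suc n) i False)"

lemma fc_closed [simp, intro]:
  "z \<in> cells X (Suc n) \<Longrightarrow> 1 \<le> i \<Longrightarrow> i \<le> Suc n \<Longrightarrow> fc n i e z \<in> cells X n"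
  by (simp add: fc_def act_closed box_face')

lemma dg_closed [simp, intro]:
  "z \<in> cells X n \<Longrightarrow> 1 \<le> i \<Longrightarrow> i \<le> Suc n \<Longrightarrow> dg n i z \<in> cells X (Suc n)"
  by (simp add: dg_def act_closed box_degen')

lemma cn_closed [simp, intro]:
  "z \<in> cells X n \<Longrightarrow> 1 \<le> i \<Longrightarrow> i \<le> n \<Longrightarrow> cn n i z \<in> cells X (Suc n)"
  by (simp add: cn_def act_closed box_conn')

text \<open>Functoriality reduces an identity between operators to a pointwise identity of maps on
  Boolean lists. Together with \<open>act_act_id\<close> this yields the cubical identities below by
  comparing coordinates.\<close>

lemma act_act_cong:
  assumes "box_map k m \<psi>" "box_map m n \<phi>" "box_map k m' \<psi>'" "box_map m' n \<phi>'" "z \<in> cells X n"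
    and "\<And>xs. length xs = k \<Longrightarrow> \<phi> (\<psi> xs) = \<phi>' (\<psi>' xs)"
  shows "act X k m \<psi> (act X m n \<phi> z) = act X k m' \<psi>' (act X m' n \<phi>' z)"
proof -
  have "compose (cube k) \<phi> \<psi> = compose (cube k) \<phi>' \<psi>'"
    using assms(6) by (auto simp: compose_def restrict_def)
  then show ?thesis using assms act_comp by metis
qed

lemma act_act_id:
  assumes "box_map n m \<psi>" "box_map m n \<phi>" "z \<in> cells X n"
    and "\<And>xs. length xs = n \<Longrightarrow> \<phi> (\<psi> xs) = xs"
  shows "act X n m \<psi> (act X m n \<phi> z) = z"
proof -
  have "compose (cube n) \<phi> \<psi> = (\<lambda>xs \<in> cube n. xs)"
    using assms(4) by (auto simp: compose_def restrict_def)
  then show ?thesis using assms act_comp act_id by metis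
qed

lemma fc_fc:
  assumes "z \<in> cells X (Suc (Suc n))" "1 \<le> j" "j \<le> k" "k \<le> Suc n"
  shows "fc n j c (fc (Suc n) (Suc k) d z) = fc n k d (fc (Suc n) j c z)"
  unfolding fc_def using assms
  by (intro act_act_cong box_face')
     (auto intro!: nth_equalityI simp: length_box nth_box split: if_splits)

lemma fc_dg_same [simp]:
  assumes "z \<in> cells X n" "1 \<le> i" "i \<le> Suc n"
  shows "fc n i e (dg n i z) = z"
  unfolding fc_def dg_def using assms
  by (intro act_act_id box_face' box_degen')
     (auto intro!: nth_equalityI simp: length_box nth_box split: if_splits)

lemma fc_dg_lt:
  assumes "z \<in> cells X (Suc n)" "1 \<le> j" "j \<le> i" "i \<le> Suc n"
  shows "fc (Suc n) j c (dg (Suc n) (Suc i) z) = dg n i (fc n j c z)"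
  unfolding fc_def dg_def using assms
  by (intro act_act_cong box_face' box_degen')
     (auto intro!: nth_equalityI simp: length_box nth_box split: if_splits)

lemma fc_dg_gt:
  assumes "z \<in> cells X (Suc n)" "1 \<le> i" "i \<le> j" "j \<le> Suc n"
  shows "fc (Suc n) (Suc j) c (dg (Suc n) i z) = dg n i (fc n j c z)"
  unfolding fc_def dg_def using assms
  by (intro act_act_cong box_face' box_degen')
     (auto intro!: nth_equalityI simp: length_box nth_box split: if_splits)

lemma fc_cn_False:
  assumes "z \<in> cells X n" "1 \<le> i" "i \<le> n" "j = i \<or> j = Suc i"
  shows "fc n j False (cn n i z) = z"
  unfolding fc_def cn_def using assms
  by (intro act_act_id box_face' box_conn')
     (auto intro!: nth_equalityI simp: length_box nth_box split: if_splits)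

text \<open>A maximum with one argument 1 is constantly 1, so the other coordinate is forgotten and
  a degeneracy appears. With one argument 0 the maximum returns the other coordinate, which is
  \<open>fc_cn_False\<close>.\<close>

lemma fc_cn_True:
  assumes "z \<in> cells X (Suc n)" "1 \<le> i" "i \<le> Suc n" "j = i \<or> j = Suc i"
  shows "fc (Suc n) j True (cn (Suc n) i z) = dg n i (fc n i True z)"
  unfolding fc_def cn_def dg_def using assms
  by (intro act_act_cong box_face' box_degen' box_conn')
     (auto intro!: nth_equalityI simp: length_box nth_box split: if_splits)

lemma fc_cn_lt:
  assumes "z \<in> cells X (Suc n)" "1 \<le> j" "j \<le> i" "i \<le> n"
  shows "fc (Suc n) j c (cn (Suc n) (Suc i) z) = cn n i (fc n j c z)"
  unfolding fc_def cn_def using assms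
  by (intro act_act_cong box_face' box_conn')
     (auto intro!: nth_equalityI simp: length_box nth_box split: if_splits)

lemma fc_cn_gt:
  assumes "z \<in> cells X (Suc n)" "1 \<le> i" "i < j" "j \<le> Suc n"
  shows "fc (Suc n) (Suc j) c (cn (Suc n) i z) = cn n i (fc n j c z)"
  unfolding fc_def cn_def using assms
  by (intro act_act_cong box_face' box_conn')
     (auto intro!: nth_equalityI simp: length_box nth_box split: if_splits)

lemma dg_dg:
  assumes "z \<in> cells X n" "1 \<le> i" "i \<le> j" "j \<le> Suc n"
  shows "dg (Suc n) (Suc j) (dg n i z) = dg (Suc n) i (dg n j z)"
  unfolding dg_def using assms
  by (intro act_act_cong box_degen')
     (auto intro!: nth_equalityI simp: length_box nth_box split: if_splits)

lemma cn_dg_gt: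
  assumes "z \<in> cells X n" "1 \<le> i" "i < j" "j \<le> Suc n"
  shows "cn (Suc n) i (dg n j z) = dg (Suc n) (Suc j) (cn n i z)"
  unfolding dg_def cn_def using assms
  by (intro act_act_cong box_degen' box_conn')
     (auto intro!: nth_equalityI simp: length_box nth_box split: if_splits)

lemma cn_dg_lt:
  assumes "z \<in> cells X n" "1 \<le> j" "j \<le> i" "i \<le> n"
  shows "cn (Suc n) (Suc i) (dg n j z) = dg (Suc n) j (cn n i z)"
  unfolding dg_def cn_def using assms
  by (intro act_act_cong box_degen' box_conn')
     (auto intro!: nth_equalityI simp: length_box nth_box split: if_splits)

text \<open>Merging two coordinates and dropping the result amounts to dropping both. Among the
  commutation rules here it is the only one that trades a connection for a degeneracy.\<close>

lemma cn_dg_same: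
  assumes "z \<in> cells X n" "1 \<le> i" "i \<le> Suc n"
  shows "cn (Suc n) i (dg n i z) = dg (Suc n) i (dg n i z)"
  unfolding dg_def cn_def using assms
  by (intro act_act_cong box_degen' box_conn')
     (auto intro!: nth_equalityI simp: length_box nth_box split: if_splits)

lemma cn_cn:
  assumes "z \<in> cells X n" "1 \<le> i" "i \<le> j" "j \<le> n"
  shows "cn (Suc n) (Suc j) (cn n i z) = cn (Suc n) i (cn n j z)"
  unfolding cn_def using assms
  by (intro act_act_cong box_conn')
     (auto intro!: nth_equalityI simp: length_box nth_box split: if_splits)

end

section \<open>Filling open boxes\<close>

lemma degen_face:
  assumes "length xs = n" "1 \<le> i" "i \<le> Suc n"
  shows "degen (Suc n) i (face (Suc n) i e xs) = xs"
  using assms by (auto intro!: nth_equalityI simp: length_box nth_box split: if_splits)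

text \<open>Two facets in the different directions j and k + 1 meet in a codimension-two face. The
  list \<open>degen (Suc n) k ys\<close> holds the coordinates that remain free there, and the
  common point is recovered from it inside either facet.\<close>

lemma face_intersection:
  assumes "length ys = Suc n" "length ys' = Suc n" "1 \<le> j" "j \<le> k" "k \<le> Suc n"
    and eq: "face (Suc (Suc n)) j c ys = face (Suc (Suc n)) (Suc k) d ys'"
  shows "ys = face (Suc n) k d (degen (Suc n) k ys)" "ys' = face (Suc n) j c (degen (Suc n) k ys)"
proof -
  have H: "(if Suc p < j then ys ! p else if Suc p = j then c else ys ! (p - 1)) =
      (if p < k then ys' ! p else if p = k then d else ys' ! (p - 1))" if "p \<le> Suc n" for p
    using that arg_cong[OF eq, of "\<lambda>l. l ! p"] assms(1-5) by (simp add: nth_face)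
  show "ys = face (Suc n) k d (degen (Suc n) k ys)"
  proof (rule nth_equalityI)
    fix p assume "p < length ys"
    then show "ys ! p = face (Suc n) k d (degen (Suc n) k ys) ! p"
      using assms(1-5) H[of k] by (auto simp: nth_box length_box)
  qed (use assms in \<open>simp add: length_box\<close>)
  show "ys' = face (Suc n) j c (degen (Suc n) k ys)"
  proof (rule nth_equalityI)
    fix p assume "p < length ys'"
    then show "ys' ! p = face (Suc n) j c (degen (Suc n) k ys) ! p"
      using assms(1-5) H[of p] H[of "Suc p"] by (auto simp: nth_box length_box split: if_splits)
  qed (use assms in \<open>simp add: length_box\<close>)
qed

context kan_complex
begin

text \<open>An open box is a union of facets, so a map out of it is a family of cubes agreeing on
  codimension-two faces. Agreement is demanded in the shape of the identity \<open>fc_fc\<close>,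
  once for each pair of directions, and is void for n = 0.\<close>

lemma kan_fill:
  assumes i: "1 \<le> i" "i \<le> Suc n"
    and y: "\<And>j d. 1 \<le> j \<Longrightarrow> j \<le> Suc n \<Longrightarrow> (j, d) \<noteq> (i, e) \<Longrightarrow> y j d \<in> cells X n"
    and match: "\<And>m j c k d. n = Suc m \<Longrightarrow> 1 \<le> j \<Longrightarrow> j \<le> k \<Longrightarrow> k \<le> n \<Longrightarrow> (j, c) \<noteq> (i, e) \<Longrightarrow>
      (Suc k, d) \<noteq> (i, e) \<Longrightarrow> fc m j c (y (Suc k) d) = fc m k d (y j c)"
  shows "\<exists>w \<in> cells X (Suc n). \<forall>j d. 1 \<le> j \<longrightarrow> j \<le> Suc n \<longrightarrow> (j, d) \<noteq> (i, e) \<longrightarrow> fc n j d w = y j d"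
proof -
  define P where "P m \<phi> j d \<psi> \<longleftrightarrow> 1 \<le> j \<and> j \<le> Suc n \<and> (j, d) \<noteq> (i, e) \<and> box_map m n \<psi> \<and>
      \<phi> = compose (cube m) (face (Suc n) j d) \<psi>" for m \<phi> j d \<psi>
  have cell_iff: "\<phi> \<in> cells (open_box (Suc n) i e) m \<longleftrightarrow> (\<exists>j d \<psi>. P m \<phi> j d \<psi>)" for m \<phi>
    by (auto simp: open_box_def std_cube_def P_def)
  \<comment> \<open>A cell of the box may factor through several facets; the value prescribed on it
    must not depend on the factorization.\<close>
  have val: "act X m n \<psi> (y j c) = act X m n \<psi>' (y k d)"
    if "P m \<phi> j c \<psi>" "P m \<phi> k d \<psi>'" "j \<le> k" for m \<phi> j c \<psi> k d \<psi>'
  proof -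
    have b: "box_map m n \<psi>" "box_map m n \<psi>'" "1 \<le> j" "j \<le> k" "k \<le> Suc n" and
      ne: "(j, c) \<noteq> (i, e)" "(k, d) \<noteq> (i, e)"
      using that(1)[unfolded P_def] that(2)[unfolded P_def] that(3) by blast+
    have comp: "compose (cube m) (face (Suc n) j c) \<psi> = compose (cube m) (face (Suc n) k d) \<psi>'"
      using that(1)[unfolded P_def] that(2)[unfolded P_def] by (elim conjE) (rule trans, erule sym, assumption)
    have eq: "face (Suc n) j c (\<psi> xs) = face (Suc n) k d (\<psi>' xs)" if "length xs = m" for xs
      using fun_cong[OF comp, of xs] that by (simp add: compose_eq)
    show ?thesis
    proof (cases "j = k")
      case True
      have "\<psi> xs = \<psi>' xs" if "length xs = m" for xs
        using arg_cong[OF eq[OF that], of "degen (Suc n) j"] True b that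
        by (simp add: degen_face box_map_length[OF b(1)] box_map_length[OF b(2)])
      then have "\<psi> = \<psi>'" using b box_map_eqI by blast
      \<comment> \<open>Any single point shows on which side a facet lies: coordinate j of the image
        of the all-zero point is c and also d.\<close>
      moreover have "c = d"
        using arg_cong[OF eq[of "replicate m False"], of "\<lambda>l. l ! (j - 1)"] True b
          box_map_length[OF b(1), of "replicate m False"] box_map_length[OF b(2), of "replicate m False"]
        by (simp add: nth_face)
      ultimately show ?thesis using True by simp
    next
      case False
      then obtain k' where k': "k = Suc k'" "j \<le> k'" using b by (cases k) auto
      then obtain n' where n': "n = Suc n'" using b by (cases n) auto
      \<comment> \<open>The cell lies in the intersection of both facets; \<open>?\<chi>\<close> is
        its factor through that codimension-two face.\<close>
      let ?\<chi> = "compose (cube m) (degen (Suc n') k') \<psi>"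
      have \<chi>: "box_map m n' ?\<chi>"
        using b k' n' by (intro box_comp[OF b(1)]) (simp add: box_degen')
      have 1: "\<psi> = compose (cube m) (face (Suc n') k' d) ?\<chi>"
      proof (rule box_map_eqI[OF b(1)])
        show "box_map m n (compose (cube m) (face (Suc n') k' d) ?\<chi>)"
          using b k' n' by (auto intro!: box_comp[OF \<chi>] box_face')
        fix xs :: "bool list" assume "length xs = m"
        then show "\<psi> xs = compose (cube m) (face (Suc n') k' d) ?\<chi> xs"
          using face_intersection(1)[of "\<psi> xs" n' "\<psi>' xs" j k' c d] b k' n' eq[of xs]
            box_map_length[OF b(1)] box_map_length[OF b(2)] by (simp add: compose_eq)
      qed
      have 2: "\<psi>' = compose (cube m) (face (Suc n') j c) ?\<chi>"
      proof (rule box_map_eqI[OF b(2)])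
        show "box_map m n (compose (cube m) (face (Suc n') j c) ?\<chi>)"
          using b k' n' by (auto intro!: box_comp[OF \<chi>] box_face')
        fix xs :: "bool list" assume "length xs = m"
        then show "\<psi>' xs = compose (cube m) (face (Suc n') j c) ?\<chi> xs"
          using face_intersection(2)[of "\<psi> xs" n' "\<psi>' xs" j k' c d] b k' n' eq[of xs]
            box_map_length[OF b(1)] box_map_length[OF b(2)] by (simp add: compose_eq)
      qed
      have yj: "y j c \<in> cells X (Suc n')" "y k d \<in> cells X (Suc n')"
        using y b ne n' by auto
      have "act X m n \<psi> (y j c) = act X m n' ?\<chi> (fc n' k' d (y j c))"
        unfolding fc_def using n' b k' yj
        by (subst 1, subst act_comp[symmetric, OF \<chi>]) (auto intro!: box_face')
      also have "fc n' k' d (y j c) = fc n' j c (y k d)"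
        using match[OF n', of j k' c d] b k' n' ne by simp
      also have "act X m n' ?\<chi> \<dots> = act X m n \<psi>' (y k d)"
        unfolding fc_def using n' b k' yj
        by (subst 2, subst act_comp[symmetric, OF \<chi>]) (auto intro!: box_face')
      finally show ?thesis .
    qed
  qed
  define f where "f m \<phi> = (SOME v. \<exists>j d \<psi>. P m \<phi> j d \<psi> \<and> v = act X m n \<psi> (y j d))" for m \<phi>
  have f: "f m \<phi> = act X m n \<psi> (y j d)" if "P m \<phi> j d \<psi>" for m \<phi> j d \<psi>
  proof -
    have "\<exists>k d' \<psi>'. P m \<phi> k d' \<psi>' \<and> f m \<phi> = act X m n \<psi>' (y k d')"
      unfolding f_def by (rule someI_ex) (use that in blast)
    then show ?thesis using val that by (metis nle_le)
  qed
  have "cubical_map (open_box (Suc n) i e) X f"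
    unfolding cubical_map_def
  proof (intro conjI allI ballI impI)
    fix m \<phi> assume "\<phi> \<in> cells (open_box (Suc n) i e) m"
    then show "f m \<phi> \<in> cells X m"
      using cell_iff f y act_closed by (metis P_def)
  next
    fix k m \<theta> \<phi> assume "\<phi> \<in> cells (open_box (Suc n) i e) m" and \<theta>: "box_map k m \<theta>"
    then obtain j d \<psi> where p: "P m \<phi> j d \<psi>" using cell_iff by blast
    have "compose (cube k) \<phi> \<theta> = compose (cube k) (face (Suc n) j d) (compose (cube k) \<psi> \<theta>)"
      using p box_map_length[OF \<theta>] by (auto simp: P_def compose_def restrict_def)
    then have "P k (compose (cube k) \<phi> \<theta>) j d (compose (cube k) \<psi> \<theta>)"
      using p \<theta> box_comp by (simp add: P_def)
    then have "f k (compose (cube k) \<phi> \<theta>) = act X k n (compose (cube k) \<psi> \<theta>) (y j d)"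
      by (rule f)
    also have "\<dots> = act X k m \<theta> (f m \<phi>)"
      unfolding f[OF p] using p \<theta> act_comp y unfolding P_def by blast
    finally show "f k (act (open_box (Suc n) i e) k m \<theta> \<phi>) = act X k m \<theta> (f m \<phi>)"
      by (simp add: open_box_def std_cube_def)
  qed
  then obtain g where g: "cubical_map (std_cube (Suc n)) X g"
    and gf: "\<And>m \<phi>. \<phi> \<in> cells (open_box (Suc n) i e) m \<Longrightarrow> g m \<phi> = f m \<phi>"
    using kan_extension[of i "Suc n" e f] i by auto
  \<comment> \<open>Yoneda: the filler is the value of \<open>g\<close> at the identity, and its
    facets are the values of \<open>g\<close> at the face maps.\<close>
  let ?id = "\<lambda>xs \<in> cube (Suc n). xs"
  have "?id \<in> cells (std_cube (Suc n)) (Suc n)"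
    by (simp add: std_cube_def box_id)
  then have w: "g (Suc n) ?id \<in> cells X (Suc n)" and
    nat: "\<And>m \<phi>. box_map m (Suc n) \<phi> \<Longrightarrow>
      g m (compose (cube m) ?id \<phi>) = act X m (Suc n) \<phi> (g (Suc n) ?id)"
    using g by (auto simp: cubical_map_def std_cube_def)
  have "fc n j d (g (Suc n) ?id) = y j d" if j: "1 \<le> j" "j \<le> Suc n" "(j, d) \<noteq> (i, e)" for j d
  proof -
    have b: "box_map n (Suc n) (face (Suc n) j d)" using j by (simp add: box_face')
    have "compose (cube n) ?id (face (Suc n) j d) = face (Suc n) j d"
      by (rule box_map_eqI[OF box_comp[OF b box_id] b]) (use j in \<open>simp add: compose_eq length_face\<close>)
    then have 1: "fc n j d (g (Suc n) ?id) = g n (face (Suc n) j d)"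
      using nat[OF b] by (simp add: fc_def)
    have "face (Suc n) j d = compose (cube n) (face (Suc n) j d) (\<lambda>xs \<in> cube n. xs)"
      by (rule box_map_eqI[OF b box_comp[OF box_id b]]) (simp add: compose_eq)
    then have 2: "P n (face (Suc n) j d) j d (\<lambda>xs \<in> cube n. xs)"
      using j box_id by (simp add: P_def)
    then have "g n (face (Suc n) j d) = f n (face (Suc n) j d)"
      using gf cell_iff by blast
    also have "\<dots> = y j d"
      using f[OF 2] act_id y j by simp
    finally show ?thesis using 1 by simp
  qed
  then show ?thesis using w by blast
qed

text \<open>Homotopy extension. Direction 1 is the time coordinate, \<open>w\<close> the bottom, and
  \<open>t j d\<close> the side over the facet \<open>(j, d)\<close>, which therefore sits in
  direction \<open>Suc j\<close>. The box lacks the lid \<open>(1, True)\<close>.\<close>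

lemma cylinder:
  assumes w: "w \<in> cells X (Suc n)"
    and t: "\<And>j d. 1 \<le> j \<Longrightarrow> j \<le> Suc n \<Longrightarrow> t j d \<in> cells X (Suc n)"
    and bot: "\<And>j d. 1 \<le> j \<Longrightarrow> j \<le> Suc n \<Longrightarrow> fc n 1 False (t j d) = fc n j d w"
    and match: "\<And>j c k d. 1 \<le> j \<Longrightarrow> j \<le> k \<Longrightarrow> k \<le> n \<Longrightarrow>
      fc n (Suc j) c (t (Suc k) d) = fc n (Suc k) d (t j c)"
  shows "\<exists>v \<in> cells X (Suc (Suc n)). fc (Suc n) 1 False v = w \<and>
    (\<forall>j d. 1 \<le> j \<longrightarrow> j \<le> Suc n \<longrightarrow> fc (Suc n) (Suc j) d v = t j d)"
proof -
  let ?y = "\<lambda>j d. if j = 1 then w else t (j - 1) d"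
  have "\<exists>v \<in> cells X (Suc (Suc n)). \<forall>j d. 1 \<le> j \<longrightarrow> j \<le> Suc (Suc n) \<longrightarrow> (j, d) \<noteq> (1, True) \<longrightarrow>
      fc (Suc n) j d v = ?y j d"
  proof (rule kan_fill)
    fix j :: nat and d assume "1 \<le> j" "j \<le> Suc (Suc n)" "(j, d) \<noteq> (1, True)"
    then show "?y j d \<in> cells X (Suc n)" using w t by auto
  next
    fix m j c k d
    assume a: "Suc n = Suc m" "1 \<le> j" "j \<le> k" "k \<le> Suc n" "(j, c) \<noteq> (1, True)" "(Suc k, d) \<noteq> (1, True)"
    show "fc m j c (?y (Suc k) d) = fc m k d (?y j c)"
    proof (cases "j = 1")
      case True
      then show ?thesis using a bot[of k d] by auto
    next
      case False
      then obtain j' k' where "j = Suc j'" "k = Suc k'" "1 \<le> j'"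
        using a by (cases j; cases k) auto
      then show ?thesis using a match[of j' k' c d] by auto
    qed
  qed auto
  then obtain v where "v \<in> cells X (Suc (Suc n))" and v: "\<And>j d. 1 \<le> j \<Longrightarrow> j \<le> Suc (Suc n) \<Longrightarrow>
      (j, d) \<noteq> (1, True) \<Longrightarrow> fc (Suc n) j d v = ?y j d"
    by blast
  then show ?thesis
    by (intro bexI[of _ v]) auto
qed

end

section \<open>Relations on the boundary of a cube\<close>

definition skip :: "nat \<Rightarrow> nat \<Rightarrow> nat" where
  "skip J i = (if i < J then i else Suc i)"

definition unskip :: "nat \<Rightarrow> nat \<Rightarrow> nat" where
  "unskip J l = (if l < J then l else l - 1)"

lemma unskip_skip [simp]: "unskip J (skip J i) = i"
  by (simp add: skip_def unskip_def)

lemma (in comm_group) cancel_left: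
  assumes "u \<in> carrier G" "q \<in> carrier G"
  shows "inv u \<otimes> (u \<otimes> q) = q"
  using assms by (simp add: m_assoc[symmetric])

lemma (in comm_group) inv_cancel_left:
  assumes "u \<in> carrier G" "q \<in> carrier G"
  shows "u \<otimes> inv (u \<otimes> q) = inv q"
  using assms by (simp add: inv_mult m_assoc[symmetric])

text \<open>
  \<open>R f\<close> means that an \<open>N\<close>-cube has the facets \<open>f\<close>. In the last axiom \<open>G u v\<close> sits at the intersection of
  the facets \<open>u\<close> and \<open>v\<close> of an \<open>N + 1\<close>-cube, and direction \<open>i\<close> of the facet \<open>(J, d)\<close> is direction
  \<open>skip J i\<close> of the cube.
\<close>

locale facet_relation =
  fixes N :: nat and P :: "'p set" and z :: 'p and R :: "(nat \<times> bool \<Rightarrow> 'p) \<Rightarrow> bool"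
  assumes N: "3 \<le> N"
    and z_in [simp, intro]: "z \<in> P"
    and R_cong: "\<And>f g. R f \<Longrightarrow> (\<And>i e. 1 \<le> i \<Longrightarrow> i \<le> N \<Longrightarrow> f (i, e) = g (i, e)) \<Longrightarrow> R g"
    and R_exists: "\<And>f i e. range f \<subseteq> P \<Longrightarrow> 1 \<le> i \<Longrightarrow> i \<le> N \<Longrightarrow> \<exists>p \<in> P. R (f((i, e) := p))"
    and R_unique: "\<And>f g i e. R f \<Longrightarrow> R g \<Longrightarrow> range f \<subseteq> P \<Longrightarrow> range g \<subseteq> P \<Longrightarrow> 1 \<le> i \<Longrightarrow> i \<le> N \<Longrightarrow>
      (\<And>j d. 1 \<le> j \<Longrightarrow> j \<le> N \<Longrightarrow> (j, d) \<noteq> (i, e) \<Longrightarrow> f (j, d) = g (j, d)) \<Longrightarrow> f (i, e) = g (i, e)"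
    and R_degen: "\<And>p i. p \<in> P \<Longrightarrow> 1 \<le> i \<Longrightarrow> i \<le> N \<Longrightarrow>
      R ((\<lambda>_. z)((i, False) := p, (i, True) := p))"
    and R_conn: "\<And>p i. p \<in> P \<Longrightarrow> 1 \<le> i \<Longrightarrow> i < N \<Longrightarrow>
      R ((\<lambda>_. z)((i, False) := p, (Suc i, False) := p))"
    and R_box: "\<And>G I E. (\<And>x y. G x y \<in> P) \<Longrightarrow> (\<And>x y. fst x \<noteq> fst y \<Longrightarrow> G x y = G y x) \<Longrightarrow>
      1 \<le> I \<Longrightarrow> I \<le> Suc N \<Longrightarrow>
      (\<And>J d. 1 \<le> J \<Longrightarrow> J \<le> Suc N \<Longrightarrow> (J, d) \<noteq> (I, E) \<Longrightarrow> R (\<lambda>(i, e). G (J, d) (skip J i, e))) \<Longrightarrow>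
      R (\<lambda>(i, e). G (I, E) (skip I i, e))"
begin

lemma R_cong_iff:
  "(\<And>i e. 1 \<le> i \<Longrightarrow> i \<le> N \<Longrightarrow> f (i, e) = g (i, e)) \<Longrightarrow> R f \<longleftrightarrow> R g"
  using R_cong[of f g] R_cong[of g f] by auto

lemma R_unique_upd:
  assumes "R (f((i, e) := p))" "R (f((i, e) := q))" "range f \<subseteq> P" "p \<in> P" "q \<in> P" "1 \<le> i" "i \<le> N"
  shows "p = q"
proof -
  have "(f((i, e) := p)) (i, e) = (f((i, e) := q)) (i, e)"
    by (rule R_unique[where f = "f((i, e) := p)" and g = "f((i, e) := q)"]) (use assms in auto)
  then show ?thesis by simp
qed

text \<open>
  The boundary \<open>f\<close> sits at the facet \<open>(K, False)\<close> and \<open>f'\<close> at \<open>(K, True)\<close> of an \<open>N + 1\<close>-cube, all of whose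
  other facets are degenerate in direction \<open>K\<close> except \<open>(a, s)\<close> and \<open>(b, t)\<close>, which share the cube \<open>m\<close>.
\<close>

lemma transfer:
  assumes f: "range f \<subseteq> P" "range f' \<subseteq> P" and m: "m \<in> P"
    and K: "1 \<le> K" "K \<le> Suc N" and a: "1 \<le> a" "a \<le> Suc N" and b: "1 \<le> b" "b \<le> Suc N"
    and distinct: "a \<noteq> b" "a \<noteq> K" "b \<noteq> K"
    and agree: "\<And>x. x \<noteq> (unskip K a, s) \<Longrightarrow> x \<noteq> (unskip K b, t) \<Longrightarrow> f x = f' x"
    and A: "R (\<lambda>(i, e). if skip a i = K then (if e then f' else f) (unskip K a, s)
                   else if (skip a i, e) = (b, t) then m else z)"
    and B: "R (\<lambda>(i, e). if skip b i = K then (if e then f' else f) (unskip K b, t)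
                   else if (skip b i, e) = (a, s) then m else z)"
  shows "R f \<longleftrightarrow> R f'"
proof -
  \<comment> \<open>These are the codimension-two faces of the larger cube: on the two facets in
    direction \<open>K\<close> they are read from \<open>f\<close> and \<open>f'\<close>, the face
    shared by the two special facets is \<open>m\<close>, and the rest is \<open>z\<close>.\<close>
  define G where "G x y = (if fst x = K then (if snd x then f' else f) (unskip K (fst y), snd y)
      else if fst y = K then (if snd y then f' else f) (unskip K (fst x), snd x)
      else if {x, y} = {(a, s), (b, t)} then m else z)" for x y
  have "G x y \<in> P" for x y using f m by (auto simp: G_def)
  moreover have "G x y = G y x" if "fst x \<noteq> fst y" for x y
    using that by (auto simp: G_def insert_commute)
  ultimately have box: "1 \<le> I \<Longrightarrow> I \<le> Suc N \<Longrightarrow>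
      (\<And>J d. 1 \<le> J \<Longrightarrow> J \<le> Suc N \<Longrightarrow> (J, d) \<noteq> (I, E) \<Longrightarrow> R (\<lambda>(i, e). G (J, d) (skip J i, e))) \<Longrightarrow>
      R (\<lambda>(i, e). G (I, E) (skip I i, e))" for I E
    using R_box[of G I E] by blast
  have facet_K: "(\<lambda>(i, e). G (K, d) (skip K i, e)) = (if d then f' else f)" for d
    by (auto simp: G_def)
  have facet: "R (\<lambda>(i, e). G (J, d) (skip J i, e))" if J: "1 \<le> J" "J \<le> Suc N" "J \<noteq> K" for J d
  proof -
    consider "(J, d) = (a, s)" | "(J, d) = (b, t)" | "(J, d) \<noteq> (a, s)" "(J, d) \<noteq> (b, t)" by blast
    then show ?thesis
    proof cases
      case 1
      show ?thesis
        by (rule R_cong[OF A]) (use 1 distinct in \<open>auto simp: G_def doubleton_eq_iff\<close>)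
    next
      case 2
      show ?thesis
        by (rule R_cong[OF B]) (use 2 distinct in \<open>auto simp: G_def doubleton_eq_iff\<close>)
    next
      case 3
      \<comment> \<open>A facet that is not special has the same cube at both ends in direction
        \<open>K\<close>, by \<open>agree\<close>, and is trivial elsewhere, so it bounds as a
        degeneracy.\<close>
      let ?p = "f (unskip K J, d)" and ?i = "unskip J K"
      have "(unskip K J, d) \<noteq> (unskip K a, s)" "(unskip K J, d) \<noteq> (unskip K b, t)"
        using 3 distinct J by (auto simp: unskip_def split: if_splits)
      then have p: "f' (unskip K J, d) = ?p" using agree by metis
      have i: "1 \<le> ?i" "?i \<le> N" "skip J i = K \<longleftrightarrow> i = ?i" for i
        using J K by (auto simp: unskip_def skip_def)
      have "R ((\<lambda>_. z)((?i, False) := ?p, (?i, True) := ?p))"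
        using f i by (intro R_degen) auto
      then show ?thesis
        by (rule R_cong) (use 3 J p i(3) in \<open>auto simp: G_def doubleton_eq_iff\<close>)
    qed
  qed
  \<comment> \<open>Every facet outside direction \<open>K\<close> is now known to bound. The box
    lacking \<open>(K, True)\<close> gives one implication and the box lacking
    \<open>(K, False)\<close> the other.\<close>
  have "R f'" if "R f"
  proof -
    have "R (\<lambda>(i, e). G (J, d) (skip J i, e))"
      if "1 \<le> J" "J \<le> Suc N" "(J, d) \<noteq> (K, True)" for J d
      using that facet[of J d] facet_K[of d] \<open>R f\<close> by (cases "J = K") auto
    then show ?thesis using box[of K True] K facet_K[of True] by simp
  qed
  moreover have "R f" if "R f'"
  proof -
    have "R (\<lambda>(i, e). G (J, d) (skip J i, e))"
      if "1 \<le> J" "J \<le> Suc N" "(J, d) \<noteq> (K, False)" for J d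
      using that facet[of J d] facet_K[of d] \<open>R f'\<close> by (cases "J = K") auto
    then show ?thesis using box[of K False] K facet_K[of False] by simp
  qed
  ultimately show ?thesis by blast
qed

text \<open>
  The boundary of a concatenation square in directions \<open>j\<close> and \<open>j + 1\<close>; it will mean that \<open>r\<close> is the
  product of \<open>u\<close> and \<open>v\<close>.
\<close>

definition T :: "nat \<Rightarrow> 'p \<Rightarrow> 'p \<Rightarrow> 'p \<Rightarrow> bool" where
  "T j u v r \<longleftrightarrow> R ((\<lambda>_. z)((j, False) := u, (Suc j, True) := v, (Suc j, False) := r))"

lemma range_upd: "range f \<subseteq> P \<Longrightarrow> p \<in> P \<Longrightarrow> range (f(x := p)) \<subseteq> P"
  by auto

lemma range_z: "range (\<lambda>_. z) \<subseteq> P"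
  by auto

lemma R_ex1:
  assumes "range f \<subseteq> P" "1 \<le> i" "i \<le> N"
  shows "\<exists>!p. p \<in> P \<and> R (f((i, e) := p))"
proof -
  obtain p where p: "p \<in> P" "R (f((i, e) := p))"
    using R_exists[OF assms] by blast
  have "q = p" if "q \<in> P \<and> R (f((i, e) := q))" for q
    using R_unique_upd[of f i e q p] that p assms by simp
  then show ?thesis using p by blast
qed

text \<open>Any one of the three entries can serve as the missing facet of a box. Hence unique
  division on both sides comes along with the product, and inverses need no separate
  construction.\<close>

lemma T_ex1:
  assumes "1 \<le> j" "j < N"
  shows "u \<in> P \<Longrightarrow> v \<in> P \<Longrightarrow> \<exists>!r. r \<in> P \<and> T j u v r"
    and "u \<in> P \<Longrightarrow> r \<in> P \<Longrightarrow> \<exists>!v. v \<in> P \<and> T j u v r"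
    and "v \<in> P \<Longrightarrow> r \<in> P \<Longrightarrow> \<exists>!u. u \<in> P \<and> T j u v r"
proof -
  assume "u \<in> P" "v \<in> P"
  then show "\<exists>!r. r \<in> P \<and> T j u v r"
    unfolding T_def using assms by (intro R_ex1 range_upd range_z) auto
next
  assume P: "u \<in> P" "r \<in> P"
  have eq: "T j u v r \<longleftrightarrow> R ((\<lambda>_. z)((j, False) := u, (Suc j, False) := r, (Suc j, True) := v))" for v
    unfolding T_def by (rule R_cong_iff) auto
  show "\<exists>!v. v \<in> P \<and> T j u v r"
    unfolding eq using assms P by (intro R_ex1 range_upd range_z) auto
next
  assume P: "v \<in> P" "r \<in> P"
  have eq: "T j u v r \<longleftrightarrow> R ((\<lambda>_. z)((Suc j, True) := v, (Suc j, False) := r, (j, False) := u))" for u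
    unfolding T_def by (rule R_cong_iff) auto
  show "\<exists>!u. u \<in> P \<and> T j u v r"
    unfolding eq using assms P by (intro R_ex1 range_upd range_z) auto
qed

section \<open>Products in pairs of adjacent directions\<close>

definition mul :: "nat \<Rightarrow> 'p \<Rightarrow> 'p \<Rightarrow> 'p" where
  "mul j u v = (THE r. r \<in> P \<and> T j u v r)"

lemma mul_T:
  assumes "1 \<le> j" "j < N" "u \<in> P" "v \<in> P"
  shows mul_closed: "mul j u v \<in> P" and T_mul: "T j u v (mul j u v)"
  using theI'[OF T_ex1(1)[OF assms]] unfolding mul_def by simp_all

lemma T_iff:
  assumes "1 \<le> j" "j < N" "u \<in> P" "v \<in> P" "r \<in> P"
  shows "T j u v r \<longleftrightarrow> r = mul j u v"
proof
  show "T j u v r \<Longrightarrow> r = mul j u v"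
    unfolding mul_def using assms(5) by (intro the1_equality[OF T_ex1(1)[OF assms(1-4)], symmetric] conjI)
  show "r = mul j u v \<Longrightarrow> T j u v r"
    using T_mul[OF assms(1-4)] by simp
qed

lemma mul_solve_right:
  assumes "1 \<le> j" "j < N" "u \<in> P" "r \<in> P"
  obtains v where "v \<in> P" "mul j u v = r"
proof -
  obtain v where v: "v \<in> P" "T j u v r"
    using ex1_implies_ex[OF T_ex1(2)[OF assms]] by blast
  with that[OF v(1)] show ?thesis using T_iff[OF assms(1-3) v(1) assms(4)] by simp
qed

lemma mul_solve_left:
  assumes "1 \<le> j" "j < N" "v \<in> P" "r \<in> P"
  obtains u where "u \<in> P" "mul j u v = r"
proof -
  obtain u where u: "u \<in> P" "T j u v r"
    using ex1_implies_ex[OF T_ex1(3)[OF assms]] by blast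
  with that[OF u(1)] show ?thesis using T_iff[OF assms(1,2) u(1) assms(3,4)] by simp
qed

text \<open>A negative connection has \<open>u\<close> on two adjacent lower facets, which is a
  concatenation with trivial second factor. For \<open>mul_z_left\<close> a degeneracy in direction
  \<open>Suc j\<close> serves the same purpose.\<close>

lemma mul_z_right [simp]:
  assumes "1 \<le> j" "j < N" "u \<in> P"
  shows "mul j u z = u"
proof -
  have "T j u z u"
    unfolding T_def by (rule R_cong[OF R_conn[of u j]]) (use assms in auto)
  then show ?thesis using T_iff assms by auto
qed

lemma mul_z_left [simp]:
  assumes "1 \<le> j" "j < N" "v \<in> P"
  shows "mul j z v = v"
proof -
  have "T j z v v"
    unfolding T_def by (rule R_cong[OF R_degen[of v "Suc j"]]) (use assms in auto)
  then show ?thesis using T_iff assms by auto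
qed

text \<open>Removing \<open>p = f (j, False)\<close> divides the neighbouring lower facet by p on
  the left. Direction \<open>Suc j\<close> interpolates between the two boundaries: over
  \<open>(j, False)\<close> a connection absorbs p, and over the neighbour lies the concatenation
  square for \<open>mul j p q\<close>.\<close>

lemma R_push:
  assumes j: "1 \<le> j" "j < N" and f: "range f \<subseteq> P" and q: "q \<in> P"
    and T: "f (Suc j, False) = mul j (f (j, False)) q"
  shows "R f \<longleftrightarrow> R (f((j, False) := z, (Suc j, False) := q))"
proof (rule transfer[where K = "Suc j" and a = j and b = "Suc (Suc j)" and s = False and t = False
      and m = "f (j, False)"])
  have p: "f x \<in> P" for x using f by auto
  show "R (\<lambda>(i, e). if skip j i = Suc j then
        (if e then f((j, False) := z, (Suc j, False) := q) else f) (unskip (Suc j) j, False)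
      else if (skip j i, e) = (Suc (Suc j), False) then f (j, False) else z)"
    by (rule R_cong[OF R_conn[of "f (j, False)" j]]) (use j p in \<open>auto simp: skip_def unskip_def\<close>)
  have "T j (f (j, False)) q (f (Suc j, False))"
    using T T_mul[OF j p q] by simp
  then show "R (\<lambda>(i, e). if skip (Suc (Suc j)) i = Suc j then
        (if e then f((j, False) := z, (Suc j, False) := q) else f) (unskip (Suc j) (Suc (Suc j)), False)
      else if (skip (Suc (Suc j)) i, e) = (j, False) then f (j, False) else z)"
    unfolding T_def by (rule R_cong) (use j p in \<open>auto simp: skip_def unskip_def\<close>)
qed (use assms in \<open>auto simp: unskip_def\<close>)

text \<open>One boundary is pushed in two orders. Starting at direction \<open>j\<close> leaves the
  concatenation square for \<open>y\<close>, \<open>v\<close> and \<open>c\<close>; starting at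
  \<open>Suc j\<close> leaves one for \<open>a'\<close>, \<open>v\<close> and the quotient of
  \<open>c\<close> by \<open>mul j a y\<close>, and \<open>v\<close> is chosen so that this quotient
  is \<open>w\<close>.\<close>

lemma mul_mul:
  assumes j: "1 \<le> j" "Suc j < N" and P: "a \<in> P" "y \<in> P" "w \<in> P"
  shows "mul (Suc j) (mul j a y) w = mul (Suc j) y (mul (Suc j) a w)"
proof -
  obtain a' where a': "a' \<in> P" "mul j a a' = z"
    using mul_solve_right[of j a z] j P by auto
  obtain v where v: "v \<in> P" "mul (Suc j) a' v = w"
    using mul_solve_right[of "Suc j" a' w] j P a' by auto
  have *: "mul (Suc j) (mul j a y) w = mul (Suc j) y v" if y: "y \<in> P" for y
  proof -
    define b c where "b = mul j a y" and "c = mul (Suc j) y v"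
    have bc: "b \<in> P" "c \<in> P" using mul_closed j y P v by (auto simp: b_def c_def)
    obtain d where d: "d \<in> P" "mul (Suc j) b d = c"
      using mul_solve_right[of "Suc j" b c] j bc by auto
    let ?f = "(\<lambda>_. z)((j, False) := a, (Suc j, False) := b, (Suc (Suc j), False) := c,
        (Suc (Suc j), True) := v)"
    have "T (Suc j) y v c" using T_iff j y v bc by (simp add: c_def)
    have "R ?f \<longleftrightarrow> R (?f((j, False) := z, (Suc j, False) := y))"
      by (rule R_push) (use j P v bc y b_def in auto)
    also have "\<dots> \<longleftrightarrow> T (Suc j) y v c"
      unfolding T_def by (rule R_cong_iff) auto
    finally have f: "R ?f" using \<open>T (Suc j) y v c\<close> by simp
    let ?g = "?f((Suc j, False) := z, (Suc (Suc j), False) := d)"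
    have "R ?f \<longleftrightarrow> R ?g"
      by (rule R_push) (use j P v bc y d in auto)
    also have "\<dots> \<longleftrightarrow> R (?g((j, False) := z, (Suc j, False) := a'))"
      by (rule R_push) (use j P v bc y d a' in auto)
    also have "\<dots> \<longleftrightarrow> T (Suc j) a' v d"
      unfolding T_def by (rule R_cong_iff) auto
    finally have "T (Suc j) a' v d" using f by simp
    then have "d = w" using T_iff j a' v d by simp
    then show ?thesis using d by (simp add: b_def c_def)
  qed
  \<comment> \<open>The choice of \<open>v\<close> involves only \<open>a\<close> and
    \<open>w\<close>, so the case \<open>y = z\<close> identifies it.\<close>
  have "mul (Suc j) a w = v" using *[of z] j P v by simp
  then show ?thesis using *[OF P(2)] by simp
qed

text \<open>The case \<open>w = z\<close> of the preceding identity: products in neighbouring pairs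
  of directions are opposite to each other.\<close>

lemma mul_Suc_eq_flip:
  assumes j: "1 \<le> j" "Suc j < N" and P: "a \<in> P" "y \<in> P"
  shows "mul j a y = mul (Suc j) y a"
  using mul_mul[OF j P z_in] j P mul_closed[of j a y] by simp

text \<open>
  Commutativity needs a third direction: the facets \<open>(j, False)\<close> and \<open>(j + 1, False)\<close> are varied along
  direction \<open>j + 3\<close> of the larger cube, which is adjacent to neither.
\<close>

lemma mul_Suc_commute:
  assumes j: "1 \<le> j" "Suc j < N" and P: "p \<in> P" "v \<in> P"
  shows "mul (Suc j) p v = mul (Suc j) v p"
proof -
  define q where "q = mul j p v"
  have q: "q \<in> P" "q = mul (Suc j) v p"
    using mul_Suc_eq_flip j P mul_closed by (auto simp: q_def)
  \<comment> \<open>A left inverse of \<open>p\<close>; it becomes the cube shared by the facets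
    \<open>(j, False)\<close> and \<open>(Suc j, False)\<close> of the larger cube. Direction
    \<open>j + 3\<close> exists there because \<open>Suc j < N\<close>.\<close>
  obtain m where m: "m \<in> P" "mul j m p = z"
    using mul_solve_left[of j p z] j P by auto
  obtain u where u: "u \<in> P" "mul (Suc j) p u = q"
    using mul_solve_right[of "Suc j" p q] j P q by auto
  let ?f = "(\<lambda>_. z)((j, False) := p, (Suc j, True) := v, (Suc j, False) := q)"
  let ?g = "?f((j, False) := z, (Suc j, False) := u)"
  have "R ?f \<longleftrightarrow> R ?g"
  proof (rule transfer[where K = "Suc (Suc (Suc j))" and a = j and b = "Suc j" and s = False and t = False
        and m = m])
    let ?A = "(\<lambda>_. z)((j, False) := m, (Suc (Suc j), False) := p)"
    have "R ?A \<longleftrightarrow> R (?A((j, False) := z, (Suc j, False) := p))"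
      by (rule R_push) (use j P m in auto)
    also have "\<dots>"
      by (rule R_cong[OF R_conn[of p "Suc j"]]) (use j P in auto)
    finally have "R ?A" by simp
    then show "R (\<lambda>(i, e). if skip j i = Suc (Suc (Suc j)) then
          (if e then ?g else ?f) (unskip (Suc (Suc (Suc j))) j, False)
        else if (skip j i, e) = (Suc j, False) then m else z)"
      by (rule R_cong) (use j in \<open>auto simp: skip_def unskip_def\<close>)
    let ?B = "(\<lambda>_. z)((j, False) := m, (Suc (Suc j), False) := q, (Suc (Suc j), True) := u)"
    have "R ?B \<longleftrightarrow> R (?B((j, False) := z, (Suc j, False) := p))"
      by (rule R_push) (use j P m q u in auto)
    also have "\<dots> \<longleftrightarrow> T (Suc j) p u q"
      unfolding T_def by (rule R_cong_iff) auto
    also have "\<dots>"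
      using T_iff j P u q by simp
    finally have "R ?B" by simp
    then show "R (\<lambda>(i, e). if skip (Suc j) i = Suc (Suc (Suc j)) then
          (if e then ?g else ?f) (unskip (Suc (Suc (Suc j))) (Suc j), False)
        else if (skip (Suc j) i, e) = (j, False) then m else z)"
      by (rule R_cong) (use j in \<open>auto simp: skip_def unskip_def\<close>)
  qed (use j P q u m in \<open>auto simp: unskip_def\<close>)
  moreover have "R ?f" using T_iff[of j p v q] j P q unfolding T_def q_def by auto
  ultimately have "R ?g" by simp
  \<comment> \<open>Only two opposite facets are left, and comparison with a degeneracy makes them
    equal.\<close>
  then have "R ((\<lambda>_. z)((Suc j, True) := v, (Suc j, False) := u))"
    by (rule R_cong) auto
  moreover have "R ((\<lambda>_. z)((Suc j, True) := v, (Suc j, False) := v))"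
    by (rule R_cong[OF R_degen[of v "Suc j"]]) (use j P in auto)
  ultimately have "u = v"
    by (rule R_unique_upd) (use j P u in auto)
  then show ?thesis using u q by simp
qed

lemma mul_eq_mul_1:
  assumes "1 \<le> j" "j < N" "u \<in> P" "v \<in> P"
  shows "mul j u v = mul 1 u v"
  using assms(1,2)
proof (induction j rule: dec_induct)
  case (step j)
  then show ?case
    using mul_Suc_eq_flip[of j u v] mul_Suc_commute[of j u v] assms(3,4) by simp
qed simp

text \<open>\<open>3 \<le> N\<close> is what makes the pair of directions (2,3) available;
  commutativity there is carried back to the pair (1,2).\<close>

lemma mul_1_commute: "u \<in> P \<Longrightarrow> v \<in> P \<Longrightarrow> mul 1 u v = mul 1 v u"
  using mul_Suc_commute[of 1 u v] mul_eq_mul_1[of "Suc 1" u v] mul_eq_mul_1[of "Suc 1" v u] N by simp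

lemma mul_1_assoc: "a \<in> P \<Longrightarrow> y \<in> P \<Longrightarrow> w \<in> P \<Longrightarrow> mul 1 (mul 1 y a) w = mul 1 y (mul 1 a w)"
  using mul_mul[of 1 a y w] mul_eq_mul_1[of "Suc 1"] mul_1_commute[of a y] N mul_closed[of 1] by simp

section \<open>The abelian group and the moves for upper facets\<close>

definition facet_group :: "'p monoid" where
  "facet_group = \<lparr>carrier = P, mult = mul 1, one = z\<rparr>"

lemma facet_group_simps [simp]:
  "carrier facet_group = P" "u \<otimes>\<^bsub>facet_group\<^esub> v = mul 1 u v" "\<one>\<^bsub>facet_group\<^esub> = z"
  by (simp_all add: facet_group_def)

lemma facet_group: "comm_group facet_group"
proof (rule comm_groupI, unfold facet_group_simps)
  show "mul 1 x y \<in> P" if "x \<in> P" "y \<in> P" for x y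
    using that N by (simp add: mul_closed)
  show "mul 1 z x = x" if "x \<in> P" for x
    using that N by simp
  show "\<exists>y\<in>P. mul 1 y x = z" if "x \<in> P" for x
    using mul_solve_left[of 1 x z] that N by auto
qed (use mul_1_assoc mul_1_commute in blast)+

lemma facet_group_T:
  assumes "1 \<le> j" "j < N" "u \<in> P" "v \<in> P" "r \<in> P"
  shows "T j u v r \<longleftrightarrow> r = u \<otimes>\<^bsub>facet_group\<^esub> v"
  using T_iff[OF assms] mul_eq_mul_1[OF assms(1-4)] by simp

text \<open>An upper facet is merged into the lower facet one direction below. A connection again
  carries \<open>v\<close> across; what the lower facet turns into is at first only some
  \<open>q\<close> completing a boundary with \<open>u\<close> and \<open>v\<close>.\<close>

lemma push_down:
  assumes j: "1 \<le> j" "j < N" and f: "range f \<subseteq> P"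
  shows "R f \<longleftrightarrow> R (f((Suc j, True) := z, (j, False) := f (j, False) \<otimes>\<^bsub>facet_group\<^esub> f (Suc j, True)))"
proof -
  have general: "R g \<longleftrightarrow> R (g((Suc j, True) := z, (j, False) := q))"
    if W: "R ((\<lambda>_. z)((j, False) := u, (Suc j, True) := v, (j, True) := q))"
      and g: "range g \<subseteq> P" "g (j, False) = u" "g (Suc j, True) = v" "q \<in> P" for g u v q
  proof (rule transfer[where K = "Suc j" and a = "Suc (Suc j)" and b = j and s = True and t = False
        and m = v])
    have v: "v \<in> P" using g by auto
    show "R (\<lambda>(i, e). if skip (Suc (Suc j)) i = Suc j then
          (if e then g((Suc j, True) := z, (j, False) := q) else g) (unskip (Suc j) (Suc (Suc j)), True)
        else if (skip (Suc (Suc j)) i, e) = (j, False) then v else z)"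
      by (rule R_cong[OF R_conn[of v j]]) (use j v g in \<open>auto simp: skip_def unskip_def\<close>)
    show "R (\<lambda>(i, e). if skip j i = Suc j then
          (if e then g((Suc j, True) := z, (j, False) := q) else g) (unskip (Suc j) j, False)
        else if (skip j i, e) = (Suc (Suc j), True) then v else z)"
      by (rule R_cong[OF W]) (use j v g in \<open>auto simp: skip_def unskip_def\<close>)
  qed (use j g in \<open>auto simp: unskip_def\<close>)
  define u v where "u = f (j, False)" and "v = f (Suc j, True)"
  have P: "u \<in> P" "v \<in> P" "mul 1 u v \<in> P"
    using f mul_closed[of 1 u v] N by (auto simp: u_def v_def)
  \<comment> \<open>To determine \<open>q\<close>, the move is applied to the concatenation square
    of \<open>u\<close> and \<open>v\<close> itself. Its result has the shape of the boundary of a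
    connection, which forces \<open>q\<close> to be the product.\<close>
  obtain q where q: "q \<in> P" "R ((\<lambda>_. z)((j, False) := u, (Suc j, True) := v, (j, True) := q))"
    using R_exists[of "(\<lambda>_. z)((j, False) := u, (Suc j, True) := v)" j True] j P by auto
  let ?g = "(\<lambda>_. z)((j, False) := u, (Suc j, True) := v, (Suc j, False) := mul 1 u v)"
  have "R ?g"
    using facet_group_T[OF j P] by (simp add: T_def)
  moreover have "R ?g \<longleftrightarrow> R (?g((Suc j, True) := z, (j, False) := q))"
    by (rule general[OF q(2)]) (use P q in auto)
  moreover have "\<dots> \<longleftrightarrow> R ((\<lambda>_. z)((Suc j, False) := mul 1 u v, (j, False) := q))"
    by (rule R_cong_iff) auto
  moreover have "R ((\<lambda>_. z)((Suc j, False) := mul 1 u v, (j, False) := mul 1 u v))"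
    by (rule R_cong[OF R_conn[of "mul 1 u v" j]]) (use j P in auto)
  ultimately have "q = mul 1 u v"
    using R_unique_upd[of "(\<lambda>_. z)((Suc j, False) := mul 1 u v)" j False q "mul 1 u v"] j P q by auto
  then show ?thesis
    using general[OF q(2) f] q(1) by (simp add: u_def v_def)
qed

text \<open>The counterpart for an upper facet that has a direction above it: it is merged into the
  next lower facet. As in \<open>push_down\<close>, an auxiliary facet \<open>q\<close> is computed
  from a concatenation square before the move is made.\<close>

lemma push_up:
  assumes j: "1 \<le> j" "j < N" and f: "range f \<subseteq> P"
  shows "R f \<longleftrightarrow> R (f((j, True) := z, (Suc j, False) := f (Suc j, False) \<otimes>\<^bsub>facet_group\<^esub> f (j, True)))"
proof -
  define u v where "u = f (Suc j, False)" and "v = f (j, True)"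
  have P: "u \<in> P" "v \<in> P" "mul 1 u v \<in> P"
    using f mul_closed[of 1 u v] N by (auto simp: u_def v_def)
  obtain q where q: "q \<in> P" "R ((\<lambda>_. z)((j, True) := v, (Suc j, False) := u, (Suc j, True) := q))"
    using R_exists[of "(\<lambda>_. z)((j, True) := v, (Suc j, False) := u)" "Suc j" True] j P by auto
  let ?g = "(\<lambda>_. z)((j, False) := u, (Suc j, True) := v, (Suc j, False) := mul 1 u v)"
  have "R ?g"
    using facet_group_T[OF j P] by (simp add: T_def)
  moreover have "R ?g \<longleftrightarrow> R (?g((Suc j, True) := z, (j, False) := q))"
  proof (rule transfer[where K = "Suc (Suc j)" and a = "Suc j" and b = j and s = True and t = False
        and m = v])
    show "R (\<lambda>(i, e). if skip (Suc j) i = Suc (Suc j) then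
          (if e then ?g((Suc j, True) := z, (j, False) := q) else ?g) (unskip (Suc (Suc j)) (Suc j), True)
        else if (skip (Suc j) i, e) = (j, False) then v else z)"
      by (rule R_cong[OF R_conn[of v j]]) (use j P in \<open>auto simp: skip_def unskip_def\<close>)
    show "R (\<lambda>(i, e). if skip j i = Suc (Suc j) then
          (if e then ?g((Suc j, True) := z, (j, False) := q) else ?g) (unskip (Suc (Suc j)) j, False)
        else if (skip j i, e) = (Suc j, True) then v else z)"
      by (rule R_cong[OF q(2)]) (use j P in \<open>auto simp: skip_def unskip_def\<close>)
  qed (use j P q in \<open>auto simp: unskip_def\<close>)
  moreover have "\<dots> \<longleftrightarrow> R ((\<lambda>_. z)((Suc j, False) := mul 1 u v, (j, False) := q))"
    by (rule R_cong_iff) auto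
  moreover have "R ((\<lambda>_. z)((Suc j, False) := mul 1 u v, (j, False) := mul 1 u v))"
    by (rule R_cong[OF R_conn[of "mul 1 u v" j]]) (use j P in auto)
  ultimately have eq: "q = mul 1 u v"
    using R_unique_upd[of "(\<lambda>_. z)((Suc j, False) := mul 1 u v)" j False q "mul 1 u v"] j P q by auto
  show ?thesis
  proof (rule transfer[where K = "Suc j" and a = j and b = "Suc (Suc j)" and s = True and t = False
        and m = v])
    show "R (\<lambda>(i, e). if skip j i = Suc j then
          (if e then f((j, True) := z, (Suc j, False) := f (Suc j, False) \<otimes>\<^bsub>facet_group\<^esub> f (j, True)) else f)
            (unskip (Suc j) j, True)
        else if (skip j i, e) = (Suc (Suc j), False) then v else z)"
      by (rule R_cong[OF R_conn[of v j]]) (use j P v_def in \<open>auto simp: skip_def unskip_def\<close>)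
    show "R (\<lambda>(i, e). if skip (Suc (Suc j)) i = Suc j then
          (if e then f((j, True) := z, (Suc j, False) := f (Suc j, False) \<otimes>\<^bsub>facet_group\<^esub> f (j, True)) else f)
            (unskip (Suc j) (Suc (Suc j)), False)
        else if (skip (Suc (Suc j)) i, e) = (j, True) then v else z)"
      by (rule R_cong[OF q(2)]) (use j P u_def v_def eq in \<open>auto simp: skip_def unskip_def\<close>)
  qed (use j P f u_def v_def in \<open>auto simp: unskip_def\<close>)
qed

section \<open>Signed facet sums\<close>

definition signed :: "(nat \<times> bool \<Rightarrow> 'p) \<Rightarrow> nat \<times> bool \<Rightarrow> 'p" where
  "signed f = (\<lambda>(i, e). f (i, e) [^]\<^bsub>facet_group\<^esub> ((- 1) ^ (i + of_bool e) :: int))"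

text \<open>The exponents are the signs of \<open>chain_diff\<close>, so this is the cubical
  boundary formula with values in the facet group.\<close>

definition boundary_sum :: "(nat \<times> bool \<Rightarrow> 'p) \<Rightarrow> 'p" where
  "boundary_sum f = finprod facet_group (signed f) ({1..N} \<times> UNIV)"

lemma signed_closed: "range f \<subseteq> P \<Longrightarrow> signed f \<in> A \<rightarrow> carrier facet_group"
proof -
  interpret comm_group facet_group by (rule facet_group)
  assume "range f \<subseteq> P"
  then show ?thesis
    using int_pow_closed by (auto simp: signed_def image_subset_iff)
qed

lemma boundary_sum_upd:
  assumes f: "range f \<subseteq> P" and p: "p \<in> P" "q \<in> P"
    and xy: "x \<noteq> y" "x \<in> {1..N} \<times> UNIV" "y \<in> {1..N} \<times> UNIV"
    and eq: "signed f x \<otimes>\<^bsub>facet_group\<^esub> signed f y =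
      signed (f(x := p, y := q)) x \<otimes>\<^bsub>facet_group\<^esub> signed (f(x := p, y := q)) y"
  shows "boundary_sum f = boundary_sum (f(x := p, y := q))"
proof -
  interpret comm_group facet_group by (rule facet_group)
  let ?A = "{1..N} \<times> (UNIV :: bool set) - {x} - {y}"
  have A: "{1..N} \<times> UNIV = insert x (insert y ?A)" using xy by auto
  have split: "boundary_sum g = (signed g x \<otimes>\<^bsub>facet_group\<^esub> signed g y) \<otimes>\<^bsub>facet_group\<^esub> finprod facet_group (signed g) ?A"
    if "range g \<subseteq> P" for g
  proof -
    note c = signed_closed[OF that]
    have c': "signed g x \<in> carrier facet_group" "signed g y \<in> carrier facet_group"
      using c[of UNIV] by auto
    have "finprod facet_group (signed g) (insert x (insert y ?A)) =
        signed g x \<otimes>\<^bsub>facet_group\<^esub> (signed g y \<otimes>\<^bsub>facet_group\<^esub> finprod facet_group (signed g) ?A)"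
      using xy c c' by (subst finprod_insert; (subst finprod_insert)?) auto
    then show ?thesis
      unfolding boundary_sum_def A[symmetric] using m_assoc c' finprod_closed[OF c] by metis
  qed
  have g: "range (f(x := p, y := q)) \<subseteq> P" using f p by auto
  have "finprod facet_group (signed f) ?A = finprod facet_group (signed (f(x := p, y := q))) ?A"
    by (rule finprod_cong') (use signed_closed[OF g] in \<open>auto simp: signed_def\<close>)
  then show ?thesis using split[OF f] split[OF g] eq by simp
qed

lemma R_zero_but_last:
  assumes "R f" "range f \<subseteq> P" "1 \<le> i" "i \<le> N"
    and "\<And>j d. 1 \<le> j \<Longrightarrow> j \<le> N \<Longrightarrow> (j, d) \<noteq> (i, e) \<Longrightarrow> f (j, d) = z"
  shows "f (i, e) = z"
proof -
  have "R (\<lambda>_. z)"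
    by (rule R_cong[OF R_degen[of z i]]) (use assms in auto)
  then show ?thesis
    using R_unique[of f "\<lambda>_. z" i e] assms by auto
qed

lemma boundary_sum_zero:
  assumes "\<And>i e. 1 \<le> i \<Longrightarrow> i \<le> N \<Longrightarrow> f (i, e) = z"
  shows "boundary_sum f = z"
proof -
  interpret comm_group facet_group by (rule facet_group)
  have "z [^]\<^bsub>facet_group\<^esub> (k :: int) = z" for k
    using int_pow_one by simp
  then show ?thesis
    unfolding boundary_sum_def using assms finprod_one_eqI[of "{1..N} \<times> UNIV" "signed f"]
    by (auto simp: signed_def)
qed

lemma signed_simps:
  "even i \<Longrightarrow> f (i, False) \<in> P \<Longrightarrow> signed f (i, False) = f (i, False)"
  "odd i \<Longrightarrow> f (i, False) \<in> P \<Longrightarrow> signed f (i, False) = inv\<^bsub>facet_group\<^esub> f (i, False)"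
  "odd i \<Longrightarrow> f (i, True) \<in> P \<Longrightarrow> signed f (i, True) = f (i, True)"
  "even i \<Longrightarrow> f (i, True) \<in> P \<Longrightarrow> signed f (i, True) = inv\<^bsub>facet_group\<^esub> f (i, True)"
proof -
  interpret comm_group facet_group by (rule facet_group)
  show "even i \<Longrightarrow> f (i, False) \<in> P \<Longrightarrow> signed f (i, False) = f (i, False)"
    "odd i \<Longrightarrow> f (i, False) \<in> P \<Longrightarrow> signed f (i, False) = inv\<^bsub>facet_group\<^esub> f (i, False)"
    "odd i \<Longrightarrow> f (i, True) \<in> P \<Longrightarrow> signed f (i, True) = f (i, True)"
    "even i \<Longrightarrow> f (i, True) \<in> P \<Longrightarrow> signed f (i, True) = inv\<^bsub>facet_group\<^esub> f (i, True)"
    by (simp_all add: signed_def int_pow_neg int_pow_1)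
qed

text \<open>Every push preserves both \<open>R\<close> and the signed sum, so it suffices to push
  until one facet remains, which uniqueness makes trivial. Upper facets are cleared in increasing
  direction by \<open>push_up\<close>, then lower ones by \<open>R_push\<close>; in both inductions
  the directions below \<open>N - k\<close> are already clear.\<close>

theorem boundary_sum_eq_zero:
  assumes "R f" "range f \<subseteq> P"
  shows "boundary_sum f = z"
proof -
  interpret comm_group facet_group by (rule facet_group)
  have inv_z: "inv\<^bsub>facet_group\<^esub> z = z" using inv_one by simp
  have lower: "boundary_sum f = z"
    if "R f" "range f \<subseteq> P" "\<And>i. 1 \<le> i \<Longrightarrow> i \<le> N \<Longrightarrow> f (i, True) = z"
      "\<And>i. 1 \<le> i \<Longrightarrow> i < N - k \<Longrightarrow> f (i, False) = z" for f k
    using that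
  proof (induction k arbitrary: f)
    case 0
    then have "f (j, d) = z" if "1 \<le> j" "j \<le> N" "(j, d) \<noteq> (N, False)" for j d
      using that by (cases d) auto
    moreover from this have "f (N, False) = z"
      using R_zero_but_last[of f N False] 0 N by auto
    ultimately have "f (i, e) = z" if "1 \<le> i" "i \<le> N" for i e
      using that by metis
    then show ?case by (rule boundary_sum_zero)
  next
    case (Suc k)
    show ?case
    proof (cases "Suc k < N")
      case False
      then show ?thesis using Suc.IH[of f] Suc.prems by auto
    next
      case True
      define j where "j = N - Suc k"
      have j: "1 \<le> j" "j < N" "N - k = Suc j" using True by (auto simp: j_def)
      define u v where "u = f (j, False)" and "v = f (Suc j, False)"
      have P: "u \<in> P" "v \<in> P" using Suc.prems(2) by (auto simp: u_def v_def)
      \<comment> \<open>The two facets carry opposite signs, so replacing \<open>(u, v)\<close> by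
        the trivial cube and this quotient leaves the sum unchanged.\<close>
      define q where "q = inv\<^bsub>facet_group\<^esub> u \<otimes>\<^bsub>facet_group\<^esub> v"
      have q: "q \<in> P" "v = u \<otimes>\<^bsub>facet_group\<^esub> q"
        using P inv_closed[of u] m_closed[of "inv\<^bsub>facet_group\<^esub> u" v] m_assoc[of u "inv\<^bsub>facet_group\<^esub> u" v]
          r_inv[of u] l_one[of v] by (auto simp: q_def simp del: facet_group_simps(2))
      let ?g = "f((j, False) := z, (Suc j, False) := q)"
      have "R ?g"
        using R_push[OF j(1,2) Suc.prems(2) q(1)] Suc.prems(1) q(2) mul_eq_mul_1[OF j(1,2) P(1) q(1)]
        by (simp add: u_def v_def)
      have "boundary_sum ?g = z"
      proof (rule Suc.IH)
        show "R ?g" by fact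
        show "range ?g \<subseteq> P" using Suc.prems(2) q by auto
      qed (use Suc.prems j j_def in auto)
      moreover have "boundary_sum f = boundary_sum ?g"
      proof (rule boundary_sum_upd)
        show "signed f (j, False) \<otimes>\<^bsub>facet_group\<^esub> signed f (Suc j, False) =
            signed ?g (j, False) \<otimes>\<^bsub>facet_group\<^esub> signed ?g (Suc j, False)"
          using P q(1) cancel_left[of u q] inv_cancel_left[of u q] q(2) inv_closed[of q] N
          by (cases "even j") (simp_all add: signed_simps inv_z u_def[symmetric] v_def[symmetric])
      qed (use Suc.prems q j in auto)
      ultimately show ?thesis by simp
    qed
  qed
  have upper: "boundary_sum f = z"
    if "R f" "range f \<subseteq> P" "\<And>i. 1 \<le> i \<Longrightarrow> i < N - k \<Longrightarrow> f (i, True) = z" for f k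
    using that
  proof (induction k arbitrary: f)
    case 0
    \<comment> \<open>Direction \<open>N\<close> has no direction above it, so the last upper facet
      is pushed down to \<open>(N - 1, False)\<close>. Taking \<open>k = N\<close> in
      \<open>lower\<close> afterwards imposes nothing on the lower facets.\<close>
    define j where "j = N - 1"
    have j: "1 \<le> j" "j < N" "N = Suc j" using N by (auto simp: j_def)
    define u v where "u = f (j, False)" and "v = f (Suc j, True)"
    have P: "u \<in> P" "v \<in> P" "u \<otimes>\<^bsub>facet_group\<^esub> v \<in> P"
      using 0(2) mul_closed[of 1 u v] N by (auto simp: u_def v_def)
    let ?g = "f((Suc j, True) := z, (j, False) := u \<otimes>\<^bsub>facet_group\<^esub> v)"
    have "boundary_sum ?g = z"
    proof (rule lower[of _ N])
      show "R ?g" using push_down[OF j(1,2) 0(2)] 0(1) by (simp add: u_def v_def)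
      show "range ?g \<subseteq> P" using 0(2) P by auto
    qed (use 0(3) j in auto)
    moreover have "boundary_sum f = boundary_sum ?g"
    proof (rule boundary_sum_upd)
      show "signed f (Suc j, True) \<otimes>\<^bsub>facet_group\<^esub> signed f (j, False) =
          signed ?g (Suc j, True) \<otimes>\<^bsub>facet_group\<^esub> signed ?g (j, False)"
        using P m_comm[of u v] inv_mult[of u v] m_comm[of "inv\<^bsub>facet_group\<^esub> u" "inv\<^bsub>facet_group\<^esub> v"]
          inv_closed[of u] inv_closed[of v] inv_closed[of "u \<otimes>\<^bsub>facet_group\<^esub> v"] N
        by (cases "even j") (simp_all add: signed_simps inv_z u_def[symmetric] v_def[symmetric])
    qed (use 0 P j in auto)
    ultimately show ?case by simp
  next
    case (Suc k)
    show ?case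
    proof (cases "Suc k < N")
      case False
      then show ?thesis using Suc.IH[of f] Suc.prems by auto
    next
      case True
      define j where "j = N - Suc k"
      have j: "1 \<le> j" "j < N" "N - k = Suc j" using True by (auto simp: j_def)
      define u v where "u = f (Suc j, False)" and "v = f (j, True)"
      have P: "u \<in> P" "v \<in> P" "u \<otimes>\<^bsub>facet_group\<^esub> v \<in> P"
        using Suc.prems(2) mul_closed[of 1 u v] N by (auto simp: u_def v_def)
      let ?g = "f((j, True) := z, (Suc j, False) := u \<otimes>\<^bsub>facet_group\<^esub> v)"
      have "boundary_sum ?g = z"
      proof (rule Suc.IH)
        show "R ?g" using push_up[OF j(1,2) Suc.prems(2)] Suc.prems(1) by (simp add: u_def v_def)
        show "range ?g \<subseteq> P" using Suc.prems(2) P by auto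
      qed (use Suc.prems j j_def in auto)
      moreover have "boundary_sum f = boundary_sum ?g"
      proof (rule boundary_sum_upd)
        show "signed f (j, True) \<otimes>\<^bsub>facet_group\<^esub> signed f (Suc j, False) =
            signed ?g (j, True) \<otimes>\<^bsub>facet_group\<^esub> signed ?g (Suc j, False)"
          using P m_comm[of u v] inv_mult[of u v] m_comm[of "inv\<^bsub>facet_group\<^esub> u" "inv\<^bsub>facet_group\<^esub> v"]
            inv_closed[of u] inv_closed[of v] inv_closed[of "u \<otimes>\<^bsub>facet_group\<^esub> v"] N
          by (cases "even j") (simp_all add: signed_simps inv_z u_def[symmetric] v_def[symmetric])
      qed (use Suc.prems P j in auto)
      ultimately show ?thesis by simp
    qed
  qed
  show ?thesis using upper[of f N] assms by simp
qed

end

section \<open>Spherical cubes\<close>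

locale pointed_cubical = cubical_set +
  fixes x :: 'a
  assumes x_in: "x \<in> cells X 0"
begin

definition pt :: "nat \<Rightarrow> 'a" where
  "pt n = const_cube X n x"

lemma act_pt:
  assumes "box_map m n \<phi>"
  shows "act X m n \<phi> (pt n) = pt m"
proof -
  have "compose (cube m) (terminal n) \<phi> = terminal m"
    by (rule box_map_eqI[OF box_comp[OF assms box_terminal] box_terminal])
       (simp add: compose_eq terminal_def box_map_length[OF assms])
  then show ?thesis
    using act_comp[OF assms box_terminal x_in] by (simp add: pt_def const_cube_def)
qed

lemma pt_in [simp, intro]: "pt n \<in> cells X n"
  by (simp add: pt_def const_cube_def act_closed[OF box_terminal x_in])

lemma fc_pt [simp]: "1 \<le> i \<Longrightarrow> i \<le> Suc n \<Longrightarrow> fc n i e (pt (Suc n)) = pt n"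
  by (simp add: fc_def act_pt box_face')

lemma dg_pt [simp]: "1 \<le> i \<Longrightarrow> i \<le> Suc n \<Longrightarrow> dg n i (pt n) = pt (Suc n)"
  by (simp add: dg_def act_pt box_degen')

lemma cn_pt [simp]: "1 \<le> i \<Longrightarrow> i \<le> n \<Longrightarrow> cn n i (pt n) = pt (Suc n)"
  by (simp add: cn_def act_pt box_conn')

definition sph :: "nat \<Rightarrow> 'a \<Rightarrow> bool" where
  "sph n a \<longleftrightarrow> a \<in> cells X n \<and> (\<forall>i e. 1 \<le> i \<longrightarrow> i \<le> n \<longrightarrow> fc (n - 1) i e a = pt (n - 1))"

text \<open>Homotopy relative to the boundary, with the direction \<open>p\<close> kept as a
  parameter: fillings use direction 1, whereas paths in an iterated loop space use the last
  direction.\<close>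

definition homot :: "nat \<Rightarrow> nat \<Rightarrow> 'a \<Rightarrow> 'a \<Rightarrow> bool" where
  "homot p n a b \<longleftrightarrow> (\<exists>t \<in> cells X (Suc n). fc n p False t = a \<and> fc n p True t = b \<and>
     (\<forall>i e. 1 \<le> i \<longrightarrow> i \<le> Suc n \<longrightarrow> i \<noteq> p \<longrightarrow> fc n i e t = pt n))"

lemma sph_pt [simp]: "sph n (pt n)"
  by (cases n) (simp_all add: sph_def)

lemma sph_cell [simp]: "sph n a \<Longrightarrow> a \<in> cells X n"
  by (simp add: sph_def)

lemma sph_fc [simp]: "sph (Suc n) a \<Longrightarrow> 1 \<le> i \<Longrightarrow> i \<le> Suc n \<Longrightarrow> fc n i e a = pt n"
  by (simp add: sph_def)

lemma fc_dg_sph: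
  assumes "sph n a" "1 \<le> i" "i \<le> Suc n" "1 \<le> j" "j \<le> Suc n" "j \<noteq> i"
  shows "fc n j e (dg n i a) = pt n"
proof -
  obtain m where m: "n = Suc m" using assms by (cases n) auto
  show ?thesis
  proof (cases "j < i")
    case True
    then obtain i' where "i = Suc i'" by (cases i) auto
    then show ?thesis using assms True m fc_dg_lt[of a m j i' e] by simp
  next
    case False
    then obtain j' where "j = Suc j'" by (cases j) (use assms in auto)
    then show ?thesis using assms False m fc_dg_gt[of a m i j' e] by simp
  qed
qed

lemma fc_cn_sph:
  assumes "sph n a" "1 \<le> i" "i \<le> n" "1 \<le> j" "j \<le> Suc n"
  shows "fc n j e (cn n i a) = (if (j = i \<or> j = Suc i) \<and> \<not> e then a else pt n)"
proof -
  obtain m where m: "n = Suc m" using assms by (cases n) auto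
  consider "j < i" | "j = i \<or> j = Suc i" "e" | "j = i \<or> j = Suc i" "\<not> e" | "Suc i < j" by linarith
  then show ?thesis
  proof cases
    case 1
    then obtain i' where "i = Suc i'" by (cases i) auto
    then show ?thesis using assms 1 m fc_cn_lt[of a m j i' e] by simp
  next
    case 2
    then show ?thesis using assms m fc_cn_True[of a m i j] by auto
  next
    case 3
    then show ?thesis using assms m fc_cn_False[of a n i j] by auto
  next
    case 4
    then obtain j' where "j = Suc j'" by (cases j) auto
    then show ?thesis using assms 4 m fc_cn_gt[of a m i j' e] by simp
  qed
qed

end

section \<open>Homotopies between spherical cubes in a Kan complex\<close>

locale pointed_kan = pointed_cubical + kan_complex
begin

text \<open>The lid of a cylinder on \<open>w\<close> that moves one facet along the given homotopy
  and keeps the others fixed. Sphericity makes the moving side agree with its stationary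
  neighbours.\<close>

lemma replace_face:
  assumes w: "w \<in> cells X (Suc n)" and i: "1 \<le> i" "i \<le> Suc n"
    and sph: "sph n (fc n i e w)" and hom: "homot 1 n (fc n i e w) b"
  shows "\<exists>w' \<in> cells X (Suc n). fc n i e w' = b \<and>
    (\<forall>j d. 1 \<le> j \<longrightarrow> j \<le> Suc n \<longrightarrow> (j, d) \<noteq> (i, e) \<longrightarrow> fc n j d w' = fc n j d w)"
proof -
  obtain t where t: "t \<in> cells X (Suc n)" "fc n 1 False t = fc n i e w" "fc n 1 True t = b"
    "\<And>i e. 1 \<le> i \<Longrightarrow> i \<le> Suc n \<Longrightarrow> i \<noteq> 1 \<Longrightarrow> fc n i e t = pt n"
    using hom by (auto simp: homot_def)
  let ?t = "\<lambda>j d. if (j, d) = (i, e) then t else dg n 1 (fc n j d w)"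
  have "\<exists>v \<in> cells X (Suc (Suc n)). fc (Suc n) 1 False v = w \<and>
    (\<forall>j d. 1 \<le> j \<longrightarrow> j \<le> Suc n \<longrightarrow> fc (Suc n) (Suc j) d v = ?t j d)"
  proof (rule cylinder[OF w])
    fix j c k d assume jk: "1 \<le> j" "j \<le> k" "k \<le> n"
    then obtain m where m: "n = Suc m" by (cases n) auto
    have side: "fc n (Suc l) b (?t l' b') = dg m 1 (fc m l b (fc n l' b' w))"
      if "1 \<le> l" "l \<le> n" "1 \<le> l'" "l' \<le> Suc n" for l b l' b'
      using that m t(4) sph w fc_dg_gt[of "fc n l' b' w" m 1 l b] by auto
    show "fc n (Suc j) c (?t (Suc k) d) = fc n (Suc k) d (?t j c)"
      using side[of j "Suc k" c d] side[of k j d c] jk fc_fc[of w m j k c d] m w by simp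
  qed (use w t i in auto)
  then obtain v where v: "v \<in> cells X (Suc (Suc n))" "fc (Suc n) 1 False v = w"
    "\<And>j d. 1 \<le> j \<Longrightarrow> j \<le> Suc n \<Longrightarrow> fc (Suc n) (Suc j) d v = ?t j d" by blast
  have *: "fc n j d (fc (Suc n) 1 True v) = fc n 1 True (?t j d)" if "1 \<le> j" "j \<le> Suc n" for j d
    using fc_fc[of v n 1 j True d] v that by simp
  show ?thesis
  proof (intro bexI[of _ "fc (Suc n) 1 True v"] conjI allI impI)
    show "fc n i e (fc (Suc n) 1 True v) = b" using *[of i e] i t by simp
    fix j d assume "1 \<le> j" "j \<le> Suc n" "(j, d) \<noteq> (i, e)"
    then show "fc n j d (fc (Suc n) 1 True v) = fc n j d w"
      using *[of j d] w by auto
  qed (use v in auto)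
qed

text \<open>Take a cylinder with ends \<open>w\<close> and \<open>w'\<close> whose sides are
  stationary, leaving out the side over the facet \<open>(i, e)\<close> where they may differ. The
  filler supplies that side, and it is the homotopy.\<close>

lemma homot_unique:
  assumes w: "w \<in> cells X (Suc n)" "w' \<in> cells X (Suc n)" and i: "1 \<le> i" "i \<le> Suc n"
    and sph: "sph n (fc n i e w)"
    and eq: "\<And>j d. 1 \<le> j \<Longrightarrow> j \<le> Suc n \<Longrightarrow> (j, d) \<noteq> (i, e) \<Longrightarrow> fc n j d w = fc n j d w'"
  shows "homot 1 n (fc n i e w) (fc n i e w')"
proof -
  let ?y = "\<lambda>J d. if J = 1 then (if d then w' else w) else dg n 1 (fc n (J - 1) d w)"
  have side: "fc n (Suc l) b (dg n 1 (fc n l' b' w)) = dg (n - 1) 1 (fc (n - 1) l b (fc n l' b' w))"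
    if "1 \<le> l" "l \<le> n" "1 \<le> l'" "l' \<le> Suc n" for l b l' b'
    using that w fc_dg_gt[of "fc n l' b' w" "n - 1" 1 l b] by (cases n) auto
  have "\<exists>v \<in> cells X (Suc (Suc n)). \<forall>j d. 1 \<le> j \<longrightarrow> j \<le> Suc (Suc n) \<longrightarrow> (j, d) \<noteq> (Suc i, e) \<longrightarrow>
      fc (Suc n) j d v = ?y j d"
  proof (rule kan_fill)
    fix m j c k d
    assume a: "Suc n = Suc m" "1 \<le> j" "j \<le> k" "k \<le> Suc n" "(j, c) \<noteq> (Suc i, e)" "(Suc k, d) \<noteq> (Suc i, e)"
    show "fc m j c (?y (Suc k) d) = fc m k d (?y j c)"
    proof (cases "j = 1")
      case True
      then show ?thesis using a w eq[of k d] by auto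
    next
      case False
      then obtain j' k' m' where jk: "j = Suc j'" "k = Suc k'" "1 \<le> j'" "n = Suc m'"
        using a by (cases j; cases k; cases n) auto
      then show ?thesis
        using a side[of j' "Suc k'" c d] side[of k' j' d c] fc_fc[of w m' j' k' c d] w by auto
    qed
  qed (use w i in auto)
  then obtain v where v: "v \<in> cells X (Suc (Suc n))" "\<And>j d. 1 \<le> j \<Longrightarrow> j \<le> Suc (Suc n) \<Longrightarrow>
      (j, d) \<noteq> (Suc i, e) \<Longrightarrow> fc (Suc n) j d v = ?y j d" by blast
  let ?u = "fc (Suc n) (Suc i) e v"
  have ends: "fc n 1 d ?u = fc n i e (if d then w' else w)" for d
    using fc_fc[of v n 1 i d e] v i by simp
  \<comment> \<open>The other faces of the new side belong to stationary sides, and they lie over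
    faces of the spherical facet \<open>(i, e)\<close>.\<close>
  have "fc n J c ?u = pt n" if J: "1 \<le> J" "J \<le> Suc n" "J \<noteq> 1" for J c
  proof -
    obtain j m where j: "J = Suc j" "1 \<le> j" "j \<le> n" "n = Suc m" using J by (cases J; cases n) auto
    have sph': "fc m j c (fc n i e w) = pt m" using sph j by simp
    show ?thesis
    proof (cases "J \<le> i")
      case True
      then obtain i' where i': "i = Suc i'" "j \<le> i'" "1 \<le> i'" "i' \<le> n" using j i by (cases i) auto
      have "fc n J c ?u = fc n i e (fc (Suc n) J c v)"
        using fc_fc[of v n J i c e] v i True J by simp
      also have "\<dots> = dg m 1 (fc m i' e (fc n j c w))"
        using v(2)[of J c] side[of i' j e c] j i i' J True by auto
      also have "fc m i' e (fc n j c w) = fc m j c (fc n i e w)"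
        using fc_fc[of w m j i' c e] w i' j by simp
      finally show ?thesis using sph' j by simp
    next
      case False
      then have "fc n J c ?u = fc n (Suc i) e (fc (Suc n) (Suc J) c v)"
        using fc_fc[of v n "Suc i" J e c] v i J by simp
      also have "\<dots> = dg m 1 (fc m i e (fc n (Suc j) c w))"
        using v(2)[of "Suc J" c] side[of i "Suc j" e c] j i J False by auto
      also have "fc m i e (fc n (Suc j) c w) = fc m j c (fc n i e w)"
        using fc_fc[of w m i j e c] w i j False by simp
      finally show ?thesis using sph' j by simp
    qed
  qed
  then show ?thesis
    unfolding homot_def using ends v i by (intro bexI[of _ ?u]) auto
qed

lemma homot_refl:
  assumes "sph n a" "1 \<le> p" "p \<le> Suc n"
  shows "homot p n a a"
  unfolding homot_def using assms fc_dg_sph by (intro bexI[of _ "dg n p a"]) auto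

text \<open>The constant homotopy of \<open>a\<close> has \<open>a\<close> at both ends; replacing
  the lower end by \<open>b\<close> reverses the direction. Transitivity likewise replaces the upper
  end of a homotopy.\<close>

lemma homot_sym:
  assumes a: "sph n a" and h: "homot 1 n a b"
  shows "homot 1 n b a"
proof -
  have "\<exists>w' \<in> cells X (Suc n). fc n 1 False w' = b \<and>
    (\<forall>j d. 1 \<le> j \<longrightarrow> j \<le> Suc n \<longrightarrow> (j, d) \<noteq> (1, False) \<longrightarrow> fc n j d w' = fc n j d (dg n 1 a))"
    by (rule replace_face) (use a h in auto)
  then show ?thesis
    unfolding homot_def using a fc_dg_sph[OF a, of 1] by (elim bexE, intro bexI) auto
qed

lemma homot_trans:
  assumes "sph n b" "homot 1 n a b" "homot 1 n b c"
  shows "homot 1 n a c"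
proof -
  obtain t where t: "t \<in> cells X (Suc n)" "fc n 1 False t = a" "fc n 1 True t = b"
    "\<And>i e. 1 \<le> i \<Longrightarrow> i \<le> Suc n \<Longrightarrow> i \<noteq> 1 \<Longrightarrow> fc n i e t = pt n"
    using assms by (auto simp: homot_def)
  have "\<exists>w' \<in> cells X (Suc n). fc n 1 True w' = c \<and>
    (\<forall>j d. 1 \<le> j \<longrightarrow> j \<le> Suc n \<longrightarrow> (j, d) \<noteq> (1, True) \<longrightarrow> fc n j d w' = fc n j d t)"
    by (rule replace_face) (use assms t in auto)
  then show ?thesis
    unfolding homot_def using t by (elim bexE, intro bexI) auto
qed

text \<open>A homotopy in direction \<open>p\<close> shares all facets except
  \<open>(p, True)\<close> with the degenerate cube \<open>dg n p a\<close>, so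
  \<open>homot_unique\<close> compares the remaining facets in direction 1. Conversely that facet of
  \<open>dg n p a\<close> can be replaced.\<close>

lemma homot_direction:
  assumes "sph n a" "1 \<le> p" "p \<le> Suc n"
  shows "homot p n a b \<longleftrightarrow> homot 1 n a b"
proof
  assume "homot p n a b"
  then obtain t where t: "t \<in> cells X (Suc n)" "fc n p False t = a" "fc n p True t = b"
    "\<And>i e. 1 \<le> i \<Longrightarrow> i \<le> Suc n \<Longrightarrow> i \<noteq> p \<Longrightarrow> fc n i e t = pt n"
    by (auto simp: homot_def)
  have "fc n j d (dg n p a) = fc n j d t" if "1 \<le> j" "j \<le> Suc n" "(j, d) \<noteq> (p, True)" for j d
    using that t assms fc_dg_sph[of n a p j d] by (cases "j = p") auto
  then have "homot 1 n (fc n p True (dg n p a)) (fc n p True t)"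
    by (intro homot_unique) (use assms t in auto)
  then show "homot 1 n a b" using assms t by simp
next
  assume h: "homot 1 n a b"
  have "\<exists>w' \<in> cells X (Suc n). fc n p True w' = b \<and>
    (\<forall>j d. 1 \<le> j \<longrightarrow> j \<le> Suc n \<longrightarrow> (j, d) \<noteq> (p, True) \<longrightarrow> fc n j d w' = fc n j d (dg n p a))"
    by (rule replace_face) (use assms h in auto)
  then show "homot p n a b"
    unfolding homot_def using assms fc_dg_sph[of n a p] by (elim bexE, intro bexI) auto
qed

definition filled :: "nat \<Rightarrow> (nat \<times> bool \<Rightarrow> 'a) \<Rightarrow> bool" where
  "filled n f \<longleftrightarrow> (\<exists>w \<in> cells X (Suc n). \<forall>i e. 1 \<le> i \<longrightarrow> i \<le> Suc n \<longrightarrow> fc n i e w = f (i, e))"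

lemma filled_homot:
  assumes f: "filled n f"
    and fg: "\<And>i e. 1 \<le> i \<Longrightarrow> i \<le> Suc n \<Longrightarrow> sph n (f (i, e)) \<and> homot 1 n (f (i, e)) (g (i, e))"
  shows "filled n g"
proof -
  \<comment> \<open>\<open>S\<close> collects the facets already replaced; they are exchanged one at
    a time.\<close>
  have "finite S \<Longrightarrow> S \<subseteq> {1..Suc n} \<times> UNIV \<Longrightarrow> filled n (\<lambda>y. if y \<in> S then g y else f y)" for S
  proof (induction rule: finite_induct)
    case empty
    then show ?case using f by simp
  next
    case (insert s S)
    obtain i e where s: "s = (i, e)" by (cases s)
    then have i: "1 \<le> i" "i \<le> Suc n" using insert.prems by auto
    obtain w where w: "w \<in> cells X (Suc n)" "\<And>j d. 1 \<le> j \<Longrightarrow> j \<le> Suc n \<Longrightarrow>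
        fc n j d w = (if (j, d) \<in> S then g (j, d) else f (j, d))"
      using insert unfolding filled_def by auto
    have "\<exists>w' \<in> cells X (Suc n). fc n i e w' = g s \<and>
        (\<forall>j d. 1 \<le> j \<longrightarrow> j \<le> Suc n \<longrightarrow> (j, d) \<noteq> (i, e) \<longrightarrow> fc n j d w' = fc n j d w)"
      by (rule replace_face) (use w i s fg insert.hyps in auto)
    then obtain w' where w': "w' \<in> cells X (Suc n)" "fc n i e w' = g s"
      "\<And>j d. 1 \<le> j \<Longrightarrow> j \<le> Suc n \<Longrightarrow> (j, d) \<noteq> (i, e) \<Longrightarrow> fc n j d w' = fc n j d w"
      by blast
    have "fc n j d w' = (if (j, d) \<in> insert s S then g (j, d) else f (j, d))"
      if "1 \<le> j" "j \<le> Suc n" for j d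
      using w(2)[OF that, of d] w'(2) w'(3)[OF that, of d] s by (cases "(j, d) = s") auto
    then show ?case
      unfolding filled_def using w'(1) by blast
  qed
  from this[of "{1..Suc n} \<times> UNIV"] show ?thesis
    unfolding filled_def by auto
qed

text \<open>Each face of the remaining facet is also a face of one of the other facets, where it is
  constant.\<close>

lemma sph_last_face:
  assumes w: "w \<in> cells X (Suc n)" and i: "1 \<le> i" "i \<le> Suc n"
    and sph: "\<And>j d. 1 \<le> j \<Longrightarrow> j \<le> Suc n \<Longrightarrow> (j, d) \<noteq> (i, e) \<Longrightarrow> sph n (fc n j d w)"
  shows "sph n (fc n i e w)"
proof -
  have "fc (n - 1) j c (fc n i e w) = pt (n - 1)" if j: "1 \<le> j" "j \<le> n" for j c
  proof -
    obtain m where m: "n = Suc m" using j by (cases n) auto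
    show ?thesis
    proof (cases "j < i")
      case True
      then obtain i' where "i = Suc i'" by (cases i) auto
      then show ?thesis
        using fc_fc[of w m j i' c e] w m True j i sph[of j c] by simp
    next
      case False
      then show ?thesis
        using fc_fc[of w m i j e c] w m j i sph[of "Suc j" c] by simp
    qed
  qed
  then show ?thesis using w i by (simp add: sph_def del: sph_cell sph_fc)
qed

section \<open>Homotopy classes and the boundaries they fill\<close>

definition cls :: "nat \<Rightarrow> 'a \<Rightarrow> 'a set" where
  "cls n a = {b. sph n b \<and> homot 1 n a b}"

lemma cls_eq_iff:
  assumes "sph n a" "sph n b"
  shows "cls n a = cls n b \<longleftrightarrow> homot 1 n a b"
proof
  assume "cls n a = cls n b"
  moreover have "b \<in> cls n b" using assms homot_refl by (simp add: cls_def)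
  ultimately show "homot 1 n a b" by (auto simp: cls_def)
next
  assume h: "homot 1 n a b"
  then show "cls n a = cls n b"
    using homot_trans homot_sym assms unfolding cls_def by blast
qed

definition pi_set :: "nat \<Rightarrow> 'a set set" where
  "pi_set n = cls n ` {a. sph n a}"

definition bounds :: "nat \<Rightarrow> (nat \<times> bool \<Rightarrow> 'a set) \<Rightarrow> bool" where
  "bounds n F \<longleftrightarrow> (\<exists>f. (\<forall>y. sph n (f y)) \<and> filled n f \<and>
     (\<forall>i e. 1 \<le> i \<longrightarrow> i \<le> Suc n \<longrightarrow> F (i, e) = cls n (f (i, e))))"

text \<open>Facets may be replaced by homotopic ones, so a filling by some representatives gives a
  filling by any others.\<close>

lemma bounds_filled:
  assumes F: "bounds n F" and f: "\<And>y. sph n (f y)"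
    and eq: "\<And>i e. 1 \<le> i \<Longrightarrow> i \<le> Suc n \<Longrightarrow> F (i, e) = cls n (f (i, e))"
  shows "filled n f"
proof -
  obtain g where g: "\<And>y. sph n (g y)" "filled n g"
    "\<And>i e. 1 \<le> i \<Longrightarrow> i \<le> Suc n \<Longrightarrow> F (i, e) = cls n (g (i, e))"
    using F unfolding bounds_def by blast
  show ?thesis
  proof (rule filled_homot[OF g(2)])
    fix i e assume i: "1 \<le> i" "i \<le> Suc n"
    then have "cls n (g (i, e)) = cls n (f (i, e))" using g(3) eq by simp
    then show "sph n (g (i, e)) \<and> homot 1 n (g (i, e)) (f (i, e))"
      using cls_eq_iff[OF g(1) f] g(1) by simp
  qed
qed

lemma filled_bounds:
  assumes "filled n f" "\<And>y. sph n (f y)"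
    "\<And>i e. 1 \<le> i \<Longrightarrow> i \<le> Suc n \<Longrightarrow> F (i, e) = cls n (f (i, e))"
  shows "bounds n F"
  using assms by (auto simp: bounds_def)

lemma pi_set_reps:
  assumes "range F \<subseteq> pi_set n"
  obtains f where "\<And>y. sph n (f y)" "\<And>y. F y = cls n (f y)"
proof -
  have "\<forall>y. \<exists>a. sph n a \<and> F y = cls n a"
    using assms by (auto simp: pi_set_def)
  then show ?thesis using that by metis
qed

text \<open>Existence is the filling of an (n + 1)-dimensional box, uniqueness is
  \<open>homot_unique\<close>, and the two special boundaries come from degeneracies and
  connections. For the last axiom, fillers of the known facets are assembled into an (n +
  2)-dimensional box.\<close>

lemma facet_relation_bounds:
  assumes n: "2 \<le> n"
  shows "facet_relation (Suc n) (pi_set n) (cls n (pt n)) (bounds n)"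
proof
  show "3 \<le> Suc n" using n by simp
  show "cls n (pt n) \<in> pi_set n" by (auto simp: pi_set_def)
  show "bounds n g" if "bounds n f" "\<And>i e. 1 \<le> i \<Longrightarrow> i \<le> Suc n \<Longrightarrow> f (i, e) = g (i, e)" for f g
    using that by (auto simp: bounds_def)
next
  fix F :: "nat \<times> bool \<Rightarrow> 'a set" and i e
  assume F: "range F \<subseteq> pi_set n" and i: "1 \<le> i" "i \<le> Suc n"
  obtain f where f: "\<And>y. sph n (f y)" "\<And>y. F y = cls n (f y)"
    using pi_set_reps[OF F] by blast
  have "\<exists>w \<in> cells X (Suc n). \<forall>j d. 1 \<le> j \<longrightarrow> j \<le> Suc n \<longrightarrow> (j, d) \<noteq> (i, e) \<longrightarrow> fc n j d w = f (j, d)"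
    by (rule kan_fill) (use i f in auto)
  then obtain w where w: "w \<in> cells X (Suc n)"
    "\<And>j d. 1 \<le> j \<Longrightarrow> j \<le> Suc n \<Longrightarrow> (j, d) \<noteq> (i, e) \<Longrightarrow> fc n j d w = f (j, d)" by blast
  have s: "sph n (fc n i e w)"
    by (rule sph_last_face) (use w i f in auto)
  have "bounds n (F((i, e) := cls n (fc n i e w)))"
  proof (rule filled_bounds)
    show "filled n (f((i, e) := fc n i e w))"
      unfolding filled_def using w by (intro bexI[of _ w]) auto
  qed (use f s in auto)
  then show "\<exists>p \<in> pi_set n. bounds n (F((i, e) := p))"
    using s by (intro bexI[of _ "cls n (fc n i e w)"]) (auto simp: pi_set_def)
next
  fix F G :: "nat \<times> bool \<Rightarrow> 'a set" and i e
  assume F: "bounds n F" "range F \<subseteq> pi_set n" and G: "bounds n G" "range G \<subseteq> pi_set n"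
    and i: "1 \<le> i" "i \<le> Suc n"
    and eq: "\<And>j d. 1 \<le> j \<Longrightarrow> j \<le> Suc n \<Longrightarrow> (j, d) \<noteq> (i, e) \<Longrightarrow> F (j, d) = G (j, d)"
  obtain f where f: "\<And>y. sph n (f y)" "\<And>y. F y = cls n (f y)"
    using pi_set_reps[OF F(2)] by blast
  obtain g where g: "\<And>y. sph n (g y)" "\<And>y. G y = cls n (g y)"
    using pi_set_reps[OF G(2)] by blast
  let ?g = "f((i, e) := g (i, e))"
  obtain w where w: "w \<in> cells X (Suc n)" "\<And>j d. 1 \<le> j \<Longrightarrow> j \<le> Suc n \<Longrightarrow> fc n j d w = f (j, d)"
    using bounds_filled[OF F(1), of f] f by (auto simp: filled_def)
  have "filled n ?g"
    by (rule bounds_filled[OF G(1)]) (use f g eq in auto)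
  then obtain w' where w': "w' \<in> cells X (Suc n)" "\<And>j d. 1 \<le> j \<Longrightarrow> j \<le> Suc n \<Longrightarrow> fc n j d w' = ?g (j, d)"
    unfolding filled_def by blast
  have "homot 1 n (fc n i e w) (fc n i e w')"
    by (rule homot_unique) (use w w' i f in auto)
  then show "F (i, e) = G (i, e)"
    using w w' i f g by (simp add: cls_eq_iff)
next
  fix p i assume p: "p \<in> pi_set n" and i: "1 \<le> i" "i \<le> Suc n"
  obtain a where a: "sph n a" "p = cls n a" using p by (auto simp: pi_set_def)
  show "bounds n ((\<lambda>_. cls n (pt n))((i, False) := p, (i, True) := p))"
  proof (rule filled_bounds)
    show "filled n ((\<lambda>_. pt n)((i, False) := a, (i, True) := a))"
      unfolding filled_def using i a fc_dg_sph[OF a(1)] by (intro bexI[of _ "dg n i a"]) auto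
  qed (use a in auto)
next
  fix p i assume p: "p \<in> pi_set n" and i: "1 \<le> i" "i < Suc n"
  obtain a where a: "sph n a" "p = cls n a" using p by (auto simp: pi_set_def)
  show "bounds n ((\<lambda>_. cls n (pt n))((i, False) := p, (Suc i, False) := p))"
  proof (rule filled_bounds)
    show "filled n ((\<lambda>_. pt n)((i, False) := a, (Suc i, False) := a))"
      unfolding filled_def using i a fc_cn_sph[OF a(1)] by (intro bexI[of _ "cn n i a"]) auto
  qed (use a in auto)
next
  fix G :: "nat \<times> bool \<Rightarrow> nat \<times> bool \<Rightarrow> 'a set" and I E
  assume P: "\<And>y y'. G y y' \<in> pi_set n" and sym: "\<And>y y'. fst y \<noteq> fst y' \<Longrightarrow> G y y' = G y' y"
    and I: "1 \<le> I" "I \<le> Suc (Suc n)"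
    and facets: "\<And>J d. 1 \<le> J \<Longrightarrow> J \<le> Suc (Suc n) \<Longrightarrow> (J, d) \<noteq> (I, E) \<Longrightarrow>
      bounds n (\<lambda>(i, e). G (J, d) (skip J i, e))"
  \<comment> \<open>A representative must depend on the class alone: then symmetry of
    \<open>G\<close> puts literally the same cube on both facets meeting in a codimension-two face,
    and the fillers match.\<close>
  define \<rho> where "\<rho> p = (SOME a. sph n a \<and> p = cls n a)" for p
  have \<rho>: "sph n (\<rho> (G y y')) \<and> G y y' = cls n (\<rho> (G y y'))" for y y'
    unfolding \<rho>_def by (rule someI_ex) (use P[of y y'] in \<open>auto simp: pi_set_def\<close>)
  define c where "c y y' = \<rho> (G y y')" for y y'
  have c: "sph n (c y y')" "G y y' = cls n (c y y')" for y y'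
    using \<rho>[of y y'] by (auto simp: c_def)
  have c_sym: "c y y' = c y' y" if "fst y \<noteq> fst y'" for y y'
    using sym[OF that] by (simp add: c_def)
  have "\<exists>w \<in> cells X (Suc n). \<forall>i e. 1 \<le> i \<longrightarrow> i \<le> Suc n \<longrightarrow> fc n i e w = c (J, d) (skip J i, e)"
    if "1 \<le> J" "J \<le> Suc (Suc n)" "(J, d) \<noteq> (I, E)" for J d
  proof -
    have "filled n (\<lambda>(i, e). c (J, d) (skip J i, e))"
      by (rule bounds_filled[OF facets[OF that]]) (auto simp: c split: prod.splits)
    then show ?thesis by (simp add: filled_def)
  qed
  then obtain w where w: "\<And>J d. 1 \<le> J \<Longrightarrow> J \<le> Suc (Suc n) \<Longrightarrow> (J, d) \<noteq> (I, E) \<Longrightarrow> w J d \<in> cells X (Suc n)"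
    and fc_w: "\<And>J d i e. 1 \<le> J \<Longrightarrow> J \<le> Suc (Suc n) \<Longrightarrow> (J, d) \<noteq> (I, E) \<Longrightarrow> 1 \<le> i \<Longrightarrow> i \<le> Suc n \<Longrightarrow>
      fc n i e (w J d) = c (J, d) (skip J i, e)"
    by metis
  have "\<exists>v \<in> cells X (Suc (Suc n)). \<forall>j d. 1 \<le> j \<longrightarrow> j \<le> Suc (Suc n) \<longrightarrow> (j, d) \<noteq> (I, E) \<longrightarrow>
      fc (Suc n) j d v = w j d"
  proof (rule kan_fill)
    fix m j e k d
    assume "Suc n = Suc m" "1 \<le> j" "j \<le> k" "k \<le> Suc n" "(j, e) \<noteq> (I, E)" "(Suc k, d) \<noteq> (I, E)"
    then show "fc m j e (w (Suc k) d) = fc m k d (w j e)"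
      using fc_w[of "Suc k" d j e] fc_w[of j e k d] c_sym[of "(j, e)" "(Suc k, d)"]
      by (simp add: skip_def)
  qed (use w I in auto)
  then obtain v where v: "v \<in> cells X (Suc (Suc n))" "\<And>j d. 1 \<le> j \<Longrightarrow> j \<le> Suc (Suc n) \<Longrightarrow>
      (j, d) \<noteq> (I, E) \<Longrightarrow> fc (Suc n) j d v = w j d" by blast
  show "bounds n (\<lambda>(i, e). G (I, E) (skip I i, e))"
  proof (rule filled_bounds)
    show "filled n (\<lambda>(i, e). c (I, E) (skip I i, e))"
      unfolding filled_def
    proof (intro bexI[of _ "fc (Suc n) I E v"] allI impI)
      fix i e assume i: "1 \<le> i" "i \<le> Suc n"
      show "fc n i e (fc (Suc n) I E v) = (case (i, e) of (i, e) \<Rightarrow> c (I, E) (skip I i, e))"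
      proof (cases "i < I")
        case True
        then obtain k where "I = Suc k" by (cases I) auto
        then show ?thesis
          using True i I fc_fc[of v n i k e E] v fc_w[of i e k E] c_sym[of "(I, E)" "(i, e)"]
          by (simp add: skip_def)
      next
        case False
        then show ?thesis
          using i I fc_fc[of v n I i E e] v fc_w[of "Suc i" e I E] c_sym[of "(I, E)" "(Suc i, e)"]
          by (simp add: skip_def)
      qed
    qed (use v I in auto)
  qed (auto simp: c split: prod.splits)
qed

end

section \<open>Iterated loop spaces\<close>

text \<open>The product of the identity of the m-cube with \<open>\<phi>\<close>, which is what m
  applications of \<open>id_times\<close> produce.\<close>

definition act_tail :: "nat \<Rightarrow> nat \<Rightarrow> (bool list \<Rightarrow> bool list) \<Rightarrow> bool list \<Rightarrow> bool list" where
  "act_tail m k \<phi> = (\<lambda>xs \<in> cube (m + k). take m xs @ \<phi> (drop m xs))"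

lemma act_tail_id_times: "act_tail m (Suc k) (id_times k \<phi>) = act_tail (Suc m) k \<phi>"
proof
  fix xs :: "bool list"
  show "act_tail m (Suc k) (id_times k \<phi>) xs = act_tail (Suc m) k \<phi> xs"
  proof (cases "length xs = Suc (m + k)")
    case True
    then have "drop m xs = xs ! m # drop (Suc m) xs" by (simp add: Cons_nth_drop_Suc)
    then show ?thesis
      using True by (simp add: act_tail_def id_times_def take_Suc_conv_app_nth)
  qed (simp add: act_tail_def)
qed

lemma act_tail_0:
  assumes "\<And>xs. length xs \<noteq> k \<Longrightarrow> \<phi> xs = undefined"
  shows "act_tail 0 k \<phi> = \<phi>"
  using assms by (auto simp: act_tail_def restrict_def)

lemma act_tail_face:
  assumes "1 \<le> i"
  shows "act_tail m k (face (Suc k) i e) = face (Suc (m + k)) (m + i) e"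
proof
  note assms
  then obtain i' where i: "i = Suc i'" by (cases i) auto
  fix xs :: "bool list"
  show "act_tail m k (face (Suc k) i e) xs = face (Suc (m + k)) (m + i) e xs"
    using take_add[of m i' xs] by (simp add: i act_tail_def face_def add.commute)
qed

lemma box_act_tail_terminal: "box_map (m + k) m (act_tail m k (terminal k))"
proof (induction k)
  case 0
  have "act_tail m 0 (terminal 0) = (\<lambda>xs \<in> cube m. xs)"
    by (auto simp: act_tail_def terminal_def restrict_def)
  then show ?case using box_id[of m] by (simp only: add_0_right)
next
  case (Suc k)
  have "compose (cube (Suc (m + k))) (act_tail m k (terminal k)) (degen (Suc (m + k)) (Suc m)) =
      act_tail m (Suc k) (terminal (Suc k))"
    by (auto simp: compose_def restrict_def act_tail_def terminal_def degen_def)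
  then show ?case
    using box_comp[OF box_degen'[of "Suc m" "m + k"] Suc] by simp
qed

text \<open>Each loop space adds a coordinate in front, so the m loop coordinates come first and
  operators act on the tail. Direction i of the iterated loop space is thus direction m + i of
  \<open>X\<close>.\<close>

lemma act_iter_loop:
  assumes "\<And>xs. length xs \<noteq> k \<Longrightarrow> \<phi> xs = undefined"
  shows "act (iter_loop m X x) k l \<phi> = act X (m + k) (m + l) (act_tail m k \<phi>)"
  using assms
proof (induction m arbitrary: k l \<phi>)
  case 0
  then show ?case by (simp add: act_tail_0)
next
  case (Suc m)
  have "act (iter_loop (Suc m) X x) k l \<phi> = act (iter_loop m X x) (Suc k) (Suc l) (id_times k \<phi>)"
    by (simp add: loop_space_def)
  also have "\<dots> = act X (m + Suc k) (m + Suc l) (act_tail m (Suc k) (id_times k \<phi>))"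
    by (rule Suc.IH) (simp add: id_times_def)
  finally show ?case by (simp add: act_tail_id_times)
qed

context pointed_cubical
begin

lemma face_op_iter_loop:
  assumes "1 \<le> i"
  shows "face_op (iter_loop m X x) (Suc k) i e = fc (m + k) (m + i) e"
  unfolding face_op_def fc_def diff_Suc_1
  by (subst act_iter_loop) (use assms in \<open>auto simp: act_tail_face, simp add: face_def\<close>)

lemma const_cube_iter_loop: "const_cube (iter_loop m X x) k (const_cube X m x) = pt (m + k)"
  unfolding const_cube_def[of "iter_loop m X x"]
  by (subst act_iter_loop)
     (use act_pt[OF box_act_tail_terminal[of m k]] in \<open>auto simp: pt_def terminal_def\<close>)

text \<open>The loop condition of stage i concerns the first direction at that stage, which is
  direction i of \<open>X\<close>. For k = 0 the conditions exhaust all directions and give exactly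
  the spherical cubes.\<close>

lemma cells_iter_loop:
  "cells (iter_loop m X x) k =
    {z \<in> cells X (m + k). \<forall>i e. 1 \<le> i \<longrightarrow> i \<le> m \<longrightarrow> fc (m + k - 1) i e z = pt (m + k - 1)}"
proof (induction m arbitrary: k)
  case (Suc m)
  have "cells (iter_loop (Suc m) X x) k = {z \<in> cells (iter_loop m X x) (Suc k).
      \<forall>e. fc (m + k) (Suc m) e z = pt (m + k)}"
  proof -
    have fo: "face_op (iter_loop m X x) (Suc k) 1 e z = fc (m + k) (Suc m) e z" for e z
      using face_op_iter_loop[of 1 m k e] by simp
    have "cells (iter_loop (Suc m) X x) k = {z \<in> cells (iter_loop m X x) (Suc k).
        face_op (iter_loop m X x) (Suc k) 1 False z = pt (m + k) \<and>
        face_op (iter_loop m X x) (Suc k) 1 True z = pt (m + k)}"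
      unfolding iter_loop.simps loop_space_def const_cube_iter_loop by simp
    also have "\<dots> = {z \<in> cells (iter_loop m X x) (Suc k). \<forall>e. fc (m + k) (Suc m) e z = pt (m + k)}"
      unfolding fo all_bool_eq by (simp add: conj_commute)
    finally show ?thesis .
  qed
  also have "\<dots> = {z \<in> cells X (Suc m + k). \<forall>i e. 1 \<le> i \<longrightarrow> i \<le> Suc m \<longrightarrow>
      fc (Suc m + k - 1) i e z = pt (Suc m + k - 1)}"
  proof -
    have "(\<forall>i e. 1 \<le> i \<longrightarrow> i \<le> Suc m \<longrightarrow> fc (m + k) i e z = pt (m + k)) \<longleftrightarrow>
        (\<forall>i e. 1 \<le> i \<longrightarrow> i \<le> m \<longrightarrow> fc (m + k) i e z = pt (m + k)) \<and>
        (\<forall>e. fc (m + k) (Suc m) e z = pt (m + k))" for z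
      by (metis le_Suc_eq le_add1 plus_1_eq_Suc)
    then show ?thesis unfolding Suc by simp
  qed
  finally show ?case .
qed simp

lemma cells_iter_loop_0: "cells (iter_loop m X x) 0 = {a. sph m a}"
  by (simp add: cells_iter_loop sph_def del: sph_cell sph_fc)

lemma iter_loop_edge:
  "(\<exists>e \<in> cells (iter_loop m X x) 1. u = face_op (iter_loop m X x) 1 1 False e \<and>
      v = face_op (iter_loop m X x) 1 1 True e) \<longleftrightarrow> homot (Suc m) m u v"
proof -
  have "e \<in> cells (iter_loop m X x) 1 \<longleftrightarrow> e \<in> cells X (Suc m) \<and>
      (\<forall>i d. 1 \<le> i \<longrightarrow> i \<le> Suc m \<longrightarrow> i \<noteq> Suc m \<longrightarrow> fc m i d e = pt m)" for e
    by (auto simp: cells_iter_loop le_Suc_eq)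
  then show ?thesis
    using face_op_iter_loop[of 1 m 0] by (auto simp: homot_def)
qed

lemma pi0_rel_iter_loop:
  "pi0_rel (iter_loop m X x) = {(a, b). sph m a \<and> sph m b \<and> equivclp (homot (Suc m) m) a b}"
  unfolding pi0_rel_def cells_iter_loop_0 iter_loop_edge by simp

text \<open>The first \<open>m\<close> faces of an end are faces of constant sides by the cubical
  identities, so sphericity of both ends is automatic.\<close>

lemma homot_last_sph:
  assumes "homot (Suc m) m a b"
  shows "sph m a" "sph m b"
proof -
  obtain t where t: "t \<in> cells X (Suc m)" "fc m (Suc m) False t = a" "fc m (Suc m) True t = b"
    "\<And>i e. 1 \<le> i \<Longrightarrow> i \<le> m \<Longrightarrow> fc m i e t = pt m"
    using assms by (auto simp: homot_def)
  have "fc (m - 1) i e (fc m (Suc m) d t) = pt (m - 1)" if i: "1 \<le> i" "i \<le> m" for i e d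
  proof -
    obtain l where l: "m = Suc l" using i by (cases m) auto
    then show ?thesis using fc_fc[of t l i m e d] t i by simp
  qed
  then have "sph m (fc m (Suc m) d t)" for d
    using t(1) by (simp add: sph_def del: sph_cell sph_fc)
  then show "sph m a" "sph m b" using t by auto
qed

end

context pointed_kan
begin

text \<open>In a Kan complex the relation given by single homotopies is already an equivalence on
  spherical cubes, so a zigzag collapses to one homotopy.\<close>

lemma equivclp_homot:
  assumes "sph m a" "equivclp (homot (Suc m) m) a b"
  shows "sph m b \<and> homot 1 m a b"
  using assms(2)
proof (induction rule: equivclp_induct)
  case base
  then show ?case using homot_refl[OF assms(1), of 1] assms(1) by simp
next
  case (step b c)
  have s: "sph m b" "sph m c" using step(2) homot_last_sph by blast+
  have "homot 1 m b c"
    using step(2) homot_direction[of m b "Suc m" c] homot_direction[of m c "Suc m" b] homot_sym s by auto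
  then show ?case using step s homot_trans by blast
qed

lemma pi0_class_iter_loop:
  assumes "sph m a"
  shows "pi0_class (iter_loop m X x) a = cls m a"
proof -
  have "equivclp (homot (Suc m) m) a b" if "homot 1 m a b" for b
    using that homot_direction[of m a "Suc m" b] assms by (auto intro: r_into_equivclp)
  then show ?thesis
    using assms equivclp_homot[OF assms] by (auto simp: pi0_class_def pi0_rel_iter_loop cls_def)
qed

lemma homotopy_set_eq: "homotopy_set m X x = pi_set m"
proof -
  have "homotopy_set m X x = (\<lambda>a. pi0_class (iter_loop m X x) a) ` {a. sph m a}"
    by (auto simp: homotopy_set_def pi0_def quotient_def pi0_class_def cells_iter_loop_0)
  also have "\<dots> = pi_set m"
    unfolding pi_set_def by (rule image_cong) (auto simp: pi0_class_iter_loop)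
  finally show ?thesis .
qed

lemma concat_square_iter_loop:
  "concat_square (iter_loop m X x) (const_cube X m x) u v s \<longleftrightarrow> s \<in> cells X (Suc (Suc m)) \<and>
     (\<forall>i e. 1 \<le> i \<longrightarrow> i \<le> m \<longrightarrow> fc (Suc m) i e s = pt (Suc m)) \<and>
     fc (Suc m) (Suc m) False s = u \<and> fc (Suc m) (Suc m) True s = pt (Suc m) \<and>
     fc (Suc m) (Suc (Suc m)) True s = v"
  using face_op_iter_loop[of 1 m 1] face_op_iter_loop[of 2 m 1]
  by (auto simp: concat_square_def cells_iter_loop const_cube_iter_loop numeral_2_eq_2)

section \<open>The homotopy groups as facet groups\<close>

definition pi_group :: "nat \<Rightarrow> 'a set monoid" where
  "pi_group n = facet_relation.facet_group (pi_set n) (cls n (pt n)) (bounds n)"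

lemma pi_group_simps:
  assumes "2 \<le> n"
  shows "carrier (pi_group n) = pi_set n" "\<one>\<^bsub>pi_group n\<^esub> = cls n (pt n)" "comm_group (pi_group n)"
proof -
  interpret facet_relation "Suc n" "pi_set n" "cls n (pt n)" "bounds n"
    by (rule facet_relation_bounds[OF assms])
  show "carrier (pi_group n) = pi_set n" "\<one>\<^bsub>pi_group n\<^esub> = cls n (pt n)" "comm_group (pi_group n)"
    using facet_group by (simp_all add: pi_group_def)
qed

text \<open>The cubical homotopy addition theorem, obtained from \<open>boundary_sum_eq_zero\<close>
  for the relation \<open>bounds n\<close>. Facets outside the range are set to the constant cube so
  that the family is total.\<close>

lemma homotopy_addition:
  assumes n: "2 \<le> n" and w: "w \<in> cells X (Suc n)"
    and sph: "\<And>i e. 1 \<le> i \<Longrightarrow> i \<le> Suc n \<Longrightarrow> sph n (fc n i e w)"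
  shows "finprod (pi_group n) (\<lambda>(i, e). cls n (fc n i e w) [^]\<^bsub>pi_group n\<^esub> ((- 1) ^ (i + of_bool e) :: int))
    ({1..Suc n} \<times> UNIV) = \<one>\<^bsub>pi_group n\<^esub>"
proof -
  interpret facet_relation "Suc n" "pi_set n" "cls n (pt n)" "bounds n"
    by (rule facet_relation_bounds[OF n])
  interpret comm_group "pi_group n" by (rule pi_group_simps(3)[OF n])
  let ?f = "\<lambda>(i, e). if 1 \<le> i \<and> i \<le> Suc n then fc n i e w else pt n"
  have f: "sph n (?f y)" for y using sph by (cases y) auto
  have F: "range (\<lambda>y. cls n (?f y)) \<subseteq> pi_set n" unfolding pi_set_def using f by blast
  have "filled n ?f" unfolding filled_def using w by (intro bexI[of _ w]) auto
  then have "bounds n (\<lambda>y. cls n (?f y))" by (rule filled_bounds) (use f in auto)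
  then have "boundary_sum (\<lambda>y. cls n (?f y)) = \<one>\<^bsub>pi_group n\<^esub>"
    using boundary_sum_eq_zero F pi_group_simps[OF n] by simp
  moreover have "finprod (pi_group n) (\<lambda>(i, e). cls n (fc n i e w) [^]\<^bsub>pi_group n\<^esub> ((- 1) ^ (i + of_bool e) :: int))
    ({1..Suc n} \<times> UNIV) = boundary_sum (\<lambda>y. cls n (?f y))"
    unfolding boundary_sum_def pi_group_def[symmetric]
  proof (rule finprod_cong')
    show "signed (\<lambda>y. cls n (?f y)) \<in> {1..Suc n} \<times> UNIV \<rightarrow> carrier (pi_group n)"
      using signed_closed[OF F] by (simp add: pi_group_def)
  qed (auto simp: signed_def pi_group_def[symmetric])
  ultimately show ?thesis by simp
qed

lemma homotopy_group_carrier: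
  assumes "1 \<le> n"
  shows "carrier (homotopy_group n X x) = pi_set n"
proof -
  obtain m where "n = Suc m" using assms by (cases n) auto
  then show ?thesis
    using homotopy_set_eq[of n] by (simp add: homotopy_group_def pi1_group_def homotopy_set_def)
qed

text \<open>A concatenation square in the (n - 1)-fold loop space is an (n + 1)-cube whose only
  nontrivial facets are in the last two directions. It is an instance of \<open>T n\<close>, and the
  product does not depend on the pair of directions.\<close>

lemma concat_cls:
  assumes n: "2 \<le> n" and u: "sph n u" and v: "sph n v" and s: "s \<in> cells X (Suc n)"
    and lower: "\<And>i e. 1 \<le> i \<Longrightarrow> i < n \<Longrightarrow> fc n i e s = pt n"
    and sides: "fc n n False s = u" "fc n n True s = pt n" "fc n (Suc n) True s = v"
  shows "sph n (fc n (Suc n) False s)"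
    and "cls n (fc n (Suc n) False s) = cls n u \<otimes>\<^bsub>pi_group n\<^esub> cls n v"
proof -
  interpret facet_relation "Suc n" "pi_set n" "cls n (pt n)" "bounds n"
    by (rule facet_relation_bounds[OF n])
  have sph: "sph n (fc n j d s)" if jd: "1 \<le> j" "j \<le> Suc n" "(j, d) \<noteq> (Suc n, False)" for j d
  proof -
    have "j < n \<or> j = n \<or> j = Suc n" using jd(2) by linarith
    then consider "j < n" | "j = n" "d" | "j = n" "\<not> d" | "j = Suc n" "d" using jd(3) by blast
    then show ?thesis using lower[of j d] sides u v jd by cases auto
  qed
  show r: "sph n (fc n (Suc n) False s)"
    by (rule sph_last_face[OF s]) (use sph in auto)
  let ?f = "(\<lambda>_. pt n)((n, False) := u, (Suc n, True) := v, (Suc n, False) := fc n (Suc n) False s)"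
  have "filled n ?f"
    unfolding filled_def
  proof (intro bexI[OF _ s] allI impI)
    fix i e assume "1 \<le> i" "i \<le> Suc n"
    then consider "i < n" | "i = n" | "i = Suc n" by linarith
    then show "fc n i e s = ?f (i, e)"
      using lower[of i e] sides \<open>1 \<le> i\<close> by cases (cases e; auto)+
  qed
  then have "T n (cls n u) (cls n v) (cls n (fc n (Suc n) False s))"
    unfolding T_def by (rule filled_bounds) (use u v r in auto)
  then show "cls n (fc n (Suc n) False s) = cls n u \<otimes>\<^bsub>pi_group n\<^esub> cls n v"
    using facet_group_T[of n "cls n u" "cls n v" "cls n (fc n (Suc n) False s)"] n u v r
    by (simp add: pi_group_def pi_set_def)
qed

lemma concat_exists:
  assumes n: "1 \<le> n" and u: "sph n u" and v: "sph n v"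
  shows "\<exists>s \<in> cells X (Suc n). (\<forall>i e. 1 \<le> i \<longrightarrow> i < n \<longrightarrow> fc n i e s = pt n) \<and>
    fc n n False s = u \<and> fc n n True s = pt n \<and> fc n (Suc n) True s = v"
proof -
  let ?f = "(\<lambda>_. pt n)((n, False) := u, (Suc n, True) := v)"
  have f: "sph n (?f y)" for y using u v by auto
  have "\<exists>w \<in> cells X (Suc n). \<forall>j d. 1 \<le> j \<longrightarrow> j \<le> Suc n \<longrightarrow> (j, d) \<noteq> (Suc n, False) \<longrightarrow> fc n j d w = ?f (j, d)"
    by (rule kan_fill) (use f in \<open>auto simp del: fun_upd_apply\<close>)
  then obtain w where "w \<in> cells X (Suc n)" and
    w: "\<And>j d. 1 \<le> j \<Longrightarrow> j \<le> Suc n \<Longrightarrow> (j, d) \<noteq> (Suc n, False) \<Longrightarrow> fc n j d w = ?f (j, d)"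
    by blast
  then show ?thesis using n by (intro bexI[of _ w]) auto
qed

text \<open>This resolves the definite description: a concatenation exists by box filling, and by
  \<open>concat_cls\<close> all concatenations of representatives have the same class.\<close>

lemma homotopy_group_mult:
  assumes n: "2 \<le> n" and P: "P \<in> pi_set n" and Q: "Q \<in> pi_set n"
  shows "P \<otimes>\<^bsub>homotopy_group n X x\<^esub> Q = P \<otimes>\<^bsub>pi_group n\<^esub> Q"
proof -
  obtain m where m: "n = Suc m" using n by (cases n) auto
  have eq: "P \<otimes>\<^bsub>homotopy_group n X x\<^esub> Q = (THE R. \<exists>u \<in> P. \<exists>v \<in> Q. \<exists>s.
      concat_square (iter_loop m X x) (const_cube X m x) u v s \<and>
      R = pi0_class (iter_loop n X x) (face_op (iter_loop m X x) (Suc 1) 2 False s))"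
    by (simp add: homotopy_group_def pi1_group_def m numeral_2_eq_2)
  have cells: "sph n u \<and> cls n u = P" if "u \<in> P" "P \<in> pi_set n" for u P
    using that cls_eq_iff by (auto simp: pi_set_def cls_def)
  have fo: "face_op (iter_loop m X x) (Suc 1) 2 False s = fc n (Suc n) False s" for s
    using face_op_iter_loop[of 2 m 1] m by simp
  show ?thesis
    unfolding eq fo
  proof (rule the_equality)
    obtain u where u: "sph n u" "P = cls n u" using P by (auto simp: pi_set_def)
    obtain v where v: "sph n v" "Q = cls n v" using Q by (auto simp: pi_set_def)
    obtain s where s: "s \<in> cells X (Suc n)" "\<And>i e. 1 \<le> i \<Longrightarrow> i < n \<Longrightarrow> fc n i e s = pt n"
      "fc n n False s = u" "fc n n True s = pt n" "fc n (Suc n) True s = v"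
      using concat_exists[OF _ u(1) v(1)] n by auto
    have "concat_square (iter_loop m X x) (const_cube X m x) u v s"
      unfolding concat_square_iter_loop using s m by auto
    moreover have "P \<otimes>\<^bsub>pi_group n\<^esub> Q = pi0_class (iter_loop n X x) (fc n (Suc n) False s)"
      using concat_cls[OF n u(1) v(1) s] u v pi0_class_iter_loop by simp
    moreover have "u \<in> P" "v \<in> Q" using u v homot_refl by (auto simp: cls_def)
    ultimately show "\<exists>u\<in>P. \<exists>v\<in>Q. \<exists>s. concat_square (iter_loop m X x) (const_cube X m x) u v s \<and>
        P \<otimes>\<^bsub>pi_group n\<^esub> Q = pi0_class (iter_loop n X x) (fc n (Suc n) False s)"
      using m by auto
  next
    fix R assume "\<exists>u\<in>P. \<exists>v\<in>Q. \<exists>s. concat_square (iter_loop m X x) (const_cube X m x) u v s \<and>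
        R = pi0_class (iter_loop n X x) (fc n (Suc n) False s)"
    then obtain u v s where uv: "u \<in> P" "v \<in> Q"
      and s: "concat_square (iter_loop m X x) (const_cube X m x) u v s"
      and R: "R = pi0_class (iter_loop n X x) (fc n (Suc n) False s)"
      using m by auto
    have "sph n (fc n (Suc n) False s)" "cls n (fc n (Suc n) False s) = cls n u \<otimes>\<^bsub>pi_group n\<^esub> cls n v"
      using concat_cls[OF n, of u v s] cells[OF uv(1) P] cells[OF uv(2) Q] s m
      unfolding concat_square_iter_loop by auto
    then show "R = P \<otimes>\<^bsub>pi_group n\<^esub> Q"
      using R cells[OF uv(1) P] cells[OF uv(2) Q] pi0_class_iter_loop by simp
  qed
qed

lemma connected_homot:
  assumes "m_connected k X x" "m \<le> k" "sph m a"
  shows "homot 1 m a (pt m)"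
proof -
  have "is_singleton (pi_set m)"
    using assms homotopy_set_eq by (simp add: m_connected_def)
  then have "cls m a = cls m (pt m)"
    using assms sph_pt unfolding is_singleton_def pi_set_def by (metis imageI mem_Collect_eq singletonD)
  then show ?thesis using cls_eq_iff assms by simp
qed

end

section \<open>Contracting the lower skeleta\<close>

context cubical_set
begin

text \<open>One code for everything the Moore complex divides out: the flag selects a degeneracy or
  a negative connection, so both are treated in the same arguments.\<close>

fun deg :: "nat \<Rightarrow> bool \<times> nat \<Rightarrow> 'a \<Rightarrow> 'a" where
  "deg n (b, i) z = (if b then dg n i z else cn n i z)"

fun deg_ok :: "nat \<Rightarrow> bool \<times> nat \<Rightarrow> bool" where
  "deg_ok n (b, i) \<longleftrightarrow> 1 \<le> i \<and> i \<le> (if b then Suc n else n)"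

text \<open>The same operator on cylinders, whose time coordinate has been put in front.\<close>

fun shift :: "bool \<times> nat \<Rightarrow> bool \<times> nat" where
  "shift (b, i) = (b, Suc i)"

lemma deg_closed [simp]: "deg_ok n s \<Longrightarrow> z \<in> cells X n \<Longrightarrow> deg n s z \<in> cells X (Suc n)"
  by (cases s) auto

lemma deg_ok_shift [simp]: "deg_ok n s \<Longrightarrow> deg_ok (Suc n) (shift s)"
  by (cases s) (auto split: if_splits)

lemma fc_deg_shift_1:
  assumes "deg_ok n s" "y \<in> cells X (Suc n)"
  shows "fc (Suc n) 1 d (deg (Suc n) (shift s) y) = deg n s (fc n 1 d y)"
  using assms fc_dg_lt[of y n 1 "snd s" d] fc_cn_lt[of y n 1 "snd s" d]
  by (cases s) (auto split: if_splits)

text \<open>A face of a degenerate cube is the original cube or a degenerate presentation of one of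
  its faces. Stating the alternative simultaneously for cylinders is what allows the sides of a
  degenerate contraction to be computed. An upper face of a connection falls into the second case,
  with a degeneracy as \<open>s'\<close>.\<close>

lemma fc_deg_cases:
  assumes s: "deg_ok n s" and j: "1 \<le> j" "j \<le> Suc n"
  obtains (same) "\<And>z. z \<in> cells X n \<Longrightarrow> fc n j e (deg n s z) = z"
      "\<And>y. y \<in> cells X (Suc n) \<Longrightarrow> fc (Suc n) (Suc j) e (deg (Suc n) (shift s) y) = y"
  | (diff) m s' j' where "n = Suc m" "deg_ok m s'" "1 \<le> j'" "j' \<le> Suc m"
      "\<And>z. z \<in> cells X (Suc m) \<Longrightarrow> fc (Suc m) j e (deg (Suc m) s z) = deg m s' (fc m j' e z)"
      "\<And>y. y \<in> cells X (Suc (Suc m)) \<Longrightarrow> fc (Suc (Suc m)) (Suc j) e (deg (Suc (Suc m)) (shift s) y) =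
        deg (Suc m) (shift s') (fc (Suc m) (Suc j') e y)"
proof -
  obtain b i where bi: "s = (b, i)" by (cases s)
  show ?thesis
  proof (cases b)
    case True
    then have i: "1 \<le> i" "i \<le> Suc n" using s bi by auto
    consider "j = i" | i' where "i = Suc i'" "j \<le> i'" | j' where "j = Suc j'" "i \<le> j'"
      by (metis Suc_le_D Suc_le_mono not_less_eq_eq order_antisym_conv nle_le)
    then show ?thesis
    proof cases
      case 1
      show ?thesis by (rule same) (use bi True i 1 in auto)
    next
      case (2 i')
      then obtain m where m: "n = Suc m" using i j by (cases n) auto
      show ?thesis
      proof (rule diff[OF m])
        show "deg_ok m (True, i')" using 2 i j m by simp
      qed (use 2 i j m bi True in \<open>auto simp: fc_dg_lt\<close>)
    next
      case (3 j')
      then obtain m where m: "n = Suc m" using i j by (cases n) auto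
      show ?thesis
      proof (rule diff[OF m])
        show "deg_ok m (True, i)" using 3 i j m by simp
      qed (use 3 i j m bi True in \<open>auto simp: fc_dg_gt\<close>)
    qed
  next
    case False
    then have i: "1 \<le> i" "i \<le> n" using s bi by auto
    then obtain m where m: "n = Suc m" by (cases n) auto
    consider "j = i \<or> j = Suc i" "\<not> e" | "j = i \<or> j = Suc i" "e" | i' where "i = Suc i'" "j \<le> i'"
      | j' where "j = Suc j'" "i < j'"
    proof -
      assume a: "j = i \<or> j = Suc i \<Longrightarrow> \<not> e \<Longrightarrow> thesis" "j = i \<or> j = Suc i \<Longrightarrow> e \<Longrightarrow> thesis"
        "\<And>i'. i = Suc i' \<Longrightarrow> j \<le> i' \<Longrightarrow> thesis" "\<And>j'. j = Suc j' \<Longrightarrow> i < j' \<Longrightarrow> thesis"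
      have "j = i \<or> j = Suc i \<or> j \<le> i - 1 \<or> i < j - 1" by linarith
      then show thesis using a i j a(3)[of "i - 1"] a(4)[of "j - 1"] by fastforce
    qed
    then show ?thesis
    proof cases
      case 1
      show ?thesis by (rule same) (use bi False i 1 fc_cn_False in auto)
    next
      case 2
      show ?thesis
      proof (rule diff[OF m])
        show "deg_ok m (True, i)" using i m by simp
      qed (use 2 i j m bi False in \<open>auto simp: fc_cn_True\<close>)
    next
      case (3 i')
      show ?thesis
      proof (rule diff[OF m])
        show "deg_ok m (False, i')" using 3 i j m by simp
      qed (use 3 i j m bi False in \<open>auto simp: fc_cn_lt\<close>)
    next
      case (4 j')
      show ?thesis
      proof (rule diff[OF m])
        show "deg_ok m (False, i)" using 4 i j m by simp
      qed (use 4 i j m bi False in \<open>auto simp: fc_cn_gt\<close>)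
    qed
  qed
qed

text \<open>
  Two degenerate presentations of a cube either coincide or factor through a common smaller cube \<open>e\<close>.
  This makes the value forced on a degenerate cube by compatibility independent of the presentation.
\<close>

definition common :: "nat \<Rightarrow> bool \<times> nat \<Rightarrow> 'a \<Rightarrow> bool \<times> nat \<Rightarrow> 'a \<Rightarrow> bool" where
  "common n s a t b \<longleftrightarrow> (s = t \<and> a = b) \<or>
     (\<exists>m e s' t'. n = Suc m \<and> e \<in> cells X m \<and> deg_ok m s' \<and> deg_ok m t' \<and>
        a = deg m t' e \<and> b = deg m s' e \<and>
        (\<forall>y \<in> cells X (Suc m). deg (Suc n) (shift s) (deg (Suc m) (shift t') y) =
           deg (Suc n) (shift t) (deg (Suc m) (shift s') y)))"

lemma commonI:
  assumes "n = Suc m" "e \<in> cells X m" "deg_ok m s'" "deg_ok m t'" "a = deg m t' e" "b = deg m s' e"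
    and "\<And>y. y \<in> cells X (Suc m) \<Longrightarrow> deg (Suc n) (shift s) (deg (Suc m) (shift t') y) =
           deg (Suc n) (shift t) (deg (Suc m) (shift s') y)"
  shows "common n s a t b"
  unfolding common_def
  by (intro disjI2 exI[of _ m] exI[of _ e] exI[of _ s'] exI[of _ t'] conjI ballI assms)

lemma commonE:
  assumes "common n s a t b"
  obtains (eq) "s = t" "a = b"
  | (span) m e s' t' where "n = Suc m" "e \<in> cells X m" "deg_ok m s'" "deg_ok m t'"
      "a = deg m t' e" "b = deg m s' e"
      "\<And>y. y \<in> cells X (Suc m) \<Longrightarrow> deg (Suc n) (shift s) (deg (Suc m) (shift t') y) =
           deg (Suc n) (shift t) (deg (Suc m) (shift s') y)"
  using assms unfolding common_def
proof (elim disjE exE conjE)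
  fix m e s' t'
  assume *: "n = Suc m" "e \<in> cells X m" "deg_ok m s'" "deg_ok m t'" "a = deg m t' e" "b = deg m s' e"
    and eq: "\<forall>y \<in> cells X (Suc m). deg (Suc n) (shift s) (deg (Suc m) (shift t') y) =
           deg (Suc n) (shift t) (deg (Suc m) (shift s') y)"
  show thesis by (rule span[OF * bspec[OF eq]])
qed (rule eq)

lemma common_sym:
  assumes "common n s a t b"
  shows "common n t b s a"
  using assms
proof (cases rule: commonE)
  case (span m e s' t')
  then show ?thesis by (intro commonI[of n m e t' s']) auto
qed (simp add: common_def)

text \<open>Faces are retractions of degeneracies: applying them to the equation expresses
  \<open>a\<close> and \<open>b\<close> through each other, and a single face of \<open>b\<close> is
  the common smaller cube. The remaining cases follow the same pattern.\<close>

lemma common_dg_dg: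
  assumes ab: "a \<in> cells X n" "b \<in> cells X n" and i: "1 \<le> i" and ij: "i \<le> j" and j: "j \<le> Suc n"
    and eq: "dg n i a = dg n j b"
  shows "common n (True, i) a (True, j) b"
proof (cases "i = j")
  case True
  then have "a = b" using arg_cong[OF eq, of "fc n i False"] ab i ij j by simp
  then show ?thesis using True by (simp add: common_def)
next
  case False
  then obtain j' where j': "j = Suc j'" "i \<le> j'" using i ij by (cases j) auto
  then obtain m where m: "n = Suc m" using i j by (cases n) auto
  have a: "a = dg m j' (fc m i False b)"
    using arg_cong[OF eq, of "fc n i False"] fc_dg_lt[of b m i j' False] ab i j j' m by simp
  have "b = dg m i (fc m j' False a)"
    using arg_cong[OF eq, of "fc n j False"] fc_dg_gt[of a m i j' False] ab i j j' m by simp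
  then have b: "b = dg m i (fc m i False b)"
    using fc_dg_same[of "fc m i False b" m j' False] a ab i j j' m by simp
  show ?thesis
    by (rule commonI[OF m, of "fc m i False b" "(True, i)" "(True, j')"])
       (use ab i j j' m a b dg_dg in auto)
qed

lemma common_cn_cn:
  assumes ab: "a \<in> cells X n" "b \<in> cells X n" and i: "1 \<le> i" and ij: "i \<le> j" and j: "j \<le> n"
    and eq: "cn n i a = cn n j b"
  shows "common n (False, i) a (False, j) b"
proof (cases "i = j")
  case True
  have "a = fc n i False (cn n i a)" using fc_cn_False[of a n i i] ab i ij j by simp
  also have "\<dots> = fc n i False (cn n i b)" using eq True by simp
  also have "\<dots> = b" using fc_cn_False[of b n i i] ab i ij j by simp
  finally have "a = b" .
  then show ?thesis using True by (simp add: common_def)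
next
  case False
  then obtain j' where j': "j = Suc j'" "i \<le> j'" using i ij by (cases j) auto
  then obtain m where m: "n = Suc m" using i j by (cases n) auto
  have a: "a = cn m j' (fc m i False b)"
    using fc_cn_False[of a n i i] fc_cn_lt[of b m i j' False] ab i j j' m eq by simp
  \<comment> \<open>Direction \<open>Suc j\<close> is used because direction j may be one of the two
    merged by the connection at i.\<close>
  have "b = cn m i (fc m j False a)"
    using fc_cn_False[of b n j "Suc j"] fc_cn_gt[of a m i j False] ab i j j' m eq by simp
  then have b: "b = cn m i (fc m i False b)"
    using fc_cn_False[of "fc m i False b" m j' j] a ab i j j' m by simp
  show ?thesis
    by (rule commonI[OF m, of "fc m i False b" "(False, i)" "(False, j')"])
       (use ab i j j' m a b cn_cn in auto)
qed

lemma common_dg_cn: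
  assumes ab: "a \<in> cells X n" "b \<in> cells X n" and j: "1 \<le> j" "j \<le> Suc n" and i: "1 \<le> i" "i \<le> n"
    and eq: "dg n j a = cn n i b"
  shows "common n (True, j) a (False, i) b"
proof -
  obtain m where m: "n = Suc m" using i by (cases n) auto
  have "j = i \<or> j = Suc i \<or> j < i \<or> Suc i < j" by linarith
  then show ?thesis
  proof (elim disjE)
    assume "j < i"
    then obtain i' where i': "i = Suc i'" "j \<le> i'" using j by (cases i) auto
    have a: "a = cn m i' (fc m j False b)"
      using arg_cong[OF eq, of "fc n j False"] fc_cn_lt[of b m j i' False] ab i j i' m by simp
    have "b = dg m j (fc m i' False a)"
      using fc_cn_False[of b n i i] fc_dg_gt[of a m j i' False] ab i j i' m eq by simp
    then have b: "b = dg m j (fc m j False b)"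
      using fc_cn_False[of "fc m j False b" m i' i'] a ab i j i' m by simp
    show ?thesis
      by (rule commonI[OF m, of "fc m j False b" "(True, j)" "(False, i')"])
         (use ab i j i' m a b cn_dg_lt in auto)
  next
    assume "Suc i < j"
    then obtain j' where j': "j = Suc j'" "i < j'" by (cases j) auto
    have a: "a = cn m i (fc m j' False b)"
      using arg_cong[OF eq, of "fc n j False"] fc_cn_gt[of b m i j' False] ab i j j' m by simp
    have "b = dg m j' (fc m i False a)"
      using fc_cn_False[of b n i i] fc_dg_lt[of a m i j' False] ab i j j' m eq by simp
    then have b: "b = dg m j' (fc m j' False b)"
      using fc_cn_False[of "fc m j' False b" m i i] a ab i j j' m by simp
    show ?thesis
      by (rule commonI[OF m, of "fc m j' False b" "(True, j')" "(False, i)"])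
         (use ab i j j' m a b cn_dg_gt in auto)
  next
    \<comment> \<open>When the dropped direction is one of the merged two, \<open>a = b\<close> and
      this cube is itself degenerate in direction i. Both presentations then drop two adjacent
      coordinates, and \<open>cn_dg_same\<close> equates them.\<close>
    assume ji: "j = i"
    have "a = b"
      using arg_cong[OF eq, of "fc n j False"] fc_cn_False[of b n i j] ab i j ji by simp
    moreover have "b = dg m i (fc m i False a)"
      using fc_cn_False[of b n i "Suc i"] fc_dg_gt[of a m i i False] ab i m ji eq by simp
    ultimately show ?thesis
      by (intro commonI[OF m, of "fc m i False a" "(True, i)" "(True, i)"])
         (use ab i m ji cn_dg_same in auto)
  next
    assume ji: "j = Suc i"
    have "a = b"
      using arg_cong[OF eq, of "fc n j False"] fc_cn_False[of b n i j] ab i j ji by simp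
    moreover have "b = dg m i (fc m i False a)"
      using fc_cn_False[of b n i i] fc_dg_lt[of a m i i False] ab i m ji eq by simp
    ultimately show ?thesis
      by (intro commonI[OF m, of "fc m i False a" "(True, i)" "(True, i)"])
         (use ab i m ji cn_dg_same dg_dg in auto)
  qed
qed

lemma common_deg:
  assumes ab: "a \<in> cells X n" "b \<in> cells X n" and ok: "deg_ok n s" "deg_ok n t"
    and eq: "deg n s a = deg n t b"
  shows "common n s a t b"
proof -
  obtain c i d j where st: "s = (c, i)" "t = (d, j)" by (cases s, cases t)
  show ?thesis
  proof (cases c; cases d)
    assume "c" "d"
    then show ?thesis
      using st ok eq ab common_dg_dg[of a n b i j] common_dg_dg[of b n a j i] common_sym[of n t b s a]
      by (cases "i \<le> j") simp_all
  next
    assume "\<not> c" "\<not> d"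
    then show ?thesis
      using st ok eq ab common_cn_cn[of a n b i j] common_cn_cn[of b n a j i] common_sym[of n t b s a]
      by (cases "i \<le> j") simp_all
  next
    assume "c" "\<not> d"
    then show ?thesis using st ok eq ab common_dg_cn[of a n b i j] by simp
  next
    assume "\<not> c" "d"
    then show ?thesis using st ok eq ab common_dg_cn[of b n a j i] common_sym[of n t b s a] by simp
  qed
qed

end

section \<open>Construction of the contraction\<close>

context pointed_kan
begin

lemma pt_0: "pt 0 = x"
proof -
  have "terminal 0 = (\<lambda>xs \<in> cube 0. xs)"
    by (auto simp: terminal_def restrict_def)
  then show ?thesis using act_id x_in by (simp add: pt_def const_cube_def)
qed

text \<open>The lid is constant only below dimension n; in dimension n it is left free and carries
  the homotopy class. The clause on \<open>x\<close> anchors the contraction, and its values on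
  higher constant cubes follow from compatibility with degeneracies.\<close>

definition contracts :: "nat \<Rightarrow> nat \<Rightarrow> (nat \<Rightarrow> 'a \<Rightarrow> 'a) \<Rightarrow> bool" where
  "contracts n k H \<longleftrightarrow>
     (\<forall>c \<in> cells X k. H k c \<in> cells X (Suc k) \<and> fc k 1 False (H k c) = c \<and>
        (k < n \<longrightarrow> fc k 1 True (H k c) = pt k) \<and>
        (\<forall>m i e. k = Suc m \<longrightarrow> 1 \<le> i \<longrightarrow> i \<le> k \<longrightarrow> fc k (Suc i) e (H k c) = H m (fc m i e c))) \<and>
     (\<forall>m s. k = Suc m \<longrightarrow> deg_ok m s \<longrightarrow>
        (\<forall>c \<in> cells X m. H k (deg m s c) = deg k (shift s) (H m c))) \<and>
     (k = 0 \<longrightarrow> H 0 x = dg 0 1 x)"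

lemma contracts_cylinder:
  assumes H: "contracts n k H" and c: "c \<in> cells X (Suc k)"
  shows "\<exists>v \<in> cells X (Suc (Suc k)). fc (Suc k) 1 False v = c \<and>
    (\<forall>j d. 1 \<le> j \<longrightarrow> j \<le> Suc k \<longrightarrow> fc (Suc k) (Suc j) d v = H k (fc k j d c))"
proof (rule cylinder[OF c])
  fix j d assume "1 \<le> j" "j \<le> Suc k"
  then show "H k (fc k j d c) \<in> cells X (Suc k)" "fc k 1 False (H k (fc k j d c)) = fc k j d c"
    using H c by (auto simp: contracts_def)
next
  fix j e i d assume ji: "1 \<le> j" "j \<le> i" "i \<le> k"
  then obtain m where m: "k = Suc m" by (cases k) auto
  have "fc k (Suc l) b (H k u) = H m (fc m l b u)"
    if "u \<in> cells X (Suc m)" "1 \<le> l" "l \<le> Suc m" for l b u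
    using H that m unfolding contracts_def by blast
  then show "fc k (Suc j) e (H k (fc k (Suc i) d c)) = fc k (Suc i) d (H k (fc k j e c))"
    using fc_fc[of c m j i e d] ji m c by simp
qed

text \<open>On degenerate cubes the new value is forced, on the others any admissible filler will
  do. It remains to see that the forced value is unique, by \<open>common_deg\<close>, and
  admissible, by \<open>fc_deg_cases\<close>.\<close>

lemma contracts_step:
  assumes conn: "\<And>m a. m < n \<Longrightarrow> sph m a \<Longrightarrow> homot 1 m a (pt m)"
    and k: "Suc k \<le> n" and H: "\<And>l. l \<le> k \<Longrightarrow> contracts n l H"
  shows "\<exists>h. contracts n (Suc k) (H(Suc k := h))"
proof -
  have Hk: "contracts n k H" using H by simp
  have H_cell: "H k c \<in> cells X (Suc k)" "fc k 1 False (H k c) = c" "fc k 1 True (H k c) = pt k"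
    if "c \<in> cells X k" for c
    using Hk k that by (auto simp: contracts_def)
  define filler where "filler c v \<longleftrightarrow> v \<in> cells X (Suc (Suc k)) \<and> fc (Suc k) 1 False v = c \<and>
      (Suc k < n \<longrightarrow> fc (Suc k) 1 True v = pt (Suc k)) \<and>
      (\<forall>j d. 1 \<le> j \<longrightarrow> j \<le> Suc k \<longrightarrow> fc (Suc k) (Suc j) d v = H k (fc k j d c))" for c v
  have fill: "\<exists>v. filler c v" if c: "c \<in> cells X (Suc k)" for c
  proof -
    obtain v where v: "v \<in> cells X (Suc (Suc k))" "fc (Suc k) 1 False v = c"
      "\<And>j d. 1 \<le> j \<Longrightarrow> j \<le> Suc k \<Longrightarrow> fc (Suc k) (Suc j) d v = H k (fc k j d c)"
      using contracts_cylinder[OF Hk c] by blast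
    show ?thesis
    proof (cases "Suc k < n")
      case True
      \<comment> \<open>The lid has constant faces because the lids one dimension lower are
        constant; connectivity then allows it to be exchanged for the constant cube.\<close>
      let ?u = "fc (Suc k) 1 True v"
      have "fc k j d ?u = pt k" if "1 \<le> j" "j \<le> Suc k" for j d
        using fc_fc[of v k 1 j True d] v that H_cell c by simp
      then have s: "sph (Suc k) ?u"
        using v(1) by (simp add: sph_def del: sph_cell sph_fc)
      have "\<exists>w \<in> cells X (Suc (Suc k)). fc (Suc k) 1 True w = pt (Suc k) \<and>
        (\<forall>j d. 1 \<le> j \<longrightarrow> j \<le> Suc (Suc k) \<longrightarrow> (j, d) \<noteq> (1, True) \<longrightarrow> fc (Suc k) j d w = fc (Suc k) j d v)"
        by (rule replace_face[OF v(1) _ _ s conn[OF True s]]) auto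
      then obtain w where "w \<in> cells X (Suc (Suc k))" "fc (Suc k) 1 True w = pt (Suc k)"
        "\<And>j d. 1 \<le> j \<Longrightarrow> j \<le> Suc (Suc k) \<Longrightarrow> (j, d) \<noteq> (1, True) \<Longrightarrow> fc (Suc k) j d w = fc (Suc k) j d v"
        by blast
      then have "filler c w" using v by (auto simp: filler_def)
      then show ?thesis by blast
    next
      case False
      then have "filler c v" using v by (auto simp: filler_def)
      then show ?thesis by blast
    qed
  qed
  define val where "val c v \<longleftrightarrow> (\<exists>s a. deg_ok k s \<and> a \<in> cells X k \<and> c = deg k s a \<and>
      v = deg (Suc k) (shift s) (H k a))" for c v
  have val_unique: "v = v'" if "val c v" "val c v'" for c v v'
  proof -
    obtain s a where s: "deg_ok k s" "a \<in> cells X k" "c = deg k s a" "v = deg (Suc k) (shift s) (H k a)"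
      using \<open>val c v\<close> by (auto simp: val_def)
    obtain t b where t: "deg_ok k t" "b \<in> cells X k" "c = deg k t b" "v' = deg (Suc k) (shift t) (H k b)"
      using \<open>val c v'\<close> by (auto simp: val_def)
    have "common k s a t b" using common_deg s t by metis
    then show ?thesis
    proof (cases rule: commonE)
      case eq
      then show ?thesis using s t by simp
    next
      case (span m e s' t')
      have "H k a = deg k (shift t') (H m e)" "H k b = deg k (shift s') (H m e)"
        using Hk span unfolding contracts_def by blast+
      moreover have "H m e \<in> cells X (Suc m)"
        using H[of m] span by (auto simp: contracts_def)
      ultimately show ?thesis using s t span by simp
    qed
  qed
  have val_filler: "filler c v" if "val c v" for c v
  proof -
    obtain s a where s: "deg_ok k s" "a \<in> cells X k" "c = deg k s a" "v = deg (Suc k) (shift s) (H k a)"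
      using \<open>val c v\<close> by (auto simp: val_def)
    have 1: "fc (Suc k) 1 d v = deg k s (fc k 1 d (H k a))" for d
      using fc_deg_shift_1[OF s(1) H_cell(1)[OF s(2)]] s by simp
    have pt: "deg k s (pt k) = pt (Suc k)"
      using s(1) by (cases s) (auto split: if_splits)
    have "fc (Suc k) (Suc j) d v = H k (fc k j d c)" if j: "1 \<le> j" "j \<le> Suc k" for j d
    proof (rule fc_deg_cases[OF s(1) j, of d])
      assume "\<And>y. y \<in> cells X (Suc k) \<Longrightarrow> fc (Suc k) (Suc j) d (deg (Suc k) (shift s) y) = y"
        "\<And>z. z \<in> cells X k \<Longrightarrow> fc k j d (deg k s z) = z"
      then show ?thesis using s H_cell by simp
    next
      fix m s' j'
      assume diff: "k = Suc m" "deg_ok m s'" "1 \<le> j'" "j' \<le> Suc m"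
        "\<And>z. z \<in> cells X (Suc m) \<Longrightarrow> fc (Suc m) j d (deg (Suc m) s z) = deg m s' (fc m j' d z)"
        "\<And>y. y \<in> cells X (Suc (Suc m)) \<Longrightarrow> fc (Suc (Suc m)) (Suc j) d (deg (Suc (Suc m)) (shift s) y) =
          deg (Suc m) (shift s') (fc (Suc m) (Suc j') d y)"
      have "H k (deg m s' (fc m j' d a)) = deg k (shift s') (H m (fc m j' d a))"
        "fc k (Suc j') d (H k a) = H m (fc m j' d a)"
        using Hk diff(1-4) s(2) fc_closed[of a m j' d] unfolding contracts_def by blast+
      then show ?thesis using diff s H_cell by simp
    qed
    then show ?thesis
      using s 1 pt H_cell by (auto simp: filler_def)
  qed
  \<comment> \<open>Forced values take precedence, so compatibility with degeneracies and
    connections holds by construction.\<close>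
  define h where "h c = (if \<exists>v. val c v then (SOME v. val c v) else (SOME v. filler c v))" for c
  have h_val: "h c = v" if "val c v" for c v
    using that someI[of "val c" v] val_unique by (auto simp: h_def)
  have h_filler: "filler c (h c)" if "c \<in> cells X (Suc k)" for c
  proof (cases "\<exists>v. val c v")
    case True
    then show ?thesis using h_val val_filler by auto
  next
    case False
    then show ?thesis using someI_ex[OF fill[OF that]] by (simp add: h_def)
  qed
  have "h (deg k s c) = deg (Suc k) (shift s) (H k c)" if "deg_ok k s" "c \<in> cells X k" for s c
    by (rule h_val) (use that in \<open>unfold val_def, blast\<close>)
  then have "contracts n (Suc k) (H(Suc k := h))"
    using h_filler unfolding contracts_def filler_def
    by (auto simp del: deg.simps shift.simps deg_ok.simps)
  then show ?thesis by blast
qed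

lemma contracts_exists:
  assumes conn: "\<And>m a. m < n \<Longrightarrow> sph m a \<Longrightarrow> homot 1 m a (pt m)" and n: "0 < n"
  obtains H where "\<And>k. k \<le> n \<Longrightarrow> contracts n k H"
proof -
  have "k \<le> n \<Longrightarrow> \<exists>H. \<forall>l \<le> k. contracts n l H" for k
  proof (induction k)
    case 0
    have ex: "\<exists>t \<in> cells X 1. fc 0 1 False t = c \<and> fc 0 1 True t = pt 0 \<and> (c = x \<longrightarrow> t = dg 0 1 x)"
      if c: "c \<in> cells X 0" for c
    proof (cases "c = x")
      case True
      then show ?thesis using x_in pt_0 by (intro bexI[of _ "dg 0 1 x"]) auto
    next
      case False
      have "sph 0 c" using c by (simp add: sph_def del: sph_cell sph_fc)
      then show ?thesis using conn[OF n] False by (auto simp: homot_def)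
    qed
    \<comment> \<open>Any path to the basepoint serves for a vertex, except that the basepoint
      itself gets the degenerate path.\<close>
    define H where "H k c = (SOME t. t \<in> cells X 1 \<and> fc 0 1 False t = c \<and> fc 0 1 True t = pt 0 \<and>
      (c = x \<longrightarrow> t = dg 0 1 x))" for k :: nat and c
    have "H 0 c \<in> cells X 1 \<and> fc 0 1 False (H 0 c) = c \<and> fc 0 1 True (H 0 c) = pt 0 \<and>
      (c = x \<longrightarrow> H 0 c = dg 0 1 x)" if "c \<in> cells X 0" for c
      unfolding H_def by (rule someI_ex) (use ex[OF that] in blast)
    then have "contracts n 0 H" using x_in by (auto simp: contracts_def)
    then show ?case by blast
  next
    case (Suc k)
    then obtain H where H: "\<And>l. l \<le> k \<Longrightarrow> contracts n l H" by auto
    obtain h where h: "contracts n (Suc k) (H(Suc k := h))"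
      using contracts_step[OF conn Suc.prems H] by blast
    have "contracts n l (H(Suc k := h))" if "l \<le> k" for l
      using H[OF that] that unfolding contracts_def by (auto simp del: fun_upd_apply simp: fun_upd_other)
    then show ?case using h by (metis le_Suc_eq)
  qed
  then show ?thesis using that by blast
qed

lemma contracts_pt:
  assumes H: "\<And>k. k \<le> n \<Longrightarrow> contracts n k H" and k: "k \<le> n"
  shows "H k (pt k) = pt (Suc k)"
  using k
proof (induction k)
  case 0
  then show ?case using H[of 0] pt_0 dg_pt[of 1 0] by (simp add: contracts_def)
next
  case (Suc k)
  have "H (Suc k) (deg k (True, 1) (pt k)) = deg (Suc k) (shift (True, 1)) (H k (pt k))"
  proof -
    have "deg_ok k (True, 1)" by simp
    then show ?thesis using H[OF Suc.prems] pt_in[of k] unfolding contracts_def by blast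
  qed
  then show ?case using Suc by simp
qed

section \<open>The lid of the contraction in dimension n\<close>

definition retract :: "nat \<Rightarrow> (nat \<Rightarrow> 'a \<Rightarrow> 'a) \<Rightarrow> 'a \<Rightarrow> 'a" where
  "retract n H c = fc n 1 True (H n c)"

text \<open>The faces of the lid are lids in dimension n - 1, hence constant. On a degenerate cube
  the lid is a degeneracy or connection of such a constant lid. Over a spherical cube the sides are
  constant, so the cylinder is a relative homotopy. A cylinder on an (n + 1)-cube has a lid filling
  the retracted boundary.\<close>

lemma retract:
  assumes H: "\<And>k. k \<le> n \<Longrightarrow> contracts n k H"
  shows retract_sph: "c \<in> cells X n \<Longrightarrow> sph n (retract n H c)"
    and retract_deg: "n = Suc m \<Longrightarrow> deg_ok m s \<Longrightarrow> b \<in> cells X m \<Longrightarrow> retract n H (deg m s b) = pt n"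
    and retract_homot: "sph n a \<Longrightarrow> homot 1 n a (retract n H a)"
    and retract_filled: "w \<in> cells X (Suc n) \<Longrightarrow>
      \<exists>w' \<in> cells X (Suc n). \<forall>i e. 1 \<le> i \<longrightarrow> i \<le> Suc n \<longrightarrow> fc n i e w' = retract n H (fc n i e w)"
proof -
  have Hn: "contracts n n H" using H by simp
  have cell: "H n c \<in> cells X (Suc n)" "fc n 1 False (H n c) = c" if "c \<in> cells X n" for c
    using Hn that by (auto simp: contracts_def)
  have side: "fc (Suc m) (Suc i) e (H (Suc m) c) = H m (fc m i e c)"
    if "c \<in> cells X (Suc m)" "n = Suc m" "1 \<le> i" "i \<le> Suc m" for c m i e
    using Hn that unfolding contracts_def by blast
  have top: "fc m 1 True (H m c) = pt m" "H m c \<in> cells X (Suc m)"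
    if "c \<in> cells X m" "n = Suc m" for c m
    using H[of m] that by (auto simp: contracts_def)
  show "sph n (retract n H c)" if c: "c \<in> cells X n"
  proof -
    have "fc (n - 1) i e (retract n H c) = pt (n - 1)" if i: "1 \<le> i" "i \<le> n" for i e
    proof -
      obtain m where m: "n = Suc m" using i by (cases n) auto
      then show ?thesis
        using fc_fc[of "H n c" m 1 i True e] cell side[of c m i e] top[of "fc m i e c" m] c i
        by (simp add: retract_def)
    qed
    then show ?thesis using cell c by (simp add: sph_def retract_def del: sph_cell sph_fc)
  qed
  show "retract n H (deg m s b) = pt n" if "n = Suc m" "deg_ok m s" "b \<in> cells X m"
  proof -
    have "H n (deg m s b) = deg n (shift s) (H m b)"
      using Hn that unfolding contracts_def by blast
    moreover have "deg m s (pt m) = pt (Suc m)"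
      using that(2) by (cases s) (auto split: if_splits)
    ultimately show ?thesis
      using fc_deg_shift_1[of m s "H m b" True] top[of b m] that by (simp add: retract_def)
  qed
  show "homot 1 n a (retract n H a)" if a: "sph n a"
  proof -
    have "fc n i e (H n a) = pt n" if i: "1 \<le> i" "i \<le> Suc n" "i \<noteq> 1" for i e
    proof -
      obtain j m where j: "i = Suc j" "n = Suc m" "1 \<le> j" "j \<le> n" using i by (cases i; cases n) auto
      then show ?thesis
        using side[of a m j e] a contracts_pt[OF H, of m] by simp
    qed
    then show ?thesis
      unfolding homot_def retract_def using cell a by (intro bexI[of _ "H n a"]) auto
  qed
  show "\<exists>w' \<in> cells X (Suc n). \<forall>i e. 1 \<le> i \<longrightarrow> i \<le> Suc n \<longrightarrow> fc n i e w' = retract n H (fc n i e w)"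
    if w: "w \<in> cells X (Suc n)"
  proof -
    obtain v where v: "v \<in> cells X (Suc (Suc n))" "fc (Suc n) 1 False v = w"
      "\<And>j d. 1 \<le> j \<Longrightarrow> j \<le> Suc n \<Longrightarrow> fc (Suc n) (Suc j) d v = H n (fc n j d w)"
      using contracts_cylinder[OF Hn w] by blast
    then show ?thesis
      using fc_fc[of v n 1 _ True] by (intro bexI[of _ "fc (Suc n) 1 True v"]) (auto simp: retract_def)
  qed
qed

end

section \<open>Chain groups\<close>

lemma hom_generate_subset:
  assumes "group G" "group K" "f \<in> hom G K" "S \<subseteq> carrier G" "subgroup N K" "f ` S \<subseteq> N"
  shows "f ` generate G S \<subseteq> N"
proof -
  interpret group_hom G K f
    using assms by (simp add: group_hom_def group_hom_axioms_def)
  show ?thesis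
    using generate_img[OF assms(4)] group.generate_subgroup_incl[OF assms(2,6,5)] by simp
qed

lemma (in comm_group) coset_eq_iff:
  assumes "subgroup N G" "a \<in> carrier G" "b \<in> carrier G"
  shows "N #> a = N #> b \<longleftrightarrow> a \<otimes> inv b \<in> N"
proof -
  have "N \<subseteq> carrier G" using assms(1) by (rule subgroup.subset)
  then show ?thesis
    using assms coset_join1[of N "a \<otimes> inv b"] coset_join2[of "a \<otimes> inv b" N]
      coset_mult_inv1[of N a b] coset_mult_inv2[of N a b] by blast
qed

lemma (in comm_group) coset_hom:
  assumes "subgroup N G"
  shows "(\<lambda>a. N #> a) \<in> hom G (G Mod N)"
proof -
  interpret normal N G using assms by (rule subgroup_imp_normal)
  show ?thesis by (rule r_coset_hom_Mod)
qed

lemma quot_map_coset: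
  assumes G: "comm_group G" and K: "comm_group K" and M: "subgroup M G" and N: "subgroup N K"
    and f: "f \<in> hom G K" and fM: "f ` M \<subseteq> N" and g: "g \<in> carrier G"
  shows "quot_map K N f (M #>\<^bsub>G\<^esub> g) = N #>\<^bsub>K\<^esub> f g"
proof -
  interpret G: comm_group G by fact
  interpret K: comm_group K by fact
  have M': "M \<subseteq> carrier G" and N': "N \<subseteq> carrier K"
    using M N by (auto dest: subgroup.subset)
  have f': "f m \<in> carrier K" "f (m \<otimes>\<^bsub>G\<^esub> g) = f m \<otimes>\<^bsub>K\<^esub> f g" if "m \<in> M" for m
    using f M' g that by (auto simp: hom_def Pi_def)
  have fg: "f g \<in> carrier K" using f g by (auto simp: hom_def)
  show ?thesis
  proof
    show "quot_map K N f (M #>\<^bsub>G\<^esub> g) \<subseteq> N #>\<^bsub>K\<^esub> f g"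
    proof
      fix y assume "y \<in> quot_map K N f (M #>\<^bsub>G\<^esub> g)"
      then obtain k m where km: "k \<in> N" "m \<in> M" "y = k \<otimes>\<^bsub>K\<^esub> f (m \<otimes>\<^bsub>G\<^esub> g)"
        by (auto simp: quot_map_def set_mult_def r_coset_def)
      have "y = (k \<otimes>\<^bsub>K\<^esub> f m) \<otimes>\<^bsub>K\<^esub> f g"
        using km f' fg N' K.m_assoc by auto
      moreover have "k \<otimes>\<^bsub>K\<^esub> f m \<in> N"
        using km fM subgroup.m_closed[OF N] by blast
      ultimately show "y \<in> N #>\<^bsub>K\<^esub> f g" by (auto simp: r_coset_def)
    qed
    show "N #>\<^bsub>K\<^esub> f g \<subseteq> quot_map K N f (M #>\<^bsub>G\<^esub> g)"
    proof
      fix y assume "y \<in> N #>\<^bsub>K\<^esub> f g"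
      then obtain k where "k \<in> N" "y = k \<otimes>\<^bsub>K\<^esub> f g" by (auto simp: r_coset_def)
      moreover have "g \<in> M #>\<^bsub>G\<^esub> g"
        using G.rcos_self[OF g M] .
      ultimately show "y \<in> quot_map K N f (M #>\<^bsub>G\<^esub> g)"
        by (auto simp: quot_map_def set_mult_def)
    qed
  qed
qed

lemma hom_frag_sum:
  assumes K: "comm_group K" and g: "g \<in> hom (free_Abelian_group S) K" and I: "finite I"
    and c: "\<And>i. i \<in> I \<Longrightarrow> Poly_Mapping.keys (c i) \<subseteq> S"
  shows "g (\<Sum>i\<in>I. frag_cmul (k i) (c i)) = finprod K (\<lambda>i. g (c i) [^]\<^bsub>K\<^esub> k i) I"
proof -
  interpret K: comm_group K by fact
  interpret group_hom "free_Abelian_group S" K g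
    using g by (simp add: group_hom_def group_hom_axioms_def K.is_group)
  show ?thesis
    using I c
  proof (induction I rule: finite_induct)
    case empty
    then show ?case using hom_one by simp
  next
    case (insert i I)
    have keys: "Poly_Mapping.keys (frag_cmul (k j) (c j)) \<subseteq> S" if "j \<in> insert i I" for j
      using insert.prems[OF that] keys_cmul by fast
    have sum: "Poly_Mapping.keys (\<Sum>i\<in>I. frag_cmul (k i) (c i)) \<subseteq> S"
      using sum_closed_free_Abelian_group[of I "\<lambda>i. frag_cmul (k i) (c i)" S] keys by simp
    have pow: "g (frag_cmul (k j) (c j)) = g (c j) [^]\<^bsub>K\<^esub> k j" if "j \<in> insert i I" for j
      using hom_int_pow[of "c j" "k j"] insert.prems[OF that] by simp
    have gc: "g (c j) \<in> carrier K" if "j \<in> insert i I" for j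
      using hom_closed insert.prems[OF that] by simp
    have "g (\<Sum>i\<in>insert i I. frag_cmul (k i) (c i)) =
        g (frag_cmul (k i) (c i)) \<otimes>\<^bsub>K\<^esub> g (\<Sum>i\<in>I. frag_cmul (k i) (c i))"
      using insert.hyps hom_mult[of "frag_cmul (k i) (c i)" "\<Sum>i\<in>I. frag_cmul (k i) (c i)"] keys sum by simp
    also have "\<dots> = finprod K (\<lambda>i. g (c i) [^]\<^bsub>K\<^esub> k i) (insert i I)"
      using insert pow gc by (subst K.finprod_insert) auto
    finally show ?case .
  qed
qed

lemma hom_diff_free_Abelian_group:
  assumes K: "group K" and f: "f \<in> hom (free_Abelian_group S) K"
    and "Poly_Mapping.keys a \<subseteq> S" "Poly_Mapping.keys b \<subseteq> S"
  shows "f (a - b) = f a \<otimes>\<^bsub>K\<^esub> inv\<^bsub>K\<^esub> f b"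
proof -
  interpret group_hom "free_Abelian_group S" K f
    using f K by (simp add: group_hom_def group_hom_axioms_def)
  show ?thesis
    using hom_mult[of a "- b"] hom_inv[of b] assms by (simp add: keys_minus)
qed

lemma hom_eq_on_generators:
  assumes K: "group K" and f: "f \<in> hom (free_Abelian_group S) K" and g: "g \<in> hom (free_Abelian_group S) K"
    and eq: "\<And>z. z \<in> S \<Longrightarrow> f (frag_of z) = g (frag_of z)" and c: "Poly_Mapping.keys c \<subseteq> S"
  shows "f c = g c"
proof -
  interpret f: group_hom "free_Abelian_group S" K f
    using f K by (simp add: group_hom_def group_hom_axioms_def)
  interpret g: group_hom "free_Abelian_group S" K g
    using g K by (simp add: group_hom_def group_hom_axioms_def)
  show ?thesis
    using f.hom_one g.hom_one hom_diff_free_Abelian_group[OF K f] hom_diff_free_Abelian_group[OF K g] eq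
    by (intro free_Abelian_group_induct[OF c, of "\<lambda>c. f c = g c"]) auto
qed

lemma frag_extend_hom:
  assumes "\<And>z. z \<in> S \<Longrightarrow> Poly_Mapping.keys (f z) \<subseteq> T"
  shows "frag_extend f \<in> hom (free_Abelian_group S) (free_Abelian_group T)"
proof (rule homI)
  fix c assume "c \<in> carrier (free_Abelian_group S)"
  then show "frag_extend f c \<in> carrier (free_Abelian_group T)"
    using assms keys_frag_extend[of f c] by fastforce
qed (simp add: frag_extend_add)

abbreviation face_sign :: "nat \<times> bool \<Rightarrow> int" where
  "face_sign \<equiv> \<lambda>(i, e). (- 1) ^ (i + of_bool e)"

abbreviation facets :: "nat \<Rightarrow> (nat \<times> bool) set" where
  "facets n \<equiv> {1..n} \<times> UNIV"

section \<open>Chains modulo the basepoint\<close>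

locale pointed_chains = pointed_cubical
begin

abbreviation A :: "('a \<Rightarrow>\<^sub>0 int) set cubical_ab" where
  "A \<equiv> free_cubical X x"

abbreviation chain :: "nat \<Rightarrow> ('a \<Rightarrow>\<^sub>0 int) \<Rightarrow> bool" where
  "chain n c \<equiv> Poly_Mapping.keys c \<subseteq> cells X n"

definition ch :: "nat \<Rightarrow> ('a \<Rightarrow>\<^sub>0 int) monoid" where
  "ch n = free_Abelian_group (cells X n)"

definition qb :: "nat \<Rightarrow> ('a \<Rightarrow>\<^sub>0 int) \<Rightarrow> ('a \<Rightarrow>\<^sub>0 int) set" where
  "qb n c = base_subgroup X x n #>\<^bsub>ch n\<^esub> c"

lemma ch_simps [simp]:
  "c \<in> carrier (ch n) \<longleftrightarrow> chain n c"
  "c \<otimes>\<^bsub>ch n\<^esub> d = c + d" "\<one>\<^bsub>ch n\<^esub> = 0"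
  "chain n c \<Longrightarrow> inv\<^bsub>ch n\<^esub> c = - c"
  by (simp_all add: ch_def)

lemma comm_group_ch: "comm_group (ch n)"
  by (simp add: ch_def abelian_free_Abelian_group)

lemma group_ch: "group (ch n)"
  by (simp add: ch_def)

lemma base_subgroup: "subgroup (base_subgroup X x n) (ch n)"
  unfolding base_subgroup_def ch_def[symmetric]
  by (rule group.generate_is_subgroup[OF group_ch]) (use pt_in in \<open>simp add: pt_def\<close>)

lemma grp_A: "grp A n = ch n Mod base_subgroup X x n"
  by (simp add: free_cubical_def ch_def)

lemma comm_group_grp: "comm_group (grp A n)"
  unfolding grp_A by (rule comm_group.abelian_FactGroup[OF comm_group_ch base_subgroup])

lemma group_grp: "group (grp A n)"
  using comm_group_grp by (rule comm_group.axioms(2))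

lemma qb_hom: "qb n \<in> hom (ch n) (grp A n)"
  unfolding grp_A qb_def by (rule comm_group.coset_hom[OF comm_group_ch base_subgroup])

lemma carrier_grp: "carrier (grp A n) = qb n ` carrier (ch n)"
  by (simp add: grp_A carrier_FactGroup qb_def)

lemma base_subgroup_trivial:
  assumes K: "group K" and g: "g \<in> hom (ch n) K" and gpt: "g (frag_of (pt n)) = \<one>\<^bsub>K\<^esub>"
    and c: "c \<in> base_subgroup X x n"
  shows "g c = \<one>\<^bsub>K\<^esub>"
proof -
  have "g ` generate (ch n) {frag_of (pt n)} \<subseteq> {\<one>\<^bsub>K\<^esub>}"
    by (rule hom_generate_subset[OF group_ch K g]) (use gpt group.triv_subgroup[OF K] in auto)
  then show ?thesis
    using c by (auto simp: base_subgroup_def ch_def pt_def)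
qed

lemma gact_qb:
  assumes \<phi>: "box_map m n \<phi>" and c: "chain n c"
  shows "gact A m n \<phi> (qb n c) = qb m (frag_extend (\<lambda>z. frag_of (act X m n \<phi> z)) c)"
proof -
  let ?f = "frag_extend (\<lambda>z. frag_of (act X m n \<phi> z))"
  have f: "?f \<in> hom (ch n) (ch m)"
    unfolding ch_def by (rule frag_extend_hom) (use act_closed[OF \<phi>] in auto)
  have "?f (frag_of (pt n)) \<in> base_subgroup X x m"
    using act_pt[OF \<phi>] by (auto simp: base_subgroup_def pt_def intro: generate.incl)
  then have "?f ` base_subgroup X x n \<subseteq> base_subgroup X x m"
    unfolding base_subgroup_def[of X x n] ch_def[symmetric]
    by (intro hom_generate_subset[OF group_ch group_ch f]) (use base_subgroup pt_in in \<open>auto simp: pt_def\<close>)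
  then have "quot_map (ch m) (base_subgroup X x m) ?f (base_subgroup X x n #>\<^bsub>ch n\<^esub> c) =
      base_subgroup X x m #>\<^bsub>ch m\<^esub> ?f c"
    by (intro quot_map_coset comm_group_ch base_subgroup f) (use c in auto)
  then show ?thesis
    by (simp add: free_cubical_def qb_def ch_def)
qed

lemma gact_qb_of:
  "box_map m n \<phi> \<Longrightarrow> z \<in> cells X n \<Longrightarrow> gact A m n \<phi> (qb n (frag_of z)) = qb m (frag_of (act X m n \<phi> z))"
  by (simp add: gact_qb)

lemma qb_pt: "qb n (frag_of (pt n)) = \<one>\<^bsub>grp A n\<^esub>"
proof -
  have "frag_of (pt n) \<in> base_subgroup X x n"
    by (auto simp: base_subgroup_def pt_def intro: generate.incl)
  then show ?thesis
    unfolding qb_def grp_A one_FactGroup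
    by (intro group.coset_join2[OF group_ch _ base_subgroup]) auto
qed

abbreviation DA :: "nat \<Rightarrow> ('a \<Rightarrow>\<^sub>0 int) set set" where
  "DA n \<equiv> degenerate_subgroup A n"

abbreviation M :: "nat \<Rightarrow> ('a \<Rightarrow>\<^sub>0 int) set set monoid" where
  "M n \<equiv> moore_group A n"

definition degenerate_gens :: "nat \<Rightarrow> ('a \<Rightarrow>\<^sub>0 int) set set" where
  "degenerate_gens n = {qb n (frag_extend (\<lambda>z. frag_of (deg m s z)) c) | m s c.
     n = Suc m \<and> deg_ok m s \<and> chain m c}"

lemma DA_eq: "DA n = generate (grp A n) (degenerate_gens n)"
proof -
  have carrier: "a \<in> carrier (grp A m) \<longleftrightarrow> (\<exists>c. chain m c \<and> a = qb m c)" for a m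
    unfolding carrier_grp by (simp add: image_iff Bex_def)
  have "{gact A n (n - 1) (degen n i) a |i a. 1 \<le> i \<and> i \<le> n \<and> a \<in> carrier (grp A (n - 1))} \<union>
     {gact A n (n - 1) (conn n i False) a |i a. 1 \<le> i \<and> i \<le> n - 1 \<and> a \<in> carrier (grp A (n - 1))} =
     degenerate_gens n"
  proof (cases n)
    case 0
    then show ?thesis by (auto simp: degenerate_gens_def)
  next
    case (Suc m)
    have dg: "gact A (Suc m) m (degen (Suc m) i) (qb m c) =
        qb (Suc m) (frag_extend (\<lambda>z. frag_of (deg m (True, i) z)) c)"
      if "1 \<le> i" "i \<le> Suc m" "chain m c" for i c
      using gact_qb[OF box_degen'[of i m], of c] that by (simp add: dg_def)
    have cn: "gact A (Suc m) m (conn (Suc m) i False) (qb m c) =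
        qb (Suc m) (frag_extend (\<lambda>z. frag_of (deg m (False, i) z)) c)"
      if "1 \<le> i" "i \<le> m" "chain m c" for i c
      using gact_qb[OF box_conn'[of i m], of c] that by (simp add: cn_def)
    show ?thesis
    proof (intro equalityI subsetI)
      fix y assume "y \<in> {gact A n (n - 1) (degen n i) a |i a. 1 \<le> i \<and> i \<le> n \<and> a \<in> carrier (grp A (n - 1))} \<union>
        {gact A n (n - 1) (conn n i False) a |i a. 1 \<le> i \<and> i \<le> n - 1 \<and> a \<in> carrier (grp A (n - 1))}"
      then consider i c where "1 \<le> i" "i \<le> Suc m" "chain m c"
          "y = gact A (Suc m) m (degen (Suc m) i) (qb m c)"
        | i c where "1 \<le> i" "i \<le> m" "chain m c"
          "y = gact A (Suc m) m (conn (Suc m) i False) (qb m c)"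
        using Suc carrier by auto
      then show "y \<in> degenerate_gens n"
      proof cases
        case (1 i c)
        then show ?thesis
          unfolding degenerate_gens_def dg[OF 1(1-3)] Suc
          by (intro CollectI exI[of _ m] exI[of _ "(True, i)"] exI[of _ c]) simp
      next
        case (2 i c)
        then show ?thesis
          unfolding degenerate_gens_def cn[OF 2(1-3)] Suc
          by (intro CollectI exI[of _ m] exI[of _ "(False, i)"] exI[of _ c]) simp
      qed
    next
      fix y assume "y \<in> degenerate_gens n"
      then obtain b i c where y: "deg_ok m (b, i)" "chain m c"
        "y = qb n (frag_extend (\<lambda>z. frag_of (deg m (b, i) z)) c)"
        using Suc by (auto simp: degenerate_gens_def simp del: deg.simps deg_ok.simps)
      have c: "qb m c \<in> carrier (grp A m)" using y carrier by auto
      show "y \<in> {gact A n (n - 1) (degen n i) a |i a. 1 \<le> i \<and> i \<le> n \<and> a \<in> carrier (grp A (n - 1))} \<union>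
        {gact A n (n - 1) (conn n i False) a |i a. 1 \<le> i \<and> i \<le> n - 1 \<and> a \<in> carrier (grp A (n - 1))}"
      proof (cases b)
        case True
        then have "1 \<le> i" "i \<le> Suc m" using y by auto
        then have "y = gact A n (n - 1) (degen n i) (qb m c)"
          using dg[of i c] y Suc True by simp
        then show ?thesis using c Suc \<open>1 \<le> i\<close> \<open>i \<le> Suc m\<close> by auto
      next
        case False
        then have "1 \<le> i" "i \<le> m" using y by auto
        then have "y = gact A n (n - 1) (conn n i False) (qb m c)"
          using cn[of i c] y Suc False by simp
        then show ?thesis using c Suc \<open>1 \<le> i\<close> \<open>i \<le> m\<close> by auto
      qed
    qed
  qed
  then show ?thesis by (simp add: degenerate_subgroup_def)
qed

lemma deg_chain:
  assumes "deg_ok m s" "chain m c"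
  shows "chain (Suc m) (frag_extend (\<lambda>z. frag_of (deg m s z)) c)"
  using hom_in_carrier[OF frag_extend_hom[of "cells X m" "\<lambda>z. frag_of (deg m s z)" "cells X (Suc m)"], of c] assms
  by simp

lemma degenerate_gens_carrier: "degenerate_gens n \<subseteq> carrier (grp A n)"
  using deg_chain by (auto simp: degenerate_gens_def carrier_grp simp del: deg.simps deg_ok.simps)

lemma DA_subgroup: "subgroup (DA n) (grp A n)"
  unfolding DA_eq by (rule group.generate_is_subgroup[OF group_grp degenerate_gens_carrier])

lemma comm_group_M: "comm_group (M n)"
  unfolding moore_group_def by (rule comm_group.abelian_FactGroup[OF comm_group_grp DA_subgroup])

lemma group_M: "group (M n)"
  using comm_group_M by (rule comm_group.axioms(2))

section \<open>The passage to the Moore complex\<close>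

definition qd :: "nat \<Rightarrow> ('a \<Rightarrow>\<^sub>0 int) set \<Rightarrow> ('a \<Rightarrow>\<^sub>0 int) set set" where
  "qd n y = DA n #>\<^bsub>grp A n\<^esub> y"

text \<open>Moore chains are cosets of cosets. Representing all of them as \<open>Q n c\<close> lets
  the later computations take place in the free abelian group on cubes.\<close>

definition Q :: "nat \<Rightarrow> ('a \<Rightarrow>\<^sub>0 int) \<Rightarrow> ('a \<Rightarrow>\<^sub>0 int) set set" where
  "Q n c = qd n (qb n c)"

lemma qd_hom: "qd n \<in> hom (grp A n) (M n)"
  unfolding qd_def moore_group_def by (rule comm_group.coset_hom[OF comm_group_grp DA_subgroup])

lemma Q_hom: "Q n \<in> hom (ch n) (M n)"
  using hom_compose[OF qb_hom qd_hom] by (simp add: Q_def[abs_def] comp_def)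

lemma carrier_M: "carrier (M n) = Q n ` carrier (ch n)"
  by (simp add: moore_group_def carrier_FactGroup Q_def[abs_def] qd_def[abs_def] carrier_grp image_image)

lemma qd_eq_one:
  assumes "y \<in> carrier (grp A n)"
  shows "qd n y = \<one>\<^bsub>M n\<^esub> \<longleftrightarrow> y \<in> DA n"
  using group.coset_join1[OF group_grp _ _ DA_subgroup, of n y]
    group.coset_join2[OF group_grp _ DA_subgroup, of y n] assms
  by (auto simp: qd_def moore_group_def)

lemma qb_carrier: "chain n c \<Longrightarrow> qb n c \<in> carrier (grp A n)"
  by (auto simp: carrier_grp)

lemma Q_carrier: "chain n c \<Longrightarrow> Q n c \<in> carrier (M n)"
  by (auto simp: carrier_M)

lemma Q_deg:
  assumes "deg_ok m s" "z \<in> cells X m"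
  shows "Q (Suc m) (frag_of (deg m s z)) = \<one>\<^bsub>M (Suc m)\<^esub>"
proof -
  have "qb (Suc m) (frag_extend (\<lambda>z. frag_of (deg m s z)) (frag_of z)) \<in> degenerate_gens (Suc m)"
    unfolding degenerate_gens_def using assms
    by (intro CollectI exI[of _ m] exI[of _ s] exI[of _ "frag_of z"]) auto
  then have "qb (Suc m) (frag_of (deg m s z)) \<in> DA (Suc m)"
    unfolding DA_eq by (simp add: generate.incl)
  then show ?thesis
    unfolding Q_def using qd_eq_one[OF qb_carrier] assms by simp
qed

lemma Q_pt: "Q n (frag_of (pt n)) = \<one>\<^bsub>M n\<^esub>"
  unfolding Q_def qb_pt using group_hom.hom_one[of "grp A n" "M n" "qd n"] qd_hom group_grp group_M
  by (simp add: group_hom_def group_hom_axioms_def)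

text \<open>The universal property of the Moore group: a homomorphism that kills the basepoint and
  all degenerate cubes factors through \<open>Q n\<close>. Only this consequence is needed, so no
  quotient homomorphism is formed; instead the image of the kernel of \<open>g\<close> is shown to
  contain the degenerate subgroup.\<close>

lemma Q_kernel:
  assumes K: "group K" and g: "g \<in> hom (ch n) K" and gpt: "g (frag_of (pt n)) = \<one>\<^bsub>K\<^esub>"
    and gdeg: "\<And>m s z. n = Suc m \<Longrightarrow> deg_ok m s \<Longrightarrow> z \<in> cells X m \<Longrightarrow> g (frag_of (deg m s z)) = \<one>\<^bsub>K\<^esub>"
    and c: "chain n c" and Q: "Q n c = \<one>\<^bsub>M n\<^esub>"
  shows "g c = \<one>\<^bsub>K\<^esub>"
proof -
  interpret K: group K by fact
  interpret g: group_hom "ch n" K g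
    using g group_ch by (simp add: group_hom_def group_hom_axioms_def K.is_group)
  interpret qb: group_hom "ch n" "grp A n" "qb n"
    using qb_hom group_ch group_grp by (simp add: group_hom_def group_hom_axioms_def)
  have "degenerate_gens n \<subseteq> qb n ` kernel (ch n) K g"
  proof
    fix y assume "y \<in> degenerate_gens n"
    then obtain m s d where d: "n = Suc m" "deg_ok m s" "chain m d"
      "y = qb n (frag_extend (\<lambda>z. frag_of (deg m s z)) d)"
      by (auto simp: degenerate_gens_def simp del: deg.simps deg_ok.simps)
    have "g \<circ> frag_extend (\<lambda>z. frag_of (deg m s z)) \<in> hom (free_Abelian_group (cells X m)) K"
      by (rule hom_compose[OF frag_extend_hom[of _ _ "cells X n"]]) (use g d(1,2) in \<open>auto simp: ch_def\<close>)
    then have "(g \<circ> frag_extend (\<lambda>z. frag_of (deg m s z))) d = \<one>\<^bsub>K\<^esub>"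
      by (rule hom_eq_on_generators[OF K, where g = "\<lambda>_. \<one>\<^bsub>K\<^esub>"])
         (use gdeg[OF d(1,2)] d(3) in \<open>auto simp: hom_def\<close>)
    then have "g (frag_extend (\<lambda>z. frag_of (deg m s z)) d) = \<one>\<^bsub>K\<^esub>" by simp
    then show "y \<in> qb n ` kernel (ch n) K g"
      using d deg_chain[OF d(2,3)] by (auto simp: kernel_def)
  qed
  moreover have "subgroup (qb n ` kernel (ch n) K g) (grp A n)"
    by (rule qb.subgroup_img_is_subgroup[OF g.subgroup_kernel])
  ultimately have "DA n \<subseteq> qb n ` kernel (ch n) K g"
    unfolding DA_eq using group.generate_subgroup_incl[OF group_grp] by blast
  moreover have "qb n c \<in> DA n"
    using Q qd_eq_one[OF qb_carrier[OF c]] by (simp add: Q_def)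
  ultimately obtain k where k: "chain n k" "g k = \<one>\<^bsub>K\<^esub>" "qb n c = qb n k"
    by (auto simp: kernel_def)
  \<comment> \<open>\<open>c\<close> and an element \<open>k\<close> of the kernel agree modulo the
    basepoint, on which \<open>g\<close> vanishes too.\<close>
  have "c \<otimes>\<^bsub>ch n\<^esub> inv\<^bsub>ch n\<^esub> k \<in> base_subgroup X x n"
    using k(3) comm_group.coset_eq_iff[OF comm_group_ch base_subgroup, of c n k] c k(1)
    unfolding qb_def by auto
  then have "g (c \<otimes>\<^bsub>ch n\<^esub> inv\<^bsub>ch n\<^esub> k) = \<one>\<^bsub>K\<^esub>"
    by (rule base_subgroup_trivial[OF K g gpt])
  moreover have "g (c \<otimes>\<^bsub>ch n\<^esub> inv\<^bsub>ch n\<^esub> k) = g c"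
    using hom_diff_free_Abelian_group[OF K g[unfolded ch_def]] g.hom_closed[of c] c k by simp
  ultimately show ?thesis by simp
qed

end

section \<open>The boundary operator\<close>

lemma (in comm_group) finprod_pair:
  assumes "finite I" "f \<in> I \<rightarrow> carrier G" "a \<in> I" "b \<in> I" "a \<noteq> b"
    and "\<And>i. i \<in> I \<Longrightarrow> i \<noteq> a \<Longrightarrow> i \<noteq> b \<Longrightarrow> f i = \<one>"
  shows "finprod G f I = f a \<otimes> f b"
proof -
  have "finprod G f {a, b} = finprod G f I"
    by (rule finprod_mono_neutral_cong_left) (use assms in auto)
  then show ?thesis using assms by (auto simp: Pi_def)
qed

lemma (in comm_group) finprod_triple:
  assumes "finite I" "f \<in> I \<rightarrow> carrier G" "a \<in> I" "b \<in> I" "c \<in> I" "a \<noteq> b" "a \<noteq> c" "b \<noteq> c"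
    and "\<And>i. i \<in> I \<Longrightarrow> i \<noteq> a \<Longrightarrow> i \<noteq> b \<Longrightarrow> i \<noteq> c \<Longrightarrow> f i = \<one>"
  shows "finprod G f I = f a \<otimes> (f b \<otimes> f c)"
proof -
  have "finprod G f {a, b, c} = finprod G f I"
    by (rule finprod_mono_neutral_cong_left) (use assms in auto)
  then show ?thesis using assms by (auto simp: Pi_def)
qed

lemma frag_extend_sum_cmul:
  "frag_extend (\<lambda>z. \<Sum>y\<in>I. frag_cmul (k y) (frag_of (g y z))) c =
    (\<Sum>y\<in>I. frag_cmul (k y) (frag_extend (\<lambda>z. frag_of (g y z)) c))"
  unfolding frag_extend_def frag_cmul_sum by (subst sum.swap) (simp add: mult.commute)

context pointed_chains
begin

definition bdry :: "nat \<Rightarrow> 'a \<Rightarrow> 'a \<Rightarrow>\<^sub>0 int" where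
  "bdry m z = (\<Sum>y\<in>facets (Suc m). frag_cmul (face_sign y) (frag_of (fc m (fst y) (snd y) z)))"

definition bd :: "nat \<Rightarrow> ('a \<Rightarrow>\<^sub>0 int) \<Rightarrow> 'a \<Rightarrow>\<^sub>0 int" where
  "bd m = frag_extend (bdry m)"

lemma bd_of [simp]: "bd m (frag_of z) = bdry m z"
  by (simp add: bd_def)

lemma bdry_chain:
  assumes "z \<in> cells X (Suc m)"
  shows "chain m (bdry m z)"
proof -
  have "frag_cmul (face_sign y) (frag_of (fc m (fst y) (snd y) z)) \<in> carrier (free_Abelian_group (cells X m))"
    if "y \<in> facets (Suc m)" for y
  proof -
    have "fc m (fst y) (snd y) z \<in> cells X m" using assms that by auto
    then show ?thesis by auto
  qed
  then have "bdry m z \<in> carrier (free_Abelian_group (cells X m))"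
    unfolding bdry_def by (rule sum_closed_free_Abelian_group)
  then show ?thesis by simp
qed

lemma bd_hom: "bd m \<in> hom (ch (Suc m)) (ch m)"
  unfolding bd_def ch_def by (rule frag_extend_hom[OF bdry_chain])

lemma bd_chain: "chain (Suc m) c \<Longrightarrow> chain m (bd m c)"
  using hom_in_carrier[OF bd_hom, of c m] by simp

lemma hom_bdry:
  assumes "comm_group K" "g \<in> hom (ch m) K" "z \<in> cells X (Suc m)"
  shows "g (bdry m z) = finprod K (\<lambda>y. g (frag_of (fc m (fst y) (snd y) z)) [^]\<^bsub>K\<^esub> face_sign y) (facets (Suc m))"
  unfolding bdry_def
  by (rule hom_frag_sum[OF assms(1) assms(2)[unfolded ch_def]]) (use assms(3) in auto)

lemma chain_diff_gact:
  "chain_diff A (Suc m) y = finprod (grp A m)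
    (\<lambda>z. gact A m (Suc m) (face (Suc m) (fst z) (snd z)) y [^]\<^bsub>grp A m\<^esub> face_sign z) (facets (Suc m))"
  by (simp add: chain_diff_def case_prod_unfold)

lemma chain_diff_qb:
  assumes c: "chain (Suc m) c"
  shows "chain_diff A (Suc m) (qb (Suc m) c) = qb m (bd m c)"
proof -
  interpret comm_group "grp A m" by (rule comm_group_grp)
  let ?f = "\<lambda>y. frag_extend (\<lambda>z. frag_of (fc m (fst y) (snd y) z)) c"
  have keys: "chain m (?f y)" if "y \<in> facets (Suc m)" for y
    using hom_in_carrier[OF frag_extend_hom[of "cells X (Suc m)" "\<lambda>z. frag_of (fc m (fst y) (snd y) z)" "cells X m"], of c]
      that c by auto
  have "chain_diff A (Suc m) (qb (Suc m) c) =
      finprod (grp A m) (\<lambda>y. qb m (?f y) [^]\<^bsub>grp A m\<^esub> face_sign y) (facets (Suc m))"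
    unfolding chain_diff_gact
  proof (rule finprod_cong')
    show "(\<lambda>y. qb m (?f y) [^]\<^bsub>grp A m\<^esub> face_sign y) \<in> facets (Suc m) \<rightarrow> carrier (grp A m)"
      using qb_carrier[OF keys] by auto
    show "gact A m (Suc m) (face (Suc m) (fst y) (snd y)) (qb (Suc m) c) [^]\<^bsub>grp A m\<^esub> face_sign y =
        qb m (?f y) [^]\<^bsub>grp A m\<^esub> face_sign y" if "y \<in> facets (Suc m)" for y
      using that c gact_qb[OF box_face'[of "fst y" m "snd y"] c] by (auto simp: fc_def)
  qed simp
  also have "\<dots> = qb m (\<Sum>y\<in>facets (Suc m). frag_cmul (face_sign y) (?f y))"
    by (rule hom_frag_sum[symmetric, OF comm_group_grp qb_hom[unfolded ch_def]]) (use keys in auto)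
  also have "(\<Sum>y\<in>facets (Suc m). frag_cmul (face_sign y) (?f y)) = bd m c"
    unfolding bd_def bdry_def by (rule frag_extend_sum_cmul[symmetric])
  finally show ?thesis .
qed

lemma Q_fc_dg:
  assumes "c \<in> cells X m" "1 \<le> i" "i \<le> Suc m" "1 \<le> j" "j \<le> Suc m" "j \<noteq> i"
  shows "Q m (frag_of (fc m j e (dg m i c))) = \<one>\<^bsub>M m\<^esub>"
proof -
  obtain l where l: "m = Suc l" using assms by (cases m) auto
  show ?thesis
  proof (cases "j < i")
    case True
    then obtain i' where "i = Suc i'" by (cases i) auto
    then show ?thesis
      using assms True l fc_dg_lt[of c l j i' e] Q_deg[of l "(True, i')" "fc l j e c"] by simp
  next
    case False
    then obtain j' where "j = Suc j'" by (cases j) (use assms in auto)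
    then show ?thesis
      using assms False l fc_dg_gt[of c l i j' e] Q_deg[of l "(True, i)" "fc l j' e c"] by simp
  qed
qed

lemma Q_fc_cn:
  assumes "c \<in> cells X m" "1 \<le> i" "i \<le> m" "1 \<le> j" "j \<le> Suc m" "\<not> ((j = i \<or> j = Suc i) \<and> \<not> e)"
  shows "Q m (frag_of (fc m j e (cn m i c))) = \<one>\<^bsub>M m\<^esub>"
proof -
  obtain l where l: "m = Suc l" using assms by (cases m) auto
  consider "j < i" | "j = i \<or> j = Suc i" "e" | "Suc i < j" using assms(6) by linarith
  then show ?thesis
  proof cases
    case 1
    then obtain i' where "i = Suc i'" by (cases i) auto
    then show ?thesis
      using assms 1 l fc_cn_lt[of c l j i' e] Q_deg[of l "(False, i')" "fc l j e c"] by simp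
  next
    case 2
    then show ?thesis
      using assms l fc_cn_True[of c l i j] Q_deg[of l "(True, i)" "fc l i True c"] by auto
  next
    case 3
    then obtain j' where "j = Suc j'" by (cases j) auto
    then show ?thesis
      using assms 3 l fc_cn_gt[of c l i j' e] Q_deg[of l "(False, i)" "fc l j' e c"] by simp
  qed
qed

text \<open>Two facets return the original cube with opposite signs and cancel:
  \<open>(i, False)\<close> and \<open>(i, True)\<close> for a degeneracy, \<open>(i, False)\<close>
  and \<open>(Suc i, False)\<close> for a connection. All other facets are degenerate.\<close>

lemma Q_bdry_deg:
  assumes s: "deg_ok m s" and c: "c \<in> cells X m"
  shows "Q m (bdry m (deg m s c)) = \<one>\<^bsub>M m\<^esub>"
proof -
  interpret comm_group "M m" by (rule comm_group_M)
  obtain b i where bi: "s = (b, i)" by (cases s)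
  let ?z = "deg m s c"
  let ?q = "\<lambda>y. Q m (frag_of (fc m (fst y) (snd y) ?z))"
  have z: "?z \<in> cells X (Suc m)" using s c by simp
  have q: "?q y \<in> carrier (M m)" if "y \<in> facets (Suc m)" for y
    using that z by (intro Q_carrier) auto
  have f: "(\<lambda>y. ?q y [^]\<^bsub>M m\<^esub> face_sign y) \<in> facets (Suc m) \<rightarrow> carrier (M m)"
    using q by auto
  obtain u v where uv: "u \<in> facets (Suc m)" "v \<in> facets (Suc m)" "u \<noteq> v" "?q u = ?q v"
    "face_sign u + face_sign v = 0"
    and other: "\<And>y. y \<in> facets (Suc m) \<Longrightarrow> y \<noteq> u \<Longrightarrow> y \<noteq> v \<Longrightarrow> ?q y = \<one>\<^bsub>M m\<^esub>"
  proof (cases b)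
    case True
    have i: "1 \<le> i" "i \<le> Suc m" using s bi True by auto
    show thesis
      by (rule that[of "(i, False)" "(i, True)"])
         (use i bi True c Q_fc_dg in \<open>auto simp: mem_Times_iff\<close>)
  next
    case False
    have i: "1 \<le> i" "i \<le> m" using s bi False by auto
    show thesis
    proof (rule that[of "(i, False)" "(Suc i, False)"])
      fix y assume "y \<in> facets (Suc m)" "y \<noteq> (i, False)" "y \<noteq> (Suc i, False)"
      then show "?q y = \<one>\<^bsub>M m\<^esub>"
        using Q_fc_cn[OF c i, of "fst y" "snd y"] bi False by (cases y) auto
    qed (use i bi False c fc_cn_False in auto)
  qed
  have "Q m (bdry m ?z) = finprod (M m) (\<lambda>y. ?q y [^]\<^bsub>M m\<^esub> face_sign y) (facets (Suc m))"
    by (rule hom_bdry[OF comm_group_M Q_hom z])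
  also have "\<dots> = ?q u [^]\<^bsub>M m\<^esub> face_sign u \<otimes>\<^bsub>M m\<^esub> ?q v [^]\<^bsub>M m\<^esub> face_sign v"
    by (rule finprod_pair[OF _ f uv(1-3)]) (use other in auto)
  also have "\<dots> = ?q u [^]\<^bsub>M m\<^esub> (face_sign u + face_sign v)"
    using uv(4) int_pow_mult[OF q[OF uv(1)]] by simp
  also have "\<dots> = \<one>\<^bsub>M m\<^esub>"
    using uv(5) by simp
  finally show ?thesis .
qed

lemma Q_bd_kernel:
  assumes c: "chain (Suc m) c" and Q: "Q (Suc m) c = \<one>\<^bsub>M (Suc m)\<^esub>"
  shows "Q m (bd m c) = \<one>\<^bsub>M m\<^esub>"
proof -
  have g: "Q m \<circ> bd m \<in> hom (ch (Suc m)) (M m)"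
    by (rule hom_compose[OF bd_hom Q_hom])
  have deg: "(Q m \<circ> bd m) (frag_of (deg m s z)) = \<one>\<^bsub>M m\<^esub>" if "deg_ok m s" "z \<in> cells X m" for s z
    using Q_bdry_deg[OF that] by simp
  have pt: "(Q m \<circ> bd m) (frag_of (pt (Suc m))) = \<one>\<^bsub>M m\<^esub>"
    using deg[of "(True, 1)" "pt m"] by simp
  have "(Q m \<circ> bd m) c = \<one>\<^bsub>M m\<^esub>"
    by (rule Q_kernel[OF group_M g pt _ c Q]) (use deg in blast)
  then show ?thesis by simp
qed

text \<open>This moves the Moore differential to free chains. The induced map is well defined since
  boundaries of degenerate chains are degenerate, by \<open>Q_bd_kernel\<close>.\<close>

lemma moore_diff_Q:
  assumes c: "chain (Suc m) c"
  shows "moore_diff A (Suc m) (Q (Suc m) c) = Q m (bd m c)"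
proof -
  have hom: "chain_diff A (Suc m) \<in> hom (grp A (Suc m)) (grp A m)"
  proof (rule homI)
    fix y assume "y \<in> carrier (grp A (Suc m))"
    then show "chain_diff A (Suc m) y \<in> carrier (grp A m)"
      using chain_diff_qb qb_carrier[OF bd_chain] by (auto simp: carrier_grp[of "Suc m"])
  next
    fix y y' assume "y \<in> carrier (grp A (Suc m))" "y' \<in> carrier (grp A (Suc m))"
    then obtain c c' where c: "chain (Suc m) c" "y = qb (Suc m) c"
      "chain (Suc m) c'" "y' = qb (Suc m) c'"
      by (auto simp: carrier_grp)
    have sum: "chain (Suc m) (c + c')"
      using keys_add[of c c'] c by blast
    have "y \<otimes>\<^bsub>grp A (Suc m)\<^esub> y' = qb (Suc m) (c + c')"
      using hom_mult[OF qb_hom, of c "Suc m" c'] c by simp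
    moreover have "qb m (bd m (c + c')) = qb m (bd m c) \<otimes>\<^bsub>grp A m\<^esub> qb m (bd m c')"
      using hom_mult[OF qb_hom, of "bd m c" m "bd m c'"] bd_chain c by (simp add: bd_def frag_extend_add)
    ultimately show "chain_diff A (Suc m) (y \<otimes>\<^bsub>grp A (Suc m)\<^esub> y') =
        chain_diff A (Suc m) y \<otimes>\<^bsub>grp A m\<^esub> chain_diff A (Suc m) y'"
      using chain_diff_qb c sum by simp
  qed
  have "chain_diff A (Suc m) ` DA (Suc m) \<subseteq> DA m"
  proof
    fix y assume "y \<in> chain_diff A (Suc m) ` DA (Suc m)"
    then obtain y' where y': "y' \<in> DA (Suc m)" "y = chain_diff A (Suc m) y'" by auto
    then have "y' \<in> carrier (grp A (Suc m))" using subgroup.subset[OF DA_subgroup] by blast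
    then obtain c where c: "chain (Suc m) c" "y' = qb (Suc m) c"
      by (auto simp: carrier_grp)
    have "Q (Suc m) c = \<one>\<^bsub>M (Suc m)\<^esub>"
      using y' c qd_eq_one[OF qb_carrier[OF c(1)]] by (simp add: Q_def)
    then have "qd m (qb m (bd m c)) = \<one>\<^bsub>M m\<^esub>" using Q_bd_kernel c by (simp add: Q_def)
    then show "y \<in> DA m"
      using qd_eq_one[OF qb_carrier[OF bd_chain[OF c(1)]]] y' c chain_diff_qb by simp
  qed
  then have "quot_map (grp A m) (DA m) (chain_diff A (Suc m)) (DA (Suc m) #>\<^bsub>grp A (Suc m)\<^esub> qb (Suc m) c) =
      DA m #>\<^bsub>grp A m\<^esub> chain_diff A (Suc m) (qb (Suc m) c)"
    by (intro quot_map_coset comm_group_grp DA_subgroup hom qb_carrier c)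
  then show ?thesis
    using chain_diff_qb[OF c] by (simp add: moore_diff_def Q_def qd_def)
qed

lemma bd_bdry:
  assumes z: "z \<in> cells X (Suc (Suc m))"
  shows "bd m (bdry (Suc m) z) = 0"
proof -
  let ?I = "facets (Suc (Suc m))" and ?J = "facets (Suc m)"
  let ?T = "\<lambda>(y, y'). frag_cmul (face_sign y * face_sign y')
    (frag_of (fc m (fst y') (snd y') (fc (Suc m) (fst y) (snd y) z)))"
  let ?U = "{(y, y') \<in> ?I \<times> ?J. fst y' < fst y}" and ?V = "{(y, y') \<in> ?I \<times> ?J. fst y \<le> fst y'}"
  have "bd m (bdry (Suc m) z) =
      (\<Sum>y\<in>?I. frag_cmul (face_sign y) (bdry m (fc (Suc m) (fst y) (snd y) z)))"
    unfolding bdry_def[of "Suc m"] bd_def by (subst frag_extend_sum) (auto simp: frag_extend_cmul)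
  also have "\<dots> = (\<Sum>y\<in>?I. \<Sum>y'\<in>?J. ?T (y, y'))"
    by (simp add: bdry_def frag_cmul_sum)
  also have "\<dots> = sum ?T (?I \<times> ?J)"
    by (simp add: sum.cartesian_product)
  also have "?I \<times> ?J = ?U \<union> ?V" by auto
  also have "sum ?T (?U \<union> ?V) = sum ?T ?U + sum ?T ?V"
    by (rule sum.union_disjoint) (auto intro: finite_subset[of _ "?I \<times> ?J"])
  \<comment> \<open>The cubical identity exchanges the two faces and lowers the larger direction by
    one, which reverses the sign.\<close>
  also have "sum ?T ?U = sum (\<lambda>w. - ?T w) ?V"
  proof (rule sum.reindex_bij_witness[where
        j = "\<lambda>((i, e), (j, d)). ((j, d), (i - 1, e))" and i = "\<lambda>((i, e), (j, d)). ((Suc j, d), (i, e))"])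
    fix w assume "w \<in> ?U"
    then obtain i e j d where w: "w = ((i, e), (j, d))" "1 \<le> j" "j < i" "i \<le> Suc (Suc m)"
      by auto
    then obtain i' where i': "i = Suc i'" by (cases i) auto
    show "- ?T ((\<lambda>((i, e), (j, d)). ((j, d), (i - 1, e))) w) = ?T w"
      using fc_fc[OF z, of j i' d e] w i' by (simp add: power_add mult.commute)
  qed auto
  finally show ?thesis by (simp add: sum_negf)
qed

lemma bd_bd:
  assumes "chain (Suc (Suc m)) c"
  shows "bd m (bd (Suc m) c) = 0"
proof -
  have hom: "bd m \<circ> bd (Suc m) \<in> hom (free_Abelian_group (cells X (Suc (Suc m)))) (ch m)"
    unfolding ch_def[symmetric] by (rule hom_compose[OF bd_hom bd_hom])
  have "(bd m \<circ> bd (Suc m)) c = (\<lambda>_. \<one>\<^bsub>ch m\<^esub>) c"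
    by (rule hom_eq_on_generators[OF group_ch hom _ _ assms]) (auto simp: hom_def bd_bdry)
  then show ?thesis by simp
qed

section \<open>Cycles, boundaries and reduced homology\<close>

definition boundaries :: "nat \<Rightarrow> ('a \<Rightarrow>\<^sub>0 int) set set set" where
  "boundaries n = moore_diff A (Suc n) ` carrier (M (Suc n))"

lemma boundaries_eq: "boundaries n = (\<lambda>w. Q n (bd n w)) ` {w. chain (Suc n) w}"
  unfolding boundaries_def carrier_M image_image by (rule image_cong) (auto simp: moore_diff_Q)

lemma moore_diff_hom: "moore_diff A (Suc m) \<in> hom (M (Suc m)) (M m)"
proof (rule homI)
  fix y assume "y \<in> carrier (M (Suc m))"
  then show "moore_diff A (Suc m) y \<in> carrier (M m)"
    using moore_diff_Q Q_carrier[OF bd_chain] by (auto simp: carrier_M[of "Suc m"])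
next
  fix y y' assume "y \<in> carrier (M (Suc m))" "y' \<in> carrier (M (Suc m))"
  then obtain c c' where c: "chain (Suc m) c" "y = Q (Suc m) c"
    "chain (Suc m) c'" "y' = Q (Suc m) c'"
    by (auto simp: carrier_M)
  have sum: "chain (Suc m) (c + c')"
    using keys_add[of c c'] c by blast
  have "y \<otimes>\<^bsub>M (Suc m)\<^esub> y' = Q (Suc m) (c + c')"
    using hom_mult[OF Q_hom, of c "Suc m" c'] c by simp
  moreover have "Q m (bd m (c + c')) = Q m (bd m c) \<otimes>\<^bsub>M m\<^esub> Q m (bd m c')"
    using hom_mult[OF Q_hom, of "bd m c" m "bd m c'"] bd_chain c by (simp add: bd_def frag_extend_add)
  ultimately show "moore_diff A (Suc m) (y \<otimes>\<^bsub>M (Suc m)\<^esub> y') =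
      moore_diff A (Suc m) y \<otimes>\<^bsub>M m\<^esub> moore_diff A (Suc m) y'"
    using moore_diff_Q c sum by simp
qed

lemma boundaries_subgroup: "subgroup (boundaries n) (M n)"
proof -
  interpret group_hom "M (Suc n)" "M n" "moore_diff A (Suc n)"
    using moore_diff_hom group_M by (simp add: group_hom_def group_hom_axioms_def)
  show ?thesis unfolding boundaries_def by (rule img_is_subgroup)
qed

definition cycles :: "nat \<Rightarrow> ('a \<Rightarrow>\<^sub>0 int) set set set" where
  "cycles n = kernel (M n) (M (n - 1)) (moore_diff A n)"

lemma cycles_Suc: "cycles (Suc m) = Q (Suc m) ` {c. chain (Suc m) c \<and> Q m (bd m c) = \<one>\<^bsub>M m\<^esub>}"
  unfolding cycles_def kernel_def carrier_M using moore_diff_Q by auto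

lemma cycles_subgroup: "subgroup (cycles (Suc m)) (M (Suc m))"
proof -
  interpret group_hom "M (Suc m)" "M m" "moore_diff A (Suc m)"
    using moore_diff_hom group_M by (simp add: group_hom_def group_hom_axioms_def)
  show ?thesis unfolding cycles_def using subgroup_kernel by simp
qed

lemma boundaries_cycles: "boundaries (Suc m) \<subseteq> cycles (Suc m)"
proof -
  have "Q m 0 = \<one>\<^bsub>M m\<^esub>"
    using group_hom.hom_one[of "ch m" "M m" "Q m"] Q_hom group_ch group_M
    by (simp add: group_hom_def group_hom_axioms_def)
  then show ?thesis
    unfolding boundaries_eq cycles_Suc using bd_bd bd_chain by auto
qed

lemma comm_group_cycles: "comm_group ((M (Suc m))\<lparr>carrier := cycles (Suc m)\<rparr>)"
proof -
  interpret comm_group "M (Suc m)" by (rule comm_group_M)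
  have "y \<otimes>\<^bsub>M (Suc m)\<^esub> y' = y' \<otimes>\<^bsub>M (Suc m)\<^esub> y" if "y \<in> cycles (Suc m)" "y' \<in> cycles (Suc m)" for y y'
    using that subgroup.subset[OF cycles_subgroup, of m] by (intro m_comm) blast+
  then show ?thesis
    by (intro group.group_comm_groupI[OF subgroup.subgroup_is_group[OF cycles_subgroup group_M]]) simp
qed

lemma reduced_homology_eq:
  "reduced_homology n X x = (M n)\<lparr>carrier := cycles n\<rparr> Mod boundaries n"
  by (simp add: reduced_homology_def moore_homology_def homology_group_def cycles_def boundaries_def)

lemma moore_class_qb: "moore_class A n (qb n c) = boundaries n #>\<^bsub>M n\<^esub> Q n c"
  by (simp add: moore_class_def homology_class_def boundaries_def Q_def qd_def)

lemma reduced_homology_Suc: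
  shows "comm_group (reduced_homology (Suc m) X x)"
    and "carrier (reduced_homology (Suc m) X x) = (\<lambda>z. boundaries (Suc m) #>\<^bsub>M (Suc m)\<^esub> z) ` cycles (Suc m)"
    and "\<one>\<^bsub>reduced_homology (Suc m) X x\<^esub> = boundaries (Suc m)"
    and "z \<in> cycles (Suc m) \<Longrightarrow> z' \<in> cycles (Suc m) \<Longrightarrow>
      (boundaries (Suc m) #>\<^bsub>M (Suc m)\<^esub> z) \<otimes>\<^bsub>reduced_homology (Suc m) X x\<^esub> (boundaries (Suc m) #>\<^bsub>M (Suc m)\<^esub> z') =
      boundaries (Suc m) #>\<^bsub>M (Suc m)\<^esub> (z \<otimes>\<^bsub>M (Suc m)\<^esub> z')"
proof -
  let ?Z = "(M (Suc m))\<lparr>carrier := cycles (Suc m)\<rparr>"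
  interpret comm_group ?Z by (rule comm_group_cycles)
  have sub: "subgroup (boundaries (Suc m)) ?Z"
    by (rule group.subgroup_incl[OF group_M boundaries_subgroup cycles_subgroup boundaries_cycles])
  have coset: "N #>\<^bsub>?Z\<^esub> z = N #>\<^bsub>M (Suc m)\<^esub> z" for N z
    by (simp add: r_coset_def)
  show "comm_group (reduced_homology (Suc m) X x)"
    unfolding reduced_homology_eq by (rule abelian_FactGroup[OF sub])
  show "carrier (reduced_homology (Suc m) X x) = (\<lambda>z. boundaries (Suc m) #>\<^bsub>M (Suc m)\<^esub> z) ` cycles (Suc m)"
    unfolding reduced_homology_eq by (simp add: carrier_FactGroup coset)
  show "\<one>\<^bsub>reduced_homology (Suc m) X x\<^esub> = boundaries (Suc m)"
    by (simp add: reduced_homology_eq)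
  show "z \<in> cycles (Suc m) \<Longrightarrow> z' \<in> cycles (Suc m) \<Longrightarrow>
      (boundaries (Suc m) #>\<^bsub>M (Suc m)\<^esub> z) \<otimes>\<^bsub>reduced_homology (Suc m) X x\<^esub> (boundaries (Suc m) #>\<^bsub>M (Suc m)\<^esub> z') =
      boundaries (Suc m) #>\<^bsub>M (Suc m)\<^esub> (z \<otimes>\<^bsub>M (Suc m)\<^esub> z')"
    using hom_mult[OF coset_hom[OF sub], of z z'] unfolding reduced_homology_eq by (simp add: coset)
qed

end

section \<open>The Hurewicz homomorphism\<close>

lemma loop_map_funpow: "(loop_map ^^ n) f k = f (n + k)"
  by (induction n arbitrary: k) (simp_all add: loop_map_def)

text \<open>Boundaries of cubes come with an overall sign depending on the dimension; membership in
  a subgroup is insensitive to it.\<close>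

lemma subgroup_int_pow_cancel:
  assumes "group G" "subgroup N G" "a \<in> carrier G" "k = 1 \<or> k = - 1" "a [^]\<^bsub>G\<^esub> (k :: int) \<in> N"
  shows "a \<in> N"
proof -
  interpret group G by fact
  show ?thesis
    using assms int_pow_neg[of a 1] subgroup.m_inv_closed[OF assms(2), of "inv\<^bsub>G\<^esub> a"] by auto
qed

lemma (in comm_group) int_pow_diff_quotient:
  assumes "u \<in> carrier G" "v \<in> carrier G"
  shows "u [^] (k :: int) \<otimes> v [^] (- k) = (u \<otimes> inv v) [^] k"
  using assms by (simp add: int_pow_distrib int_pow_inv int_pow_neg)

lemma sign_cases: "(- 1 :: int) ^ k = 1 \<or> (- 1 :: int) ^ k = - 1"
  by (cases "even k") auto

context pointed_cubical
begin

text \<open>The argument stays with the generated equivalence relation, and so applies directly to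
  the underlying cubical set of the free cubical abelian group.\<close>

lemma pi0_class_eq:
  assumes "homot (Suc m) m a b"
  shows "pi0_class (iter_loop m X x) a = pi0_class (iter_loop m X x) b"
proof -
  have s: "sph m a" "sph m b" using homot_last_sph[OF assms] .
  have "equivclp (homot (Suc m) m) a b" using assms by (rule r_into_equivclp)
  then have "equivclp (homot (Suc m) m) a c \<longleftrightarrow> equivclp (homot (Suc m) m) b c" for c
    using equivclp_trans[of _ a b c] equivclp_trans[of _ b a c] equivclp_sym[of _ a b] by blast
  then show ?thesis
    using s by (simp add: pi0_class_def pi0_rel_iter_loop Image_def)
qed

end

section \<open>Homotopies in the free cubical abelian group\<close>

context pointed_chains
begin

lemma pointed_cubical_underlying: "pointed_cubical (underlying A) \<one>\<^bsub>grp A 0\<^esub>"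
proof
  fix m n \<phi> z assume \<phi>: "box_map m n \<phi>" and "z \<in> cells (underlying A) n"
  then obtain c where c: "chain n c" "z = qb n c"
    by (auto simp: underlying_def carrier_grp)
  have "frag_extend (\<lambda>z. frag_of (act X m n \<phi> z)) \<in> hom (ch n) (ch m)"
    unfolding ch_def by (rule frag_extend_hom) (use act_closed[OF \<phi>] in auto)
  then have "chain m (frag_extend (\<lambda>z. frag_of (act X m n \<phi> z)) c)"
    using hom_in_carrier[of _ "ch n" "ch m" c] c(1) by fastforce
  then show "act (underlying A) m n \<phi> z \<in> cells (underlying A) m"
    using gact_qb[OF \<phi> c(1)] c(2) qb_carrier by (simp add: underlying_def)
next
  fix z n assume "z \<in> cells (underlying A) n"
  then obtain c where c: "chain n c" "z = qb n c"
    by (auto simp: underlying_def carrier_grp)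
  have "frag_extend (\<lambda>z. frag_of (act X n n (\<lambda>xs \<in> cube n. xs) z)) c = frag_extend frag_of c"
    by (rule frag_extend_eq) (use c(1) act_id in auto)
  then show "act (underlying A) n n (\<lambda>xs \<in> cube n. xs) z = z"
    using gact_qb[OF box_id c(1)] c(2) frag_expansion[of c] by (simp add: underlying_def)
next
  fix k m n \<psi> \<phi> z
  assume \<psi>: "box_map k m \<psi>" and \<phi>: "box_map m n \<phi>" and "z \<in> cells (underlying A) n"
  then obtain c where c: "chain n c" "z = qb n c"
    by (auto simp: underlying_def carrier_grp)
  let ?f = "frag_extend (\<lambda>z. frag_of (act X m n \<phi> z))"
  have "?f \<in> hom (ch n) (ch m)"
    unfolding ch_def by (rule frag_extend_hom) (use act_closed[OF \<phi>] in auto)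
  then have f: "chain m (?f c)"
    using hom_in_carrier[of ?f "ch n" "ch m" c] c(1) by simp
  have "frag_extend (\<lambda>z. frag_of (act X k n (compose (cube k) \<phi> \<psi>) z)) c =
      frag_extend (\<lambda>z. frag_of (act X k m \<psi> (act X m n \<phi> z))) c"
    by (rule frag_extend_eq) (use c(1) act_comp[OF \<psi> \<phi>] in auto)
  also have "\<dots> = frag_extend (\<lambda>z. frag_of (act X k m \<psi> z)) (?f c)"
    using frag_extend_compose[of "\<lambda>z. frag_of (act X k m \<psi> z)" "act X m n \<phi>" c] by (simp add: comp_def)
  finally show "act (underlying A) k n (compose (cube k) \<phi> \<psi>) z =
      act (underlying A) k m \<psi> (act (underlying A) m n \<phi> z)"
    using gact_qb[OF box_comp[OF \<psi> \<phi>] c(1)] gact_qb[OF \<phi> c(1)] gact_qb[OF \<psi> f] c(2)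
    by (simp add: underlying_def)
next
  show "\<one>\<^bsub>grp A 0\<^esub> \<in> cells (underlying A) 0"
    using group.is_monoid[OF group_grp] monoid.one_closed by (auto simp: underlying_def)
qed

interpretation Y: pointed_cubical "underlying A" "\<one>\<^bsub>grp A 0\<^esub>"
  by (rule pointed_cubical_underlying)

lemma underlying_pt: "Y.pt n = \<one>\<^bsub>grp A n\<^esub>"
proof -
  have "Y.pt n = gact A n 0 (terminal n) (qb 0 (frag_of (pt 0)))"
    unfolding Y.pt_def const_cube_def qb_pt by (simp add: underlying_def)
  also have "\<dots> = qb n (frag_of (pt n))"
    using gact_qb_of[OF box_terminal pt_in] act_pt[OF box_terminal] by simp
  finally show ?thesis by (simp add: qb_pt)
qed

lemma underlying_fc: "Y.fc n i e y = gact A n (Suc n) (face (Suc n) i e) y"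
  unfolding Y.fc_def by (simp add: underlying_def)

lemma underlying_fc_qb:
  "z \<in> cells X (Suc n) \<Longrightarrow> 1 \<le> i \<Longrightarrow> i \<le> Suc n \<Longrightarrow>
    Y.fc n i e (qb (Suc n) (frag_of z)) = qb n (frag_of (fc n i e z))"
  unfolding underlying_fc fc_def by (rule gact_qb_of[OF box_face'])

lemma underlying_cells: "cells (underlying A) n = qb n ` {c. chain n c}"
  by (auto simp: underlying_def carrier_grp)

lemma eta_sph:
  assumes "sph n a"
  shows "Y.sph n (qb n (frag_of a))"
proof -
  have "Y.fc (n - 1) i e (qb n (frag_of a)) = Y.pt (n - 1)" if "1 \<le> i" "i \<le> n" for i e
  proof -
    obtain m where "n = Suc m" using \<open>1 \<le> i\<close> \<open>i \<le> n\<close> by (cases n) auto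
    then show ?thesis
      using underlying_fc_qb[of a m i e] assms that by (simp add: underlying_pt qb_pt)
  qed
  moreover have "qb n (frag_of a) \<in> cells (underlying A) n"
    unfolding underlying_cells using assms by (intro imageI) simp
  ultimately show ?thesis unfolding Y.sph_def by blast
qed

lemma eta_homot:
  assumes "homot p n a b" "1 \<le> p" "p \<le> Suc n"
  shows "Y.homot p n (qb n (frag_of a)) (qb n (frag_of b))"
proof -
  obtain t where t: "t \<in> cells X (Suc n)" "fc n p False t = a" "fc n p True t = b"
    "\<And>i e. 1 \<le> i \<Longrightarrow> i \<le> Suc n \<Longrightarrow> i \<noteq> p \<Longrightarrow> fc n i e t = pt n"
    using assms by (auto simp: homot_def)
  show ?thesis
    unfolding Y.homot_def
  proof (intro bexI[of _ "qb (Suc n) (frag_of t)"] conjI allI impI)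
    show "Y.fc n p False (qb (Suc n) (frag_of t)) = qb n (frag_of a)"
      "Y.fc n p True (qb (Suc n) (frag_of t)) = qb n (frag_of b)"
      using underlying_fc_qb[OF t(1) assms(2,3)] t by auto
    show "Y.fc n i e (qb (Suc n) (frag_of t)) = Y.pt n" if "1 \<le> i" "i \<le> Suc n" "i \<noteq> p" for i e
      using underlying_fc_qb[OF t(1) that(1,2)] t(4)[OF that] by (simp add: underlying_pt qb_pt)
  qed (use t(1) in \<open>auto simp: underlying_cells\<close>)
qed

text \<open>All faces of a homotopy except its ends are neutral, so its boundary is the difference
  of \<open>u\<close> and \<open>v\<close> up to sign.\<close>

lemma moore_class_homot:
  assumes "Y.homot (Suc n) n u v"
  shows "moore_class A n u = moore_class A n v"
proof -
  interpret G: comm_group "grp A n" by (rule comm_group_grp)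
  interpret M: comm_group "M n" by (rule comm_group_M)
  interpret qd: group_hom "grp A n" "M n" "qd n"
    using qd_hom by (simp add: group_hom_def group_hom_axioms_def group_grp group_M)
  obtain t where t: "t \<in> cells (underlying A) (Suc n)" "Y.fc n (Suc n) False t = u" "Y.fc n (Suc n) True t = v"
    "\<And>i e. 1 \<le> i \<Longrightarrow> i \<le> Suc n \<Longrightarrow> i \<noteq> Suc n \<Longrightarrow> Y.fc n i e t = \<one>\<^bsub>grp A n\<^esub>"
    using assms by (auto simp: Y.homot_def underlying_pt)
  obtain w where w: "chain (Suc n) w" "t = qb (Suc n) w"
    using t(1) by (auto simp: underlying_cells)
  have uv: "u \<in> carrier (grp A n)" "v \<in> carrier (grp A n)"
    using Y.fc_closed[OF t(1), of "Suc n"] t(2,3) by (auto simp: underlying_def)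
  let ?k = "(- 1 :: int) ^ Suc n"
  let ?f = "\<lambda>z. Y.fc n (fst z) (snd z) t [^]\<^bsub>grp A n\<^esub> face_sign z"
  have f: "?f \<in> facets (Suc n) \<rightarrow> carrier (grp A n)"
    using Y.fc_closed[OF t(1)] by (auto simp: underlying_def)
  have "chain_diff A (Suc n) t = finprod (grp A n) ?f (facets (Suc n))"
    unfolding chain_diff_gact underlying_fc ..
  also have "\<dots> = ?f (Suc n, False) \<otimes>\<^bsub>grp A n\<^esub> ?f (Suc n, True)"
  proof (rule G.finprod_pair[OF _ f])
    fix y assume "y \<in> facets (Suc n)" "y \<noteq> (Suc n, False)" "y \<noteq> (Suc n, True)"
    then show "?f y = \<one>\<^bsub>grp A n\<^esub>"
      using t(4)[of "fst y" "snd y"] by (cases y) auto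
  qed auto
  also have "\<dots> = (u \<otimes>\<^bsub>grp A n\<^esub> inv\<^bsub>grp A n\<^esub> v) [^]\<^bsub>grp A n\<^esub> ?k"
    using G.int_pow_diff_quotient[OF uv, of ?k] t(2,3) by simp
  finally have "qd n (chain_diff A (Suc n) t) = (qd n u \<otimes>\<^bsub>M n\<^esub> inv\<^bsub>M n\<^esub> qd n v) [^]\<^bsub>M n\<^esub> ?k"
    using uv qd.hom_int_pow[of "u \<otimes>\<^bsub>grp A n\<^esub> inv\<^bsub>grp A n\<^esub> v" ?k] by simp
  moreover have "qd n (chain_diff A (Suc n) t) \<in> boundaries n"
    using chain_diff_qb[OF w(1)] w by (auto simp: boundaries_eq Q_def)
  ultimately have "(qd n u \<otimes>\<^bsub>M n\<^esub> inv\<^bsub>M n\<^esub> qd n v) [^]\<^bsub>M n\<^esub> ?k \<in> boundaries n"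
    by (simp only:)
  moreover have "qd n u \<otimes>\<^bsub>M n\<^esub> inv\<^bsub>M n\<^esub> qd n v \<in> carrier (M n)"
    using uv by simp
  ultimately have "qd n u \<otimes>\<^bsub>M n\<^esub> inv\<^bsub>M n\<^esub> qd n v \<in> boundaries n"
    using subgroup_int_pow_cancel[OF group_M boundaries_subgroup _ sign_cases] by blast
  then have "boundaries n #>\<^bsub>M n\<^esub> qd n u = boundaries n #>\<^bsub>M n\<^esub> qd n v"
    using M.coset_eq_iff[OF boundaries_subgroup, of "qd n u" "qd n v"] uv by simp
  then show ?thesis
    by (simp add: moore_class_def homology_class_def boundaries_def qd_def)
qed

text \<open>The homology class is constant along each generating homotopy, hence on the whole class,
  and the definite description is determined.\<close>

lemma pi_to_homology_class:
  assumes "Y.sph n u"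
  shows "pi_to_homology A n (pi0_class (iter_loop n (underlying A) \<one>\<^bsub>grp A 0\<^esub>) u) = moore_class A n u"
proof -
  have "moore_class A n b = moore_class A n u" if "equivclp (Y.homot (Suc n) n) u b" for b
    using that
  proof (induction rule: equivclp_induct)
    case (step b c)
    then show ?case using moore_class_homot[of n b c] moore_class_homot[of n c b] by auto
  qed simp
  note invariant = this
  have mem: "b \<in> pi0_class (iter_loop n (underlying A) \<one>\<^bsub>grp A 0\<^esub>) u \<longleftrightarrow>
      Y.sph n b \<and> equivclp (Y.homot (Suc n) n) u b" for b
    using assms by (simp add: pi0_class_def Y.pi0_rel_iter_loop)
  then have "u \<in> pi0_class (iter_loop n (underlying A) \<one>\<^bsub>grp A 0\<^esub>) u"
    using assms by simp
  then show ?thesis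
    unfolding pi_to_homology_def using invariant mem by (intro the_equality) blast+
qed

lemma Q_sph_cycle:
  assumes "sph (Suc m) a"
  shows "Q (Suc m) (frag_of a) \<in> cycles (Suc m)"
proof -
  interpret comm_group "M m" by (rule comm_group_M)
  have "Q m (bdry m a) = finprod (M m) (\<lambda>y. Q m (frag_of (fc m (fst y) (snd y) a)) [^]\<^bsub>M m\<^esub> face_sign y) (facets (Suc m))"
    by (rule hom_bdry[OF comm_group_M Q_hom]) (use assms in simp)
  also have "\<dots> = \<one>\<^bsub>M m\<^esub>"
    by (rule finprod_one_eqI) (use assms Q_pt in auto)
  finally show ?thesis
    unfolding cycles_Suc using assms by (intro image_eqI[of _ _ "frag_of a"]) auto
qed

end

section \<open>The Hurewicz map on representatives\<close>

locale pointed_kan_chains = pointed_kan + pointed_chains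
begin

lemma hurewicz_cls:
  assumes a: "sph n a"
  shows "hurewicz n X x (cls n a) = boundaries n #>\<^bsub>M n\<^esub> Q n (frag_of a)"
proof -
  interpret Y: pointed_cubical "underlying A" "\<one>\<^bsub>grp A 0\<^esub>"
    by (rule pointed_cubical_underlying)
  let ?C = "\<lambda>z. pi0_class (iter_loop n (underlying A) \<one>\<^bsub>grp A 0\<^esub>) (qb n (frag_of z))"
  have eta: "(loop_map ^^ n) (eta X x) 0 z = qb n (frag_of z)" for z
    by (simp add: loop_map_funpow eta_def qb_def ch_def)
  have "?C z = ?C a" if "z \<in> cls n a" for z
  proof -
    have "homot (Suc n) n a z"
      using that homot_direction[OF a, of "Suc n" z] by (simp add: cls_def)
    then show ?thesis
      using Y.pi0_class_eq[OF eta_homot] by simp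
  qed
  moreover have "a \<in> cls n a" using a homot_refl by (simp add: cls_def)
  ultimately have "homotopy_map n (underlying A) \<one>\<^bsub>grp A 0\<^esub> (eta X x) (cls n a) = ?C a"
    unfolding homotopy_map_def pi0_map_def eta by (intro the_equality) blast+
  then show ?thesis
    using pi_to_homology_class[OF eta_sph[OF a]] by (simp add: hurewicz_def moore_class_qb)
qed

text \<open>The boundary of a concatenation square with result \<open>r\<close> is u + v - r up to
  sign, because its remaining facets are constant.\<close>

lemma hurewicz_hom:
  assumes n: "2 \<le> n"
  shows "hurewicz n X x \<in> hom (pi_group n) (reduced_homology n X x)"
proof -
  obtain m where m: "n = Suc m" using n by (cases n) auto
  interpret M: comm_group "M n" by (rule comm_group_M)
  show ?thesis
  proof (rule homI)
    fix P assume "P \<in> carrier (pi_group n)"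
    then obtain a where "sph n a" "P = cls n a" using pi_group_simps[OF n] by (auto simp: pi_set_def)
    then show "hurewicz n X x P \<in> carrier (reduced_homology n X x)"
      using hurewicz_cls[of n a] Q_sph_cycle[of m a] reduced_homology_Suc(2)[of m] m by auto
  next
    fix P P' assume "P \<in> carrier (pi_group n)" "P' \<in> carrier (pi_group n)"
    then obtain u v where u: "sph n u" "P = cls n u" and v: "sph n v" "P' = cls n v"
      using pi_group_simps[OF n] by (auto simp: pi_set_def)
    obtain s where s: "s \<in> cells X (Suc n)" "\<And>i e. 1 \<le> i \<Longrightarrow> i < n \<Longrightarrow> fc n i e s = pt n"
      "fc n n False s = u" "fc n n True s = pt n" "fc n (Suc n) True s = v"
      using concat_exists[OF _ u(1) v(1)] n by auto
    define r where "r = fc n (Suc n) False s"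
    have r: "sph n r" "cls n r = P \<otimes>\<^bsub>pi_group n\<^esub> P'"
      using concat_cls[OF n u(1) v(1) s] u v by (auto simp: r_def)
    let ?q = "\<lambda>a. Q n (frag_of a)"
    have q: "?q u \<in> carrier (M n)" "?q v \<in> carrier (M n)" "?q r \<in> carrier (M n)"
      using u v r by (auto intro: Q_carrier)
    let ?f = "\<lambda>y. ?q (fc n (fst y) (snd y) s) [^]\<^bsub>M n\<^esub> face_sign y"
    have f: "?f \<in> facets (Suc n) \<rightarrow> carrier (M n)"
      using fc_closed[OF s(1)] by (auto intro!: Q_carrier M.int_pow_closed)
    \<comment> \<open>The common sign of the facets \<open>(n, False)\<close> and
      \<open>(Suc n, True)\<close>; the facet \<open>(Suc n, False)\<close> carrying
      \<open>r\<close> has the opposite one.\<close>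
    let ?k = "(- 1 :: int) ^ n"
    have "Q n (bdry n s) = finprod (M n) ?f (facets (Suc n))"
      by (rule hom_bdry[OF comm_group_M Q_hom s(1)])
    also have "\<dots> = ?f (n, False) \<otimes>\<^bsub>M n\<^esub> (?f (Suc n, True) \<otimes>\<^bsub>M n\<^esub> ?f (Suc n, False))"
    proof (rule M.finprod_triple[OF _ f])
      fix y assume "y \<in> facets (Suc n)" "y \<noteq> (n, False)" "y \<noteq> (Suc n, True)" "y \<noteq> (Suc n, False)"
      moreover obtain i e where y: "y = (i, e)" by (cases y)
      ultimately have "1 \<le> i" "i < n \<or> i = n \<and> e" by (cases e; auto)+
      then have "fc n (fst y) (snd y) s = pt n"
        using s(2)[of i e] s(4) y by auto
      then show "?f y = \<one>\<^bsub>M n\<^esub>" by (simp add: Q_pt)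
    qed (use n in auto)
    also have "\<dots> = ?q u [^]\<^bsub>M n\<^esub> ?k \<otimes>\<^bsub>M n\<^esub> (?q v [^]\<^bsub>M n\<^esub> ?k \<otimes>\<^bsub>M n\<^esub> ?q r [^]\<^bsub>M n\<^esub> (- ?k))"
      using s(3,5) by (simp add: r_def)
    also have "\<dots> = (?q u \<otimes>\<^bsub>M n\<^esub> ?q v \<otimes>\<^bsub>M n\<^esub> inv\<^bsub>M n\<^esub> ?q r) [^]\<^bsub>M n\<^esub> ?k"
      using M.int_pow_diff_quotient[OF q(2,3), of ?k] M.int_pow_distrib[of "?q u" "?q v \<otimes>\<^bsub>M n\<^esub> inv\<^bsub>M n\<^esub> ?q r" ?k]
        q M.m_assoc[of "?q u" "?q v" "inv\<^bsub>M n\<^esub> ?q r"] by simp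
    finally have "(?q u \<otimes>\<^bsub>M n\<^esub> ?q v \<otimes>\<^bsub>M n\<^esub> inv\<^bsub>M n\<^esub> ?q r) [^]\<^bsub>M n\<^esub> ?k = Q n (bd n (frag_of s))"
      by simp
    moreover have "Q n (bd n (frag_of s)) \<in> boundaries n"
      using s(1) unfolding boundaries_eq by (intro imageI) simp
    ultimately have "(?q u \<otimes>\<^bsub>M n\<^esub> ?q v \<otimes>\<^bsub>M n\<^esub> inv\<^bsub>M n\<^esub> ?q r) [^]\<^bsub>M n\<^esub> ?k \<in> boundaries n"
      by (simp only:)
    moreover have "?q u \<otimes>\<^bsub>M n\<^esub> ?q v \<otimes>\<^bsub>M n\<^esub> inv\<^bsub>M n\<^esub> ?q r \<in> carrier (M n)"
      using q by simp
    ultimately have "?q u \<otimes>\<^bsub>M n\<^esub> ?q v \<otimes>\<^bsub>M n\<^esub> inv\<^bsub>M n\<^esub> ?q r \<in> boundaries n"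
      using subgroup_int_pow_cancel[OF group_M boundaries_subgroup _ sign_cases] by blast
    then have "boundaries n #>\<^bsub>M n\<^esub> (?q u \<otimes>\<^bsub>M n\<^esub> ?q v) = boundaries n #>\<^bsub>M n\<^esub> ?q r"
      using M.coset_eq_iff[OF boundaries_subgroup, of "?q u \<otimes>\<^bsub>M n\<^esub> ?q v" "?q r"] q by simp
    then show "hurewicz n X x (P \<otimes>\<^bsub>pi_group n\<^esub> P') =
        hurewicz n X x P \<otimes>\<^bsub>reduced_homology n X x\<^esub> hurewicz n X x P'"
      using reduced_homology_Suc(4)[OF Q_sph_cycle Q_sph_cycle, of m u v] u(1) v(1) m
      unfolding r(2)[symmetric] unfolding u(2) v(2) hurewicz_cls[OF r(1)] hurewicz_cls[OF u(1)] hurewicz_cls[OF v(1)]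
      by simp
  qed
qed

section \<open>From chains back to homotopy classes: injectivity\<close>

context
  fixes n H
  assumes n: "2 \<le> n" and H: "\<And>k. k \<le> n \<Longrightarrow> contracts n k H"
begin

lemma contraction_cell: "k \<le> n \<Longrightarrow> c \<in> cells X k \<Longrightarrow> H k c \<in> cells X (Suc k)"
  using H[of k] by (auto simp: contracts_def)

text \<open>Freeness extends the classes of retracted cubes to all n-chains. Degenerate chains die
  by \<open>retract_deg\<close>. For a boundary, the retracted facets again bound a cube and are
  spherical, so homotopy addition applies.\<close>

lemma spherical_hom:
  obtains \<psi> where "\<psi> \<in> hom (ch n) (pi_group n)"
    "\<And>c. c \<in> cells X n \<Longrightarrow> \<psi> (frag_of c) = cls n (retract n H c)"
    "\<And>c. chain n c \<Longrightarrow> Q n c = \<one>\<^bsub>M n\<^esub> \<Longrightarrow> \<psi> c = \<one>\<^bsub>pi_group n\<^esub>"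
    "\<And>w. chain (Suc n) w \<Longrightarrow> \<psi> (bd n w) = \<one>\<^bsub>pi_group n\<^esub>"
proof -
  interpret Pi: comm_group "pi_group n" by (rule pi_group_simps(3)[OF n])
  obtain m where m: "n = Suc m" using n by (cases n) auto
  have "(\<lambda>c. cls n (retract n H c)) ` cells X n \<subseteq> carrier (pi_group n)"
    using retract_sph[OF H] pi_group_simps[OF n] by (auto simp: pi_set_def)
  then obtain \<psi> where \<psi>: "\<psi> \<in> hom (ch n) (pi_group n)"
    "\<And>c. c \<in> cells X n \<Longrightarrow> \<psi> (frag_of c) = cls n (retract n H c)"
    unfolding ch_def using Pi.free_Abelian_group_universal by metis
  have deg: "\<psi> (frag_of (deg k s z)) = \<one>\<^bsub>pi_group n\<^esub>" if "n = Suc k" "deg_ok k s" "z \<in> cells X k" for k s z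
    using \<psi>(2)[of "deg k s z"] retract_deg[OF H that] that pi_group_simps[OF n] by simp
  have "\<psi> (frag_of (pt n)) = \<one>\<^bsub>pi_group n\<^esub>"
    using deg[OF m, of "(True, 1)" "pt m"] m by simp
  then have kernel: "\<psi> c = \<one>\<^bsub>pi_group n\<^esub>" if "chain n c" "Q n c = \<one>\<^bsub>M n\<^esub>" for c
    using Q_kernel[OF Pi.is_group \<psi>(1) _ deg that] by blast
  have bdry: "\<psi> (bdry n w) = \<one>\<^bsub>pi_group n\<^esub>" if w: "w \<in> cells X (Suc n)" for w
  proof -
    obtain w' where w': "w' \<in> cells X (Suc n)"
      "\<And>i e. 1 \<le> i \<Longrightarrow> i \<le> Suc n \<Longrightarrow> fc n i e w' = retract n H (fc n i e w)"
      using retract_filled[OF H w] by blast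
    have cell: "fc n i e w \<in> cells X n" if "1 \<le> i" "i \<le> Suc n" for i e using w that by simp
    have "\<psi> (bdry n w) = finprod (pi_group n) (\<lambda>y. \<psi> (frag_of (fc n (fst y) (snd y) w)) [^]\<^bsub>pi_group n\<^esub> face_sign y) (facets (Suc n))"
      by (rule hom_bdry[OF pi_group_simps(3)[OF n] \<psi>(1) w])
    also have "\<dots> = finprod (pi_group n) (\<lambda>(i, e). cls n (fc n i e w') [^]\<^bsub>pi_group n\<^esub> ((- 1) ^ (i + of_bool e) :: int)) (facets (Suc n))"
    proof (rule Pi.finprod_cong')
      show "(\<lambda>(i, e). cls n (fc n i e w') [^]\<^bsub>pi_group n\<^esub> ((- 1) ^ (i + of_bool e) :: int)) \<in> facets (Suc n) \<rightarrow> carrier (pi_group n)"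
      proof -
        have "cls n (fc n i e w') \<in> carrier (pi_group n)" if "1 \<le> i" "i \<le> Suc n" for i e
          using w'(2)[OF that] retract_sph[OF H cell[OF that]] pi_group_simps(1)[OF n] by (auto simp: pi_set_def)
        then show ?thesis by auto
      qed
      fix y assume "y \<in> facets (Suc n)"
      then show "\<psi> (frag_of (fc n (fst y) (snd y) w)) [^]\<^bsub>pi_group n\<^esub> face_sign y =
          (case y of (i, e) \<Rightarrow> cls n (fc n i e w') [^]\<^bsub>pi_group n\<^esub> ((- 1) ^ (i + of_bool e) :: int))"
        using w'(2) \<psi>(2)[OF cell] by (cases y) auto
    qed simp
    also have "\<dots> = \<one>\<^bsub>pi_group n\<^esub>"
      by (rule homotopy_addition[OF n w'(1)]) (use w'(2) retract_sph[OF H cell] in simp)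
    finally show ?thesis .
  qed
  have comp: "\<psi> \<circ> bd n \<in> hom (free_Abelian_group (cells X (Suc n))) (pi_group n)"
    using hom_compose[OF bd_hom \<psi>(1)] unfolding ch_def[of "Suc n"] .
  have trivial: "(\<lambda>_. \<one>\<^bsub>pi_group n\<^esub>) \<in> hom (free_Abelian_group (cells X (Suc n))) (pi_group n)"
    by (simp add: hom_def)
  have "(\<psi> \<circ> bd n) w = \<one>\<^bsub>pi_group n\<^esub>" if "chain (Suc n) w" for w
    by (rule hom_eq_on_generators[OF Pi.is_group comp trivial _ that]) (simp add: bdry)
  then have boundary: "\<psi> (bd n w) = \<one>\<^bsub>pi_group n\<^esub>" if "chain (Suc n) w" for w
    using that by simp
  show ?thesis by (rule that[OF \<psi> kernel boundary])
qed

lemma hurewicz_inj: "inj_on (hurewicz n X x) (pi_set n)"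
proof (rule inj_onI)
  fix P P' assume "P \<in> pi_set n" "P' \<in> pi_set n" and eq: "hurewicz n X x P = hurewicz n X x P'"
  then obtain a b where a: "sph n a" "P = cls n a" and b: "sph n b" "P' = cls n b"
    by (auto simp: pi_set_def)
  interpret Pi: comm_group "pi_group n" by (rule pi_group_simps(3)[OF n])
  interpret M: comm_group "M n" by (rule comm_group_M)
  obtain \<psi> where \<psi>: "\<psi> \<in> hom (ch n) (pi_group n)"
    "\<And>c. c \<in> cells X n \<Longrightarrow> \<psi> (frag_of c) = cls n (retract n H c)"
    "\<And>c. chain n c \<Longrightarrow> Q n c = \<one>\<^bsub>M n\<^esub> \<Longrightarrow> \<psi> c = \<one>\<^bsub>pi_group n\<^esub>"
    "\<And>w. chain (Suc n) w \<Longrightarrow> \<psi> (bd n w) = \<one>\<^bsub>pi_group n\<^esub>"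
    using spherical_hom by blast
  have q: "Q n (frag_of a) \<in> carrier (M n)" "Q n (frag_of b) \<in> carrier (M n)"
    using a b by (auto intro: Q_carrier)
  have keys: "chain n (frag_of a)" "chain n (frag_of b)"
    using a b by auto
  let ?d = "frag_of a - frag_of b"
  have d: "chain n ?d"
    using keys_diff[of "frag_of a" "frag_of b"] keys by blast
  have "boundaries n #>\<^bsub>M n\<^esub> Q n (frag_of a) = boundaries n #>\<^bsub>M n\<^esub> Q n (frag_of b)"
    using eq a b hurewicz_cls by simp
  then have "Q n ?d \<in> boundaries n"
    using M.coset_eq_iff[OF boundaries_subgroup q] hom_diff_free_Abelian_group[OF group_M Q_hom[unfolded ch_def] keys] by simp
  then obtain w where w: "chain (Suc n) w" "Q n ?d = Q n (bd n w)"
    by (auto simp: boundaries_eq)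
  \<comment> \<open>Equality in the Moore group determines the chains only up to degenerate and
    basepoint chains, and \<open>\<psi>\<close> vanishes on this discrepancy.\<close>
  have dw: "chain n (?d - bd n w)"
    using keys_diff[of ?d "bd n w"] d bd_chain[OF w(1)] by blast
  have "Q n (?d - bd n w) = \<one>\<^bsub>M n\<^esub>"
    using hom_diff_free_Abelian_group[OF group_M Q_hom[unfolded ch_def] d bd_chain[OF w(1)]] w(2)
      Q_carrier[OF bd_chain[OF w(1)]] by simp
  then have "\<psi> (?d - bd n w) = \<one>\<^bsub>pi_group n\<^esub>" using \<psi>(3)[OF dw] by simp
  moreover have d_closed: "\<psi> ?d \<in> carrier (pi_group n)" "\<psi> (frag_of a) \<in> carrier (pi_group n)" "\<psi> (frag_of b) \<in> carrier (pi_group n)"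
    using hom_in_carrier[OF \<psi>(1)] d keys by auto
  ultimately have "\<psi> ?d = \<one>\<^bsub>pi_group n\<^esub>"
    using hom_diff_free_Abelian_group[OF Pi.is_group \<psi>(1)[unfolded ch_def] d bd_chain[OF w(1)]] \<psi>(4)[OF w(1)] by simp
  then have "\<psi> (frag_of a) \<otimes>\<^bsub>pi_group n\<^esub> inv\<^bsub>pi_group n\<^esub> \<psi> (frag_of b) = \<one>\<^bsub>pi_group n\<^esub>"
    using hom_diff_free_Abelian_group[OF Pi.is_group \<psi>(1)[unfolded ch_def] keys] by simp
  then have "\<psi> (frag_of a) = \<psi> (frag_of b)"
    using d_closed Pi.inv_equality[of "\<psi> (frag_of a)" "inv\<^bsub>pi_group n\<^esub> \<psi> (frag_of b)"] by simp
  then have "cls n (retract n H a) = cls n (retract n H b)"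
    using \<psi>(2) a b by simp
  \<comment> \<open>Retraction does not change the class of a spherical cube, so
    \<open>\<psi>\<close> recovers the class from its generator.\<close>
  moreover have "cls n c = cls n (retract n H c)" if "sph n c" for c
    using that cls_eq_iff[of n c "retract n H c"] retract_sph[OF H, of c] retract_homot[OF H that] by simp
  ultimately show "P = P'" using a b by metis
qed

section \<open>The contraction as a chain homotopy: surjectivity\<close>

abbreviation chain_homotopy :: "nat \<Rightarrow> ('a \<Rightarrow>\<^sub>0 int) \<Rightarrow> 'a \<Rightarrow>\<^sub>0 int" where
  "chain_homotopy k \<equiv> frag_extend (\<lambda>c. frag_of (H k c))"

abbreviation chain_retract :: "('a \<Rightarrow>\<^sub>0 int) \<Rightarrow> 'a \<Rightarrow>\<^sub>0 int" where
  "chain_retract \<equiv> frag_extend (\<lambda>c. frag_of (retract n H c))"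

lemma chain_homotopy_hom: "k \<le> n \<Longrightarrow> chain_homotopy k \<in> hom (ch k) (ch (Suc k))"
  unfolding ch_def by (rule frag_extend_hom) (use contraction_cell in auto)

lemma chain_retract_hom: "chain_retract \<in> hom (ch n) (ch n)"
  unfolding ch_def by (rule frag_extend_hom) (use retract_sph[OF H] in auto)

text \<open>The two facets in direction 1 give the lid minus the bottom. The side over
  \<open>(i, e)\<close> lies in direction i + 1, and this shift accounts for the minus sign of the
  last term.\<close>

lemma bdry_contraction:
  assumes m: "n = Suc m" and z: "z \<in> cells X n"
  shows "bdry n (H n z) = frag_of (retract n H z) - frag_of z - chain_homotopy m (bdry m z)"
proof -
  let ?f = "\<lambda>y. frag_cmul (face_sign y) (frag_of (fc n (fst y) (snd y) (H n z)))"
  let ?s = "\<lambda>(i, e). (Suc i, e)"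
  have bottom: "fc n 1 False (H n z) = z"
    and side: "\<And>i e. 1 \<le> i \<Longrightarrow> i \<le> n \<Longrightarrow> fc n (Suc i) e (H n z) = H m (fc m i e z)"
    using H[of n] z m unfolding contracts_def by blast+
  have facets: "facets (Suc n) = {(1, False), (1, True)} \<union> ?s ` facets n"
  proof (intro equalityI subsetI)
    fix y assume "y \<in> facets (Suc n)"
    then obtain i e where y: "y = (i, e)" "1 \<le> i" "i \<le> Suc n" by auto
    show "y \<in> {(1, False), (1, True)} \<union> ?s ` facets n"
    proof (cases "i = 1")
      case False
      then obtain j where "i = Suc j" "1 \<le> j" "j \<le> n" using y by (cases i) auto
      then show ?thesis using y by (intro UnI2 image_eqI[of _ _ "(j, e)"]) auto
    qed (use y in \<open>cases e; auto\<close>)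
  qed auto
  have "bdry n (H n z) = sum ?f ({(1, False), (1, True)} \<union> ?s ` facets n)"
    unfolding bdry_def facets[symmetric] ..
  also have "\<dots> = sum ?f {(1, False), (1, True)} + sum ?f (?s ` facets n)"
    by (rule sum.union_disjoint) auto
  also have "sum ?f {(1, False), (1, True)} = frag_of (retract n H z) - frag_of z"
    using bottom by (simp add: retract_def)
  also have "sum ?f (?s ` facets n) = (\<Sum>y\<in>facets n. ?f (?s y))"
    by (rule sum.reindex[unfolded comp_def]) (auto simp: inj_on_def)
  also have "\<dots> = (\<Sum>y\<in>facets n. - frag_cmul (face_sign y) (frag_of (H m (fc m (fst y) (snd y) z))))"
    by (rule sum.cong) (auto simp: side)
  also have "\<dots> = - (\<Sum>y\<in>facets n. frag_cmul (face_sign y) (frag_of (H m (fc m (fst y) (snd y) z))))"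
    by (rule sum_negf)
  also have "(\<Sum>y\<in>facets n. frag_cmul (face_sign y) (frag_of (H m (fc m (fst y) (snd y) z)))) =
      chain_homotopy m (bdry m z)"
    unfolding bdry_def m by (subst frag_extend_sum) (auto simp: frag_extend_cmul comp_def)
  finally show ?thesis by simp
qed

lemma chain_homotopy_identity:
  assumes m: "n = Suc m" and c: "chain n c"
  shows "bd n (chain_homotopy n c) = chain_retract c - c - chain_homotopy m (bd m c)"
proof -
  have f: "bd n \<circ> chain_homotopy n \<in> hom (free_Abelian_group (cells X n)) (ch n)"
    using hom_compose[OF chain_homotopy_hom bd_hom] unfolding ch_def by blast
  have g: "(\<lambda>c. chain_retract c - c - chain_homotopy m (bd m c)) \<in> hom (free_Abelian_group (cells X n)) (ch n)"
  proof (rule homI)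
    fix c assume c: "c \<in> carrier (free_Abelian_group (cells X n))"
    have "chain n (chain_retract c)"
      using hom_in_carrier[OF chain_retract_hom] c by auto
    moreover have "chain n (chain_homotopy m (bd m c))"
      using hom_in_carrier[OF chain_homotopy_hom, of m "bd m c"] bd_chain[of c m] c m by auto
    moreover have "chain n c" using c by simp
    ultimately have "chain n (chain_retract c - c - chain_homotopy m (bd m c))"
      using keys_diff[of "chain_retract c" c] keys_diff[of "chain_retract c - c" "chain_homotopy m (bd m c)"]
      by blast
    then show "chain_retract c - c - chain_homotopy m (bd m c) \<in> carrier (ch n)" by simp
  qed (simp add: frag_extend_add bd_def)
  have "(bd n \<circ> chain_homotopy n) c = chain_retract c - c - chain_homotopy m (bd m c)"
    by (rule hom_eq_on_generators[OF group_ch f g _ c]) (simp add: bdry_contraction[OF m])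
  then show ?thesis by simp
qed

text \<open>The boundary of a Moore cycle is trivial only after applying \<open>Q\<close>.
  Compatibility of \<open>H\<close> with degeneracies and connections keeps the corresponding term
  of the chain homotopy trivial.\<close>

lemma Q_chain_homotopy:
  assumes m: "n = Suc m" and c: "chain m c" and Q: "Q m c = \<one>\<^bsub>M m\<^esub>"
  shows "Q n (chain_homotopy m c) = \<one>\<^bsub>M n\<^esub>"
proof -
  have g: "Q n \<circ> chain_homotopy m \<in> hom (ch m) (M n)"
    using hom_compose[OF chain_homotopy_hom Q_hom] m by simp
  have "(Q n \<circ> chain_homotopy m) c = \<one>\<^bsub>M n\<^esub>"
  proof (rule Q_kernel[OF group_M g _ _ c Q])
    show "(Q n \<circ> chain_homotopy m) (frag_of (pt m)) = \<one>\<^bsub>M n\<^esub>"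
      using contracts_pt[OF H, of m] Q_pt[of n] m by simp
    fix k s z assume k: "m = Suc k" "deg_ok k s" "z \<in> cells X k"
    have "contracts n m H" using H m by simp
    then have "H m (deg k s z) = deg m (shift s) (H k z)"
      using k unfolding contracts_def by blast
    then show "(Q n \<circ> chain_homotopy m) (frag_of (deg k s z)) = \<one>\<^bsub>M n\<^esub>"
      using Q_deg[of m "shift s" "H k z"] k m contraction_cell[of k z] by simp
  qed
  then show ?thesis by simp
qed

text \<open>The chain homotopy makes a cycle homologous to its retraction, and the class of the
  retraction is the Hurewicz image of its value under \<open>\<psi>\<close>.\<close>

lemma hurewicz_surj: "hurewicz n X x ` pi_set n = carrier (reduced_homology n X x)"
proof
  show "hurewicz n X x ` pi_set n \<subseteq> carrier (reduced_homology n X x)"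
    using hom_in_carrier[OF hurewicz_hom[OF n]] pi_group_simps(1)[OF n] by auto
next
  obtain m where m: "n = Suc m" using n by (cases n) auto
  interpret RH: comm_group "reduced_homology n X x"
    using reduced_homology_Suc(1) m by simp
  interpret M: comm_group "M n" by (rule comm_group_M)
  obtain \<psi> where \<psi>: "\<psi> \<in> hom (ch n) (pi_group n)"
    "\<And>c. c \<in> cells X n \<Longrightarrow> \<psi> (frag_of c) = cls n (retract n H c)"
    "\<And>c. chain n c \<Longrightarrow> Q n c = \<one>\<^bsub>M n\<^esub> \<Longrightarrow> \<psi> c = \<one>\<^bsub>pi_group n\<^esub>"
    "\<And>w. chain (Suc n) w \<Longrightarrow> \<psi> (bd n w) = \<one>\<^bsub>pi_group n\<^esub>"
    using spherical_hom by blast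
  \<comment> \<open>Retraction turns every chain into a combination of spherical cubes, hence into a
    cycle. So \<open>?\<kappa>\<close> is defined on the whole free group, and can be compared with
    the composite of \<open>\<psi>\<close> and the Hurewicz map on single cubes.\<close>
  let ?\<kappa> = "\<lambda>c. boundaries n #>\<^bsub>M n\<^esub> Q n (chain_retract c)"
  have retract: "chain n (chain_retract c)" if "chain n c" for c
    using hom_in_carrier[OF chain_retract_hom, of c] that by simp
  have cycle: "Q n (chain_retract c) \<in> cycles n" if c: "chain n c" for c
  proof -
    have Qn: "Q n \<circ> chain_retract \<in> hom (free_Abelian_group (cells X n)) (M n)"
      using hom_compose[OF chain_retract_hom Q_hom] unfolding ch_def .
    interpret group_hom "free_Abelian_group (cells X n)" "M n" "Q n \<circ> chain_retract"
      using Qn group_M by (simp add: group_hom_def group_hom_axioms_def)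
    have sub: "subgroup (cycles n) (M n)" using cycles_subgroup m by simp
    have "(Q n \<circ> chain_retract) c \<in> cycles n"
    proof (rule free_Abelian_group_induct[OF c])
      show "(Q n \<circ> chain_retract) 0 \<in> cycles n"
        using hom_one subgroup.one_closed[OF sub] by simp
      show "(Q n \<circ> chain_retract) (a - b) \<in> cycles n"
        if "chain n a" "chain n b"
          "(Q n \<circ> chain_retract) a \<in> cycles n" "(Q n \<circ> chain_retract) b \<in> cycles n" for a b
        using hom_diff_free_Abelian_group[OF group_M Qn that(1,2)] that
          subgroup.m_closed[OF sub] subgroup.m_inv_closed[OF sub] by simp
      show "(Q n \<circ> chain_retract) (frag_of a) \<in> cycles n" if "a \<in> cells X n" for a
        using Q_sph_cycle[of m "retract n H a"] retract_sph[OF H that] m by simp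
    qed
    then show ?thesis by simp
  qed
  have \<kappa>: "?\<kappa> \<in> hom (free_Abelian_group (cells X n)) (reduced_homology n X x)"
  proof (rule homI)
    fix c assume "c \<in> carrier (free_Abelian_group (cells X n))"
    then show "?\<kappa> c \<in> carrier (reduced_homology n X x)"
      using cycle reduced_homology_Suc(2) m by auto
  next
    fix c d assume "c \<in> carrier (free_Abelian_group (cells X n))" "d \<in> carrier (free_Abelian_group (cells X n))"
    then show "?\<kappa> (c \<otimes>\<^bsub>free_Abelian_group (cells X n)\<^esub> d) = ?\<kappa> c \<otimes>\<^bsub>reduced_homology n X x\<^esub> ?\<kappa> d"
      using cycle reduced_homology_Suc(4)[of "Q n (chain_retract c)" m "Q n (chain_retract d)"] m
        hom_mult[OF Q_hom, of "chain_retract c" n "chain_retract d"] retract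
      by (simp add: frag_extend_add)
  qed
  have comp: "hurewicz n X x \<circ> \<psi> \<in> hom (free_Abelian_group (cells X n)) (reduced_homology n X x)"
    using hom_compose[OF \<psi>(1) hurewicz_hom[OF n]] unfolding ch_def .
  have \<kappa>_eq: "?\<kappa> c = (hurewicz n X x \<circ> \<psi>) c" if "chain n c" for c
    by (rule hom_eq_on_generators[OF RH.is_group \<kappa> comp _ that])
       (use \<psi>(2) hurewicz_cls retract_sph[OF H] in simp)
  show "carrier (reduced_homology n X x) \<subseteq> hurewicz n X x ` pi_set n"
  proof
    fix h assume "h \<in> carrier (reduced_homology n X x)"
    then obtain c where c: "chain n c" "Q m (bd m c) = \<one>\<^bsub>M m\<^esub>"
      "h = boundaries n #>\<^bsub>M n\<^esub> Q n c"
      using reduced_homology_Suc(2)[of m] cycles_Suc[of m] m by auto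
    have bdc: "chain m (bd m c)" using bd_chain c(1) m by simp
    let ?k = "chain_homotopy n c" and ?l = "chain_homotopy m (bd m c)"
    have k: "chain (Suc n) ?k"
      using hom_in_carrier[OF chain_homotopy_hom, of n c] c(1) by simp
    have l: "chain n ?l"
      using hom_in_carrier[OF chain_homotopy_hom, of m "bd m c"] bdc m by simp
    have rc: "chain n (chain_retract c - c)"
      using keys_diff[of "chain_retract c" c] retract[OF c(1)] c(1) by blast
    have "Q n (bd n ?k) = Q n (chain_retract c - c) \<otimes>\<^bsub>M n\<^esub> inv\<^bsub>M n\<^esub> Q n ?l"
      unfolding chain_homotopy_identity[OF m c(1)]
      by (rule hom_diff_free_Abelian_group[OF group_M Q_hom[unfolded ch_def] rc l])
    also have "\<dots> = Q n (chain_retract c - c)"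
      using Q_chain_homotopy[OF m bdc c(2)] Q_carrier[OF rc] by simp
    also have "\<dots> = Q n (chain_retract c) \<otimes>\<^bsub>M n\<^esub> inv\<^bsub>M n\<^esub> Q n c"
      by (rule hom_diff_free_Abelian_group[OF group_M Q_hom[unfolded ch_def] retract[OF c(1)] c(1)])
    finally have "Q n (chain_retract c) \<otimes>\<^bsub>M n\<^esub> inv\<^bsub>M n\<^esub> Q n c \<in> boundaries n"
      using k by (auto simp: boundaries_eq)
    then have "?\<kappa> c = h"
      using M.coset_eq_iff[OF boundaries_subgroup] Q_carrier[OF c(1)] Q_carrier[OF retract[OF c(1)]] c(3)
      by simp
    moreover have "\<psi> c \<in> pi_set n"
      using hom_in_carrier[OF \<psi>(1), of c] c(1) pi_group_simps(1)[OF n] by simp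
    ultimately show "h \<in> hurewicz n X x ` pi_set n"
      using \<kappa>_eq[OF c(1)] by auto
  qed
qed

end

end

theorem theorem4p16:
  fixes X :: "'a cubical" and x :: 'a and n :: nat
  assumes "kan_complex X"
    and "x \<in> cells X 0"
    and "n \<ge> 2"
    and "m_connected (n - 1) X x"
  shows "hurewicz n X x \<in> iso (homotopy_group n X x) (reduced_homology n X x)"
proof -
  interpret kan_complex X by fact
  interpret pointed_kan_chains X x by unfold_locales (rule assms(2))
  have "homot 1 m a (pt m)" if "m < n" "sph m a" for m a
    using connected_homot[OF assms(4)] that by simp
  then obtain H where H: "\<And>k. k \<le> n \<Longrightarrow> contracts n k H"
    using contracts_exists[of n] assms(3) by auto
  have carrier: "carrier (homotopy_group n X x) = pi_set n"
    using homotopy_group_carrier assms(3) by simp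
  \<comment> \<open>The given homotopy group and \<open>pi_group n\<close> have the same carrier and
    the same product on it, so homomorphisms out of them coincide.\<close>
  have "hurewicz n X x \<in> hom (homotopy_group n X x) (reduced_homology n X x)"
    using hurewicz_hom[OF assms(3)] homotopy_group_mult[OF assms(3)] carrier pi_group_simps(1)[OF assms(3)]
    by (simp add: hom_def)
  then show ?thesis
    using hurewicz_inj[OF assms(3) H] hurewicz_surj[OF assms(3) H] carrier
    by (simp add: iso_def bij_betw_def)
qed

end
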